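(* Let $\Gamma=\mathbb{Z}^2\rtimes\mathcal{C}_s$. A $\mathbb{Z}^2\rtimes\mathcal{C}_s$-gain graph $(G,m)$ is minimally rigid (in $\mathbb{R}^2$) if and only if it is $\mathbb{Z}^2\rtimes\mathcal{C}_s$-tight.
   Context: The group: $\Gamma=\mathbb{Z}^2\rtimes\mathcal{C}_s$ (the wallpaper group $pm$) is the group of isometries of $\mathbb{R}^2$ of the form $x\mapsto \sigma(x)+t$ with $t\in\mathbb{Z}^2$ and $\sigma\in\mathcal{C}_s=\{\mathrm{id},s\}$, $s(x,y)=(x,-y)$. The element $\sigma$ is the $\mathcal{C}_s$-component; elements with trivial $\mathcal{C}_s$-component are translations. For $\gamma\in\Gamma$, $\gamma_l$ denotes its linear part. Gain graphs: A $\Gamma$-gain graph $(G,m)$ is a finite multigraph $G=(V,E)$ (loops and parallel edges allowed) with each edge oriented and labelled by $m(e)\in\Gamma$, such that parallel edges (oriented the same way) have different gains and every loop has non-identity gain. An edge from $v_i$ to $v_j$ is written $(v_i,v_j;m(e))$; reversing its orientation while inverting its gain is regarded as giving the same edge. The net gain of a walk $e_1^{\alpha_1}\cdots e_k^{\alpha_k}$ ($\alpha_i=1$ if $e_i$ is traversed forwards, $-1$ if backwards) is $\prod_{i=1}^k m(e_i)^{\alpha_i}$. The gain space at a vertex $v$ is the subgroup of $\Gamma$ generated by the net gains of closed walks starting and ending at $v$. A gain graph (or subgraph, with the restricted gains) is balanced if its gain space at every vertex is trivial, and purely periodic if its gain space at every vertex consists only of translations. Sparsity: A multigraph is $(k,l)$-sparse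 if every subgraph $(V',E')$ with $|E'|\ge 1$ satisfies $|E'|\le k|V'|-l$; it is $(k,l)$-tight if moreover $|E|=k|V|-l$. $(G,m)$ is $\mathbb{Z}^2\rtimes\mathcal{C}_s$-tight if (1) $G$ is $(2,1)$-tight; (2) every purely periodic subgraph of $G$ is $(2,2)$-sparse; (3) every balanced subgraph of $G$ is $(2,3)$-sparse. Rigidity: The derived graph $\tilde G=(\tilde V,\tilde E)$ has $\tilde V=V\times\Gamma$, with $(v_i,\gamma_i)$ and $(v_j,\gamma_j)$ adjacent iff there is an edge $(v_i,v_j;\gamma_i^{-1}\gamma_j)$ in $(G,m)$. A map $p:V\to\mathbb{R}^2$ determines $\tilde p(v,\gamma)=\gamma(p(v))$; $p$ is a configuration if $\tilde p$ takes different values at the ends of each edge of $\tilde G$. A $\Gamma$-symmetric infinitesimal motion of $(\tilde G,\tilde p)$ is a map $\tilde u:\tilde V\to\mathbb{R}^2$ with $(\tilde p(x)-\tilde p(y))\cdot(\tilde u(x)-\tilde u(y))=0$ for all $xy\in\tilde E$ and $\tilde u(v,\gamma)=\gamma_l(\tilde u(v,\mathrm{id}))$ for all $(v,\gamma)$. It is trivial if it corresponds to a rigid body motion, i.e. $\tilde u(x)=A\tilde p(x)+b$ for some skew-symmetric $A$ and vector $b$. $(\tilde G,\tilde p)$ is $\Gamma$-symmetrically infinitesimally rigid if all its $\Gamma$-symmetric infinitesimal motions are trivial. The orbit rigidity matrix $\mathbf{O}(\tilde G,\tilde p,\Gamma)$ is the $|E|\times 2|V|$ matrix whose row for a non-loop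 edge $e=(v_i,v_j;m(e))$ has $(p(v_i)-m(e)p(v_j))^T$ in the two columns of $v_i$, $(p(v_j)-m(e)^{-1}p(v_i))^T$ in those of $v_j$, and $0$ elsewhere, and whose row for a loop $e$ at $v_i$ has $(2p(v_i)-m(e)p(v_i)-m(e)^{-1}p(v_i))^T$ in the columns of $v_i$ and $0$ elsewhere. A configuration $p$ is generic if this matrix has the maximum rank over all configurations of $(G,m)$. $(G,m)$ is rigid if $(\tilde G,\tilde p)$ is $\Gamma$-symmetrically infinitesimally rigid for every (equivalently, some) generic $p$; independent if the orbit rigidity matrix is row-independent for generic $p$; minimally rigid if it is rigid and independent. *)

theory Defs
  imports
    "HOL-Analysis.Analysis"
    "HOL-Algebra.Generated_Groups"
    "Graph_Theory.Digraph_Component"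
begin

section \<open>The wallpaper group \<open>pm\<close>\<close>

type_synonym plane_map = "real^2 \<Rightarrow> real^2"

definition int_lattice :: "(real^2) set" where
  "int_lattice = {t. \<forall>i. t $ i \<in> \<int>}"

definition reflection :: plane_map where
  "reflection x = vector [x $ 1, - (x $ 2)]"

definition pm :: "plane_map monoid" where
  "pm = \<lparr>carrier = {\<lambda>x. \<sigma> x + t | \<sigma> t. \<sigma> \<in> {id, reflection} \<and> t \<in> int_lattice},
         mult = (\<circ>), one = id\<rparr>"

definition pm_translations :: "plane_map set" where
  "pm_translations = {\<lambda>x. x + t | t. t \<in> int_lattice}"

definition linear_part :: "plane_map \<Rightarrow> plane_map" where
  "linear_part \<gamma> x = \<gamma> x - \<gamma> 0"

lemma reflection_nth [simp]: "reflection x $ 1 = x $ 1" "reflection x $ 2 = - (x $ 2)"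
  by (simp_all add: reflection_def)

lemma reflection_reflection [simp]: "reflection (reflection x) = x"
  by (simp add: vec_eq_iff forall_2)

lemma reflection_add: "reflection (x + y) = reflection x + reflection y"
  by (simp add: vec_eq_iff forall_2)

lemma reflection_zero: "reflection 0 = 0"
  by (simp add: vec_eq_iff forall_2)

lemma int_lattice_closed:
  "0 \<in> int_lattice"
  "s \<in> int_lattice \<Longrightarrow> t \<in> int_lattice \<Longrightarrow> s + t \<in> int_lattice"
  "t \<in> int_lattice \<Longrightarrow> - t \<in> int_lattice"
  "t \<in> int_lattice \<Longrightarrow> reflection t \<in> int_lattice"
  by (auto simp: int_lattice_def forall_2)

lemma pm_carrier_iff:
  "\<gamma> \<in> carrier pm \<longleftrightarrow>
     (\<exists>t\<in>int_lattice. \<gamma> = (\<lambda>x. x + t) \<or> \<gamma> = (\<lambda>x. reflection x + t))"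
proof
  assume "\<gamma> \<in> carrier pm"
  then show "\<exists>t\<in>int_lattice. \<gamma> = (\<lambda>x. x + t) \<or> \<gamma> = (\<lambda>x. reflection x + t)"
    by (auto simp: pm_def)
next
  assume "\<exists>t\<in>int_lattice. \<gamma> = (\<lambda>x. x + t) \<or> \<gamma> = (\<lambda>x. reflection x + t)"
  then obtain t \<sigma> where "t \<in> int_lattice" "\<sigma> \<in> {id, reflection}" "\<gamma> = (\<lambda>x. \<sigma> x + t)"
    by fastforce
  then show "\<gamma> \<in> carrier pm" unfolding pm_def by auto
qed

lemma group_pm: "group pm"
proof (rule groupI)
  fix \<gamma> \<delta> assume "\<gamma> \<in> carrier pm" "\<delta> \<in> carrier pm"
  then obtain s t where st: "s \<in> int_lattice" "t \<in> int_lattice"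
    and g: "\<gamma> = (\<lambda>x. x + s) \<or> \<gamma> = (\<lambda>x. reflection x + s)"
    and d: "\<delta> = (\<lambda>x. x + t) \<or> \<delta> = (\<lambda>x. reflection x + t)"
    by (auto simp: pm_carrier_iff)
  have m: "\<gamma> \<otimes>\<^bsub>pm\<^esub> \<delta> = \<gamma> \<circ> \<delta>" by (simp add: pm_def)
  have "t + s \<in> int_lattice" "reflection t + s \<in> int_lattice"
    using st by (auto intro: int_lattice_closed)
  then show "\<gamma> \<otimes>\<^bsub>pm\<^esub> \<delta> \<in> carrier pm"
    unfolding m pm_carrier_iff Bex_def using g d
    by (elim disjE; intro exI[of _ "\<gamma> (\<delta> 0)"])
      (simp_all add: fun_eq_iff reflection_add add.assoc reflection_zero)
next
  show "\<one>\<^bsub>pm\<^esub> \<in> carrier pm"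
    unfolding pm_carrier_iff by (auto simp: pm_def fun_eq_iff intro!: bexI[of _ 0] int_lattice_closed)
next
  fix \<gamma> assume "\<gamma> \<in> carrier pm"
  then obtain t where t: "t \<in> int_lattice"
    and g: "\<gamma> = (\<lambda>x. x + t) \<or> \<gamma> = (\<lambda>x. reflection x + t)"
    by (auto simp: pm_carrier_iff)
  have "(\<lambda>x. x + (- t)) \<in> carrier pm" "(\<lambda>x. reflection x + (- reflection t)) \<in> carrier pm"
    unfolding pm_carrier_iff using t int_lattice_closed by blast+
  moreover from g have "(\<lambda>x. x + (- t)) \<otimes>\<^bsub>pm\<^esub> \<gamma> = \<one>\<^bsub>pm\<^esub> \<or>
      (\<lambda>x. reflection x + (- reflection t)) \<otimes>\<^bsub>pm\<^esub> \<gamma> = \<one>\<^bsub>pm\<^esub>"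
    by (elim disjE) (simp_all add: pm_def fun_eq_iff reflection_add)
  ultimately show "\<exists>\<delta>\<in>carrier pm. \<delta> \<otimes>\<^bsub>pm\<^esub> \<gamma> = \<one>\<^bsub>pm\<^esub>"
    by blast
qed (auto simp: pm_def comp_assoc)

section \<open>Gain graphs\<close>

text \<open>
  The orientation of an edge is only a reference: an edge and its reversal with inverted gain
  are the same edge. Parallel edges (in particular loops at one vertex) therefore have to be
  compared in both relative orientations. The graph with no vertices is excluded.
\<close>

locale pm_gain_graph = fin_digraph G for G :: "('v, 'e) pre_digraph" +
  fixes m :: "'e \<Rightarrow> plane_map"
  assumes verts_nonempty: "verts G \<noteq> {}"
    and gain_in_pm: "e \<in> arcs G \<Longrightarrow> m e \<in> carrier pm"
    and parallel_gains:
      "\<lbrakk>e \<in> arcs G; f \<in> arcs G; e \<noteq> f; tail G e = tail G f; head G e = head G f\<rbrakk>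
        \<Longrightarrow> m e \<noteq> m f"
    and antiparallel_gains:
      "\<lbrakk>e \<in> arcs G; f \<in> arcs G; e \<noteq> f; tail G e = head G f; head G e = tail G f\<rbrakk>
        \<Longrightarrow> m e \<noteq> inv\<^bsub>pm\<^esub> (m f)"
    and loop_gain: "\<lbrakk>e \<in> arcs G; tail G e = head G e\<rbrakk> \<Longrightarrow> m e \<noteq> \<one>\<^bsub>pm\<^esub>"

text \<open>
  Walks may traverse an edge against its orientation; the Boolean records whether the edge is
  traversed forwards.
\<close>

fun gain_walk :: "('v, 'e) pre_digraph \<Rightarrow> 'v \<Rightarrow> ('e \<times> bool) list \<Rightarrow> 'v \<Rightarrow> bool" where
  "gain_walk G u [] v \<longleftrightarrow> u = v \<and> u \<in> verts G"
| "gain_walk G u ((e, fwd) # w) v \<longleftrightarrow>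
     e \<in> arcs G \<and> u = (if fwd then tail G e else head G e) \<and>
     gain_walk G (if fwd then head G e else tail G e) w v"

fun net_gain :: "('e \<Rightarrow> plane_map) \<Rightarrow> ('e \<times> bool) list \<Rightarrow> plane_map" where
  "net_gain m [] = \<one>\<^bsub>pm\<^esub>"
| "net_gain m ((e, fwd) # w) = (if fwd then m e else inv\<^bsub>pm\<^esub> (m e)) \<otimes>\<^bsub>pm\<^esub> net_gain m w"

definition gain_space :: "('v, 'e) pre_digraph \<Rightarrow> ('e \<Rightarrow> plane_map) \<Rightarrow> 'v \<Rightarrow> plane_map set" where
  "gain_space G m v = generate pm {net_gain m w | w. gain_walk G v w v}"

definition balanced :: "('v, 'e) pre_digraph \<Rightarrow> ('e \<Rightarrow> plane_map) \<Rightarrow> bool" where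
  "balanced G m \<longleftrightarrow> (\<forall>v\<in>verts G. gain_space G m v = {\<one>\<^bsub>pm\<^esub>})"

definition purely_periodic :: "('v, 'e) pre_digraph \<Rightarrow> ('e \<Rightarrow> plane_map) \<Rightarrow> bool" where
  "purely_periodic G m \<longleftrightarrow> (\<forall>v\<in>verts G. gain_space G m v \<subseteq> pm_translations)"

section \<open>Sparsity\<close>

definition sparse :: "nat \<Rightarrow> nat \<Rightarrow> ('v, 'e) pre_digraph \<Rightarrow> bool" where
  "sparse k l G \<longleftrightarrow>
     (\<forall>H. subgraph H G \<and> card (arcs H) \<ge> 1 \<longrightarrow>
        int (card (arcs H)) \<le> int k * int (card (verts H)) - int l)"

definition tight :: "nat \<Rightarrow> nat \<Rightarrow> ('v, 'e) pre_digraph \<Rightarrow> bool" where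
  "tight k l G \<longleftrightarrow>
     sparse k l G \<and> int (card (arcs G)) = int k * int (card (verts G)) - int l"

definition pm_tight :: "('v, 'e) pre_digraph \<Rightarrow> ('e \<Rightarrow> plane_map) \<Rightarrow> bool" where
  "pm_tight G m \<longleftrightarrow>
     tight 2 1 G \<and>
     (\<forall>H. subgraph H G \<and> purely_periodic H m \<longrightarrow> sparse 2 2 H) \<and>
     (\<forall>H. subgraph H G \<and> balanced H m \<longrightarrow> sparse 2 3 H)"

section \<open>Derived frameworks and symmetric infinitesimal rigidity\<close>

text \<open>Adjacency is undirected, so \<open>parcs\<close> contains both orientations of each edge.\<close>

definition derived_graph ::
    "('v, 'e) pre_digraph \<Rightarrow> ('e \<Rightarrow> plane_map) \<Rightarrow> ('v \<times> plane_map) pair_pre_digraph" where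
  "derived_graph G m =
     \<lparr>pverts = verts G \<times> carrier pm,
      parcs = {((u, \<gamma>), (v, \<delta>)) | u \<gamma> v \<delta>. \<gamma> \<in> carrier pm \<and> \<delta> \<in> carrier pm \<and>
        (\<exists>e\<in>arcs G.
           (tail G e = u \<and> head G e = v \<and> m e = inv\<^bsub>pm\<^esub> \<gamma> \<otimes>\<^bsub>pm\<^esub> \<delta>) \<or>
           (head G e = u \<and> tail G e = v \<and> inv\<^bsub>pm\<^esub> (m e) = inv\<^bsub>pm\<^esub> \<gamma> \<otimes>\<^bsub>pm\<^esub> \<delta>))}\<rparr>"

definition lift_conf :: "('v \<Rightarrow> real^2) \<Rightarrow> 'v \<times> plane_map \<Rightarrow> real^2" where
  "lift_conf p = (\<lambda>(v, \<gamma>). \<gamma> (p v))"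

definition configuration ::
    "('v, 'e) pre_digraph \<Rightarrow> ('e \<Rightarrow> plane_map) \<Rightarrow> ('v \<Rightarrow> real^2) \<Rightarrow> bool" where
  "configuration G m p \<longleftrightarrow>
     (\<forall>(x, y)\<in>parcs (derived_graph G m). lift_conf p x \<noteq> lift_conf p y)"

definition symmetric_motion ::
    "('v, 'e) pre_digraph \<Rightarrow> ('e \<Rightarrow> plane_map) \<Rightarrow> ('v \<Rightarrow> real^2) \<Rightarrow>
      ('v \<times> plane_map \<Rightarrow> real^2) \<Rightarrow> bool" where
  "symmetric_motion G m p u \<longleftrightarrow>
     (\<forall>(x, y)\<in>parcs (derived_graph G m). (lift_conf p x - lift_conf p y) \<bullet> (u x - u y) = 0) \<and>
     (\<forall>v\<in>verts G. \<forall>\<gamma>\<in>carrier pm. u (v, \<gamma>) = linear_part \<gamma> (u (v, \<one>\<^bsub>pm\<^esub>)))"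

definition trivial_motion ::
    "('v, 'e) pre_digraph \<Rightarrow> ('e \<Rightarrow> plane_map) \<Rightarrow> ('v \<Rightarrow> real^2) \<Rightarrow>
      ('v \<times> plane_map \<Rightarrow> real^2) \<Rightarrow> bool" where
  "trivial_motion G m p u \<longleftrightarrow>
     (\<exists>(A :: real^2^2) b. transpose A = - A \<and>
        (\<forall>x\<in>pverts (derived_graph G m). u x = A *v lift_conf p x + b))"

definition symmetrically_inf_rigid ::
    "('v, 'e) pre_digraph \<Rightarrow> ('e \<Rightarrow> plane_map) \<Rightarrow> ('v \<Rightarrow> real^2) \<Rightarrow> bool" where
  "symmetrically_inf_rigid G m p \<longleftrightarrow>
     (\<forall>u. symmetric_motion G m p u \<longrightarrow> trivial_motion G m p u)"

section \<open>The orbit rigidity matrix\<close>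

text \<open>
  Matrices are functions of a row and a column index, with explicit finite sets \<open>R\<close> of rows
  and \<open>C\<close> of columns, since the dimensions depend on the graph.
\<close>

definition rows_independent :: "('r \<Rightarrow> 'c \<Rightarrow> real) \<Rightarrow> 'r set \<Rightarrow> 'c set \<Rightarrow> bool" where
  "rows_independent A R C \<longleftrightarrow>
     (\<forall>c. (\<forall>j\<in>C. (\<Sum>i\<in>R. c i * A i j) = 0) \<longrightarrow> (\<forall>i\<in>R. c i = 0))"

definition matrix_rank :: "('r \<Rightarrow> 'c \<Rightarrow> real) \<Rightarrow> 'r set \<Rightarrow> 'c set \<Rightarrow> nat" where
  "matrix_rank A R C = Max {card F | F. F \<subseteq> R \<and> rows_independent A F C}"

lemma rows_independent_iff:
  fixes A :: "real^'n^'m"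
  shows "rows_independent (\<lambda>i j. A $ i $ j) F UNIV \<longleftrightarrow>
     inj_on (\<lambda>i. row i A) F \<and> independent ((\<lambda>i. row i A) ` F)" (is "?L \<longleftrightarrow> ?R")
proof -
  have fin: "finite F" by simp
  have sum_eq: "(\<forall>j\<in>UNIV. (\<Sum>i\<in>F. c i * A $ i $ j) = 0) \<longleftrightarrow> (\<Sum>i\<in>F. c i *\<^sub>R row i A) = 0" for c
    by (simp add: vec_eq_iff row_def)
  show ?thesis
  proof
    assume L: ?L
    then have L': "\<forall>i\<in>F. c i = 0" if "(\<Sum>i\<in>F. c i *\<^sub>R row i A) = 0" for c
      using that unfolding rows_independent_def sum_eq by blast
    have inj: "inj_on (\<lambda>i. row i A) F"
    proof (rule inj_onI, rule ccontr)
      fix a b assume ab: "a \<in> F" "b \<in> F" "row a A = row b A" "a \<noteq> b"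
      let ?c = "\<lambda>i. if i = a then 1 else if i = b then - 1 else (0::real)"
      have "(\<Sum>i\<in>F. ?c i *\<^sub>R row i A) = (\<Sum>i\<in>{a, b}. ?c i *\<^sub>R row i A)"
        using ab by (intro sum.mono_neutral_right fin) auto
      also have "\<dots> = 0" using ab by simp
      finally have "\<forall>i\<in>F. ?c i = 0" by (rule L')
      then have "?c a = 0" using ab(1) by (rule bspec)
      then show False by simp
    qed
    have "independent ((\<lambda>i. row i A) ` F)"
    proof (subst independent_explicit_finite_subsets, intro allI impI ballI)
      fix S u v assume S: "S \<subseteq> (\<lambda>i. row i A) ` F" "finite S" and
        z: "(\<Sum>v\<in>S. u v *\<^sub>R v) = 0" and v: "v \<in> S"
      let ?c = "\<lambda>i. if row i A \<in> S then u (row i A) else 0"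
      have "(\<Sum>i\<in>F. ?c i *\<^sub>R row i A)
          = (\<Sum>w\<in>(\<lambda>i. row i A) ` F. (if w \<in> S then u w else 0) *\<^sub>R w)"
        by (simp add: sum.reindex[OF inj])
      also have "\<dots> = (\<Sum>w\<in>S. u w *\<^sub>R w)"
        using S by (intro sum.mono_neutral_cong_right) auto
      finally have "(\<Sum>i\<in>F. ?c i *\<^sub>R row i A) = 0" using z by (rule trans)
      then have "\<forall>i\<in>F. ?c i = 0" by (rule L')
      then show "u v = 0" using v S by fastforce
    qed
    with inj show ?R by blast
  next
    assume R: ?R
    show ?L unfolding rows_independent_def sum_eq
    proof (intro allI impI ballI)
      fix c i assume z: "(\<Sum>i\<in>F. c i *\<^sub>R row i A) = 0" and i: "i \<in> F"
      let ?g = "the_inv_into F (\<lambda>i. row i A)"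
      have g: "?g (row k A) = k" if "k \<in> F" for k
        using the_inv_into_f_f[of "\<lambda>i. row i A" F k] R that by simp
      have "(\<Sum>w\<in>(\<lambda>i. row i A) ` F. c (?g w) *\<^sub>R w) = (\<Sum>i\<in>F. c i *\<^sub>R row i A)"
        using R by (simp add: sum.reindex g)
      then have "c (?g (row i A)) = 0"
        using R z i fin by (auto simp: independent_explicit)
      then show "c i = 0" using i by (simp add: g)
    qed
  qed
qed

lemma matrix_rank_eq_rank:
  fixes A :: "real^'n^'m"
  shows "matrix_rank (\<lambda>i j. A $ i $ j) UNIV UNIV = rank A"
  unfolding matrix_rank_def
proof (rule Max_eqI)
  show "finite {card F |F. F \<subseteq> UNIV \<and> rows_independent (\<lambda>i j. A $ i $ j) F UNIV}"
    by (rule finite_subset[of _ "range card"]) (auto simp: full_SetCompr_eq)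
next
  fix y assume "y \<in> {card F |F. F \<subseteq> UNIV \<and> rows_independent (\<lambda>i j. A $ i $ j) F UNIV}"
  then obtain F where F: "y = card F" "inj_on (\<lambda>i. row i A) F"
      "independent ((\<lambda>i. row i A) ` F)"
    by (auto simp: rows_independent_iff)
  have "(\<lambda>i. row i A) ` F \<subseteq> rows A" by (auto simp: rows_def)
  then have "card ((\<lambda>i. row i A) ` F) \<le> dim (rows A)"
    using F(3) by (intro independent_card_le_dim)
  then show "y \<le> rank A" using F by (simp add: card_image row_rank_def)
next
  obtain B where B: "B \<subseteq> rows A" "independent B" "card B = dim (rows A)"
    using basis_exists by metis
  have "B \<subseteq> (\<lambda>i. row i A) ` UNIV" using B by (auto simp: rows_def)
  then obtain F where F: "inj_on (\<lambda>i. row i A) F" "B = (\<lambda>i. row i A) ` F"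
    by (meson subset_image_inj)
  then have "card F = rank A" using B by (simp add: card_image row_rank_def)
  then show "rank A \<in> {card F |F. F \<subseteq> UNIV \<and> rows_independent (\<lambda>i j. A $ i $ j) F UNIV}"
    using F B by (auto simp: rows_independent_iff intro!: exI[of _ F])
qed

definition orbit_matrix ::
    "('v, 'e) pre_digraph \<Rightarrow> ('e \<Rightarrow> plane_map) \<Rightarrow> ('v \<Rightarrow> real^2) \<Rightarrow> 'e \<Rightarrow> 'v \<times> 2 \<Rightarrow> real" where
  "orbit_matrix G m p e = (\<lambda>(v, k).
     let i = tail G e; j = head G e in
     if i = j then
       (if v = i then 2 *\<^sub>R p i - m e (p i) - (inv\<^bsub>pm\<^esub> (m e)) (p i) else 0) $ k
     else
       (if v = i then p i - m e (p j)
        else if v = j then p j - (inv\<^bsub>pm\<^esub> (m e)) (p i) else 0) $ k)"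

abbreviation orbit_cols :: "('v, 'e) pre_digraph \<Rightarrow> ('v \<times> 2) set" where
  "orbit_cols G \<equiv> verts G \<times> UNIV"

definition generic ::
    "('v, 'e) pre_digraph \<Rightarrow> ('e \<Rightarrow> plane_map) \<Rightarrow> ('v \<Rightarrow> real^2) \<Rightarrow> bool" where
  "generic G m p \<longleftrightarrow> configuration G m p \<and>
     (\<forall>q. configuration G m q \<longrightarrow>
        matrix_rank (orbit_matrix G m q) (arcs G) (orbit_cols G)
          \<le> matrix_rank (orbit_matrix G m p) (arcs G) (orbit_cols G))"

definition rigid :: "('v, 'e) pre_digraph \<Rightarrow> ('e \<Rightarrow> plane_map) \<Rightarrow> bool" where
  "rigid G m \<longleftrightarrow> (\<forall>p. generic G m p \<longrightarrow> symmetrically_inf_rigid G m p)"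

definition gain_independent :: "('v, 'e) pre_digraph \<Rightarrow> ('e \<Rightarrow> plane_map) \<Rightarrow> bool" where
  "gain_independent G m \<longleftrightarrow>
     (\<forall>p. generic G m p \<longrightarrow> rows_independent (orbit_matrix G m p) (arcs G) (orbit_cols G))"

definition minimally_rigid :: "('v, 'e) pre_digraph \<Rightarrow> ('e \<Rightarrow> plane_map) \<Rightarrow> bool" where
  "minimally_rigid G m \<longleftrightarrow> rigid G m \<and> gain_independent G m"

end

theory Submission
  imports Defs
begin

text \<open>
  Independent rows leave a kernel that contains the trivial motions; lifting a balanced subgraph
  by a potential exhibits a three-dimensional space of them, a purely periodic subgraph has the
  two translations and every subgraph has the horizontal one. Comparing dimensions gives the
  necessity of the counts.

  For sufficiency, induct on the number of edges and remove a vertex \<open>v\<close> of degree at most three.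
  The only difficult case is that of three edges from \<open>v\<close> to neighbours that are not all equal.
  If for one pair of these edges the edge obtained by contracting the pair can be added without
  violating sparsity, then \<open>v\<close> may be put on the line through the two lifted neighbours. Otherwise
  each of the three pairs is blocked by a tight, hence infinitesimally rigid, edge set. On each of
  them a motion is the restriction of an infinitesimal isometry, and the three isometries agree
  because they agree on the triangle of lifted neighbours. So the motions of the union form a space
  no larger than its defect, and the union together with the three edges violates the count.
  This replaces the combinatorial uncrossing of tight sets by linear algebra. The integrality of
  the translations plays no role.
\<close>

section \<open>Linear algebra of rows\<close>

text \<open>\<open>defect\<close> counts the independent trivial motions that the gains of an edge
  set admit, so one count replaces three sparsity conditions. In this form sparsity already excludes
  translation loops and equal parallel edges; the induction can therefore run on bare edge sets with
  coordinates, and a contracted pair has to be checked only for its sign and for the count. The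
  obstacle at a vertex \<open>v\<close> of degree three is that the blocking sets may be
  disconnected, may overlap in any way and may carry incompatible potentials. Normalising the
  potentials at \<open>v\<close> makes their motions comparable. Where two potentials disagree at a
  common vertex, a common motion loses its rotation, and under a disagreement of signs also its
  vertical translation. A potential of the union is missing only where such a disagreement or a
  smaller defect of one of the three sets occurs, so the bound on the motions follows the defect in
  every case. Several conditions are needed at one placement. Each fails at only finitely many
  points of a line through a placement that satisfies it, so finitely many satisfiable conditions
  hold together.\<close>

lemma exists_dependency:
  fixes A :: "'r \<Rightarrow> 'c \<Rightarrow> real"
  assumes "finite C" "finite R" "card C < card R"
  shows "\<exists>c. (\<forall>j\<in>C. (\<Sum>i\<in>R. c i * A i j) = 0) \<and> (\<exists>i\<in>R. c i \<noteq> 0)"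
  using assms
proof (induction C arbitrary: R A rule: finite_induct)
  case empty
  then obtain r where "r \<in> R" by (metis card_gt_0_iff ex_in_conv card.empty)
  then show ?case by (intro exI[of _ "\<lambda>_. 1"]) auto
next
  case (insert k C)
  show ?case
  proof (cases "\<forall>r\<in>R. A r k = 0")
    case True
    with insert.IH[of R A] insert.prems insert.hyps show ?thesis by auto
  next
    case False
    then obtain r where r: "r \<in> R" "A r k \<noteq> 0" by blast
    define B where "B i j = A i j - A i k / A r k * A r j" for i j
    have "card C < card (R - {r})" using insert r by simp
    then obtain c where c: "\<forall>j\<in>C. (\<Sum>i\<in>R-{r}. c i * B i j) = 0" "\<exists>i\<in>R-{r}. c i \<noteq> 0"
      using insert.IH[of "R - {r}" B] insert.prems by blast
    \<comment> \<open>The coefficient of the pivot row collects what the elimination subtracted from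
      the other rows.\<close>
    define d where "d i = (if i = r then - (\<Sum>i\<in>R-{r}. c i * (A i k / A r k)) else c i)" for i
    have "(\<Sum>i\<in>R. d i * A i j) = (\<Sum>i\<in>R-{r}. c i * B i j)" for j
    proof -
      have "(\<Sum>i\<in>R. d i * A i j) = d r * A r j + (\<Sum>i\<in>R-{r}. d i * A i j)"
        using insert.prems r by (simp add: sum.remove)
      also have "(\<Sum>i\<in>R-{r}. d i * A i j) = (\<Sum>i\<in>R-{r}. c i * A i j)"
        by (intro sum.cong) (auto simp: d_def)
      also have "d r * A r j = - (\<Sum>i\<in>R-{r}. c i * (A i k / A r k) * A r j)"
        by (simp add: d_def sum_distrib_right)
      also have "\<dots> + (\<Sum>i\<in>R-{r}. c i * A i j) = (\<Sum>i\<in>R-{r}. c i * B i j)"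
        by (simp add: B_def sum_subtractf right_diff_distrib mult.assoc)
      finally show ?thesis .
    qed
    moreover have "B i k = 0" for i using r by (simp add: B_def)
    ultimately have "\<forall>j\<in>insert k C. (\<Sum>i\<in>R. d i * A i j) = 0" using c by simp
    moreover have "\<exists>i\<in>R. d i \<noteq> 0" using c unfolding d_def by auto
    ultimately show ?thesis by blast
  qed
qed

lemma exists_kernel_vector:
  fixes A :: "'r \<Rightarrow> 'c \<Rightarrow> real"
  assumes "finite C" "finite R" "card R < card C"
  obtains u where "\<And>i. i \<in> R \<Longrightarrow> (\<Sum>j\<in>C. A i j * u j) = 0" "\<exists>j\<in>C. u j \<noteq> 0"
proof -
  obtain u where "\<forall>i\<in>R. (\<Sum>j\<in>C. u j * A i j) = 0" "\<exists>j\<in>C. u j \<noteq> 0"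
    using exists_dependency[of R C "\<lambda>j i. A i j"] assms by blast
  then show ?thesis by (intro that[of u]) (simp_all add: mult.commute)
qed

lemma rows_independentD:
  assumes "rows_independent A R C" "\<And>j. j \<in> C \<Longrightarrow> (\<Sum>i\<in>R. c i * A i j) = 0" "i \<in> R"
  shows "c i = 0"
proof -
  have "\<forall>j\<in>C. (\<Sum>i\<in>R. c i * A i j) = 0" using assms(2) by (rule ballI)
  moreover have "(\<forall>j\<in>C. (\<Sum>i\<in>R. c i * A i j) = 0) \<longrightarrow> (\<forall>i\<in>R. c i = 0)"
    using assms(1) unfolding rows_independent_def by (rule spec)
  ultimately have "\<forall>i\<in>R. c i = 0" by (rule rev_mp)
  then show ?thesis using assms(3) by (rule bspec)
qed

lemma rows_independent_mono:
  assumes "rows_independent A R C" "S \<subseteq> R" "finite R"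
  shows "rows_independent A S C"
  unfolding rows_independent_def
proof (intro allI impI ballI)
  fix c i assume c: "\<forall>j\<in>C. (\<Sum>i\<in>S. c i * A i j) = 0" and i: "i \<in> S"
  have "(\<Sum>i\<in>R. (if i \<in> S then c i else 0) * A i j) = (\<Sum>i\<in>S. c i * A i j)" for j
    using assms by (intro sum.mono_neutral_cong_right) auto
  with c have "(if i \<in> S then c i else 0) = 0"
    using rows_independentD[OF assms(1), of "\<lambda>i. if i \<in> S then c i else 0" i] i assms by auto
  then show "c i = 0" using i by simp
qed

lemma rows_independent_cong:
  assumes "\<And>i j. i \<in> R \<Longrightarrow> j \<in> C \<Longrightarrow> A i j = B i j"
  shows "rows_independent A R C \<longleftrightarrow> rows_independent B R C"
  unfolding rows_independent_def using assms by simp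

lemma rows_independent_columns:
  assumes "C \<subseteq> C'" "\<And>i j. i \<in> R \<Longrightarrow> j \<in> C' - C \<Longrightarrow> A i j = 0"
  shows "rows_independent A R C' \<longleftrightarrow> rows_independent A R C"
proof -
  have "(\<forall>j\<in>C'. (\<Sum>i\<in>R. c i * A i j) = 0) \<longleftrightarrow> (\<forall>j\<in>C. (\<Sum>i\<in>R. c i * A i j) = 0)" for c
  proof -
    have "(\<Sum>i\<in>R. c i * A i j) = 0" if "j \<in> C' - C" for j
      using assms(2) that by (simp add: sum.neutral)
    then show ?thesis using assms(1) by blast
  qed
  then show ?thesis unfolding rows_independent_def by simp
qed

text \<open>The two combinations are negatives of each other on \<open>C\<close> and also
  orthogonal, so over the reals each has square norm zero.\<close>

lemma orthogonal_combinations: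
  fixes A :: "'r \<Rightarrow> 'c \<Rightarrow> real" and U :: "'k \<Rightarrow> 'c \<Rightarrow> real"
  assumes "finite C" "finite R" "finite K"
    and orth: "\<And>i k. i \<in> R \<Longrightarrow> k \<in> K \<Longrightarrow> (\<Sum>j\<in>C. A i j * U k j) = 0"
    and zero: "\<And>j. j \<in> C \<Longrightarrow> (\<Sum>i\<in>R. c i * A i j) + (\<Sum>k\<in>K. d k * U k j) = 0"
  shows "\<forall>j\<in>C. (\<Sum>i\<in>R. c i * A i j) = 0" "\<forall>j\<in>C. (\<Sum>k\<in>K. d k * U k j) = 0"
proof -
  define a where "a j = (\<Sum>i\<in>R. c i * A i j)" for j
  define b where "b j = (\<Sum>k\<in>K. d k * U k j)" for j
  have "(\<Sum>j\<in>C. a j * b j) = (\<Sum>j\<in>C. \<Sum>i\<in>R. \<Sum>k\<in>K. c i * d k * (A i j * U k j))"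
    unfolding a_def b_def sum_product by (simp add: mult_ac)
  also have "\<dots> = (\<Sum>i\<in>R. \<Sum>j\<in>C. \<Sum>k\<in>K. c i * d k * (A i j * U k j))"
    by (rule sum.swap)
  also have "\<dots> = (\<Sum>i\<in>R. \<Sum>k\<in>K. \<Sum>j\<in>C. c i * d k * (A i j * U k j))"
    by (intro sum.cong refl sum.swap)
  also have "\<dots> = (\<Sum>i\<in>R. \<Sum>k\<in>K. c i * d k * (\<Sum>j\<in>C. A i j * U k j))"
    by (simp add: sum_distrib_left)
  also have "\<dots> = 0" by (simp add: orth)
  finally have ab: "(\<Sum>j\<in>C. a j * b j) = 0" .
  have b: "b j = - a j" if "j \<in> C" for j using zero[OF that] by (simp add: a_def b_def)
  have "(\<Sum>j\<in>C. a j * a j) = - (\<Sum>j\<in>C. a j * b j)"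
    by (simp add: sum_negf[symmetric] b)
  then have "(\<Sum>j\<in>C. a j * a j) = 0" using ab by simp
  then have "\<forall>j\<in>C. a j * a j = 0" by (subst (asm) sum_nonneg_eq_0_iff) (auto simp: assms)
  then show "\<forall>j\<in>C. (\<Sum>i\<in>R. c i * A i j) = 0" "\<forall>j\<in>C. (\<Sum>k\<in>K. d k * U k j) = 0"
    using b by (auto simp: a_def b_def)
qed

text \<open>Rows and kernel vectors span orthogonal spaces, so the two families stay independent
  when joined over \<open>R <+> K\<close>.\<close>

lemma card_rows_plus_kernel_le:
  fixes A :: "'r \<Rightarrow> 'c \<Rightarrow> real" and U :: "'k \<Rightarrow> 'c \<Rightarrow> real"
  assumes fin: "finite C" "finite R" "finite K"
    and R: "rows_independent A R C" and K: "rows_independent U K C"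
    and orth: "\<And>i k. i \<in> R \<Longrightarrow> k \<in> K \<Longrightarrow> (\<Sum>j\<in>C. A i j * U k j) = 0"
  shows "card R + card K \<le> card C"
proof (rule ccontr)
  assume "\<not> ?thesis"
  then have "card C < card (R <+> K)" using fin by (simp add: card_Plus)
  then obtain c where c: "\<forall>j\<in>C. (\<Sum>i\<in>R <+> K. c i * case_sum A U i j) = 0" "\<exists>i\<in>R <+> K. c i \<noteq> 0"
    using exists_dependency[of C "R <+> K" "case_sum A U"] fin finite_Plus by blast
  have z: "(\<Sum>i\<in>R. c (Inl i) * A i j) + (\<Sum>k\<in>K. c (Inr k) * U k j) = 0" if "j \<in> C" for j
    using c(1) that by (simp add: sum.Plus fin)
  note o = orthogonal_combinations[OF fin orth z]
  have "\<forall>i\<in>R. c (Inl i) = 0" "\<forall>k\<in>K. c (Inr k) = 0"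
    using o R K by (auto simp: rows_independent_def)
  then show False using c(2) by auto
qed

text \<open>The previous bound leaves no room for another kernel vector: adjoining \<open>u\<close>
  under the index \<open>None\<close> creates a dependency, whose coefficient at \<open>u\<close>
  cannot vanish because \<open>U\<close> is independent.\<close>

lemma kernel_spanned:
  fixes A :: "'r \<Rightarrow> 'c \<Rightarrow> real" and U :: "'k \<Rightarrow> 'c \<Rightarrow> real"
  assumes fin: "finite C" "finite R" "finite K"
    and R: "rows_independent A R C" and K: "rows_independent U K C"
    and orth: "\<And>i k. i \<in> R \<Longrightarrow> k \<in> K \<Longrightarrow> (\<Sum>j\<in>C. A i j * U k j) = 0"
    and card: "card C \<le> card R + card K"
    and u: "\<And>i. i \<in> R \<Longrightarrow> (\<Sum>j\<in>C. A i j * u j) = 0"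
  shows "\<exists>c. \<forall>j\<in>C. u j = (\<Sum>k\<in>K. c k * U k j)"
proof -
  let ?U = "case_option u U" let ?K = "insert None (Some ` K)"
  have finK: "finite ?K" using fin by simp
  have cK: "card ?K = Suc (card K)" using fin by (simp add: card_image)
  have o: "(\<Sum>j\<in>C. A i j * ?U k j) = 0" if "i \<in> R" "k \<in> ?K" for i k
    using that orth u by auto
  have "\<not> rows_independent ?U ?K C"
    using card_rows_plus_kernel_le[OF fin(1,2) finK R _ o] card cK by fastforce
  then obtain c where c: "\<forall>j\<in>C. (\<Sum>k\<in>?K. c k * ?U k j) = 0" "\<exists>k\<in>?K. c k \<noteq> 0"
    unfolding rows_independent_def by blast
  have z: "c None * u j + (\<Sum>k\<in>K. c (Some k) * U k j) = 0" if "j \<in> C" for j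
  proof -
    have "(\<Sum>k\<in>?K. c k * ?U k j) = c None * u j + (\<Sum>k\<in>Some ` K. c k * ?U k j)"
      using fin by (subst sum.insert) auto
    then show ?thesis using c(1) that by (simp add: sum.reindex)
  qed
  have "c None \<noteq> 0"
  proof
    assume n: "c None = 0"
    then have "(\<Sum>k\<in>K. c (Some k) * U k j) = 0" if "j \<in> C" for j using z[OF that] by simp
    then have "\<forall>k\<in>K. c (Some k) = 0"
      using rows_independentD[OF K, of "\<lambda>k. c (Some k)"] by blast
    with n c(2) show False by auto
  qed
  have "u j = (\<Sum>k\<in>K. (- c (Some k) / c None) * U k j)" if "j \<in> C" for j
  proof -
    have "(\<Sum>k\<in>K. (- c (Some k) / c None) * U k j) = - (\<Sum>k\<in>K. c (Some k) * U k j) / c None"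
      by (simp add: sum_negf sum_divide_distrib)
    also have "\<dots> = u j" using z[OF that] \<open>c None \<noteq> 0\<close> by (simp add: field_simps)
    finally show ?thesis by simp
  qed
  then show ?thesis by (intro exI[of _ "\<lambda>k. - c (Some k) / c None"] ballI)
qed

text \<open>This turns knowledge of all motions at a single placement into a lower bound on the
  number of edges. With more columns, some nonzero vector would be orthogonal to \<open>A\<close>
  and to \<open>U\<close>; it would lie in the kernel, hence in the span of \<open>U\<close>, hence
  be orthogonal to itself.\<close>

lemma card_columns_le:
  fixes A :: "'r \<Rightarrow> 'c \<Rightarrow> real" and U :: "'k \<Rightarrow> 'c \<Rightarrow> real"
  assumes fin: "finite C" "finite R" "finite K"
    and sp: "\<And>u. (\<And>i. i \<in> R \<Longrightarrow> (\<Sum>j\<in>C. A i j * u j) = 0) \<Longrightarrow>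
      \<exists>c. \<forall>j\<in>C. u j = (\<Sum>k\<in>K. c k * U k j)"
  shows "card C \<le> card R + card K"
proof (rule ccontr)
  assume "\<not> ?thesis"
  then have "card (R <+> K) < card C" using fin by (simp add: card_Plus)
  then obtain u where u: "\<And>i. i \<in> R <+> K \<Longrightarrow> (\<Sum>j\<in>C. case_sum A U i j * u j) = 0"
      and nz: "\<exists>j\<in>C. u j \<noteq> 0"
    using exists_kernel_vector[of C "R <+> K" "case_sum A U"] fin finite_Plus by blast
  have "(\<Sum>j\<in>C. A i j * u j) = 0" if "i \<in> R" for i using u[OF InlI] that by simp
  then obtain c where c: "\<forall>j\<in>C. u j = (\<Sum>k\<in>K. c k * U k j)" using sp by blast
  have "(\<Sum>j\<in>C. u j * u j) = (\<Sum>j\<in>C. \<Sum>k\<in>K. c k * (U k j * u j))"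
    using c by (intro sum.cong refl) (simp add: sum_distrib_right mult_ac)
  also have "\<dots> = (\<Sum>k\<in>K. \<Sum>j\<in>C. c k * (U k j * u j))" by (rule sum.swap)
  also have "\<dots> = (\<Sum>k\<in>K. c k * (\<Sum>j\<in>C. U k j * u j))" by (simp add: sum_distrib_left)
  also have "\<dots> = 0" using u[OF InrI] by simp
  finally have "\<forall>j\<in>C. u j * u j = 0" by (subst (asm) sum_nonneg_eq_0_iff) (auto simp: fin)
  with nz show False by simp
qed

section \<open>Generic placements\<close>

definition segment_line :: "('v \<Rightarrow> real^2) \<Rightarrow> ('v \<Rightarrow> real^2) \<Rightarrow> real \<Rightarrow> 'v \<Rightarrow> real^2" where
  "segment_line p q t v = p v + t *\<^sub>R (q v - p v)"

text \<open>A substitute for Zariski openness that only involves polynomials in one variable.\<close>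

definition generic_property :: "(('v \<Rightarrow> real^2) \<Rightarrow> bool) \<Rightarrow> bool" where
  "generic_property Q \<longleftrightarrow> (\<forall>p q. Q p \<longrightarrow> finite {t. \<not> Q (segment_line p q t)})"

lemma generic_property_conj:
  assumes "generic_property P" "generic_property Q"
  shows "generic_property (\<lambda>p. P p \<and> Q p)"
  unfolding generic_property_def
proof (intro allI impI)
  fix p q assume "P p \<and> Q p"
  then have "finite ({t. \<not> P (segment_line p q t)} \<union> {t. \<not> Q (segment_line p q t)})"
    using assms by (auto simp: generic_property_def)
  then show "finite {t. \<not> (P (segment_line p q t) \<and> Q (segment_line p q t))}"
    by (rule finite_subset[rotated]) auto
qed

text \<open>On the line through \<open>p\<close> and \<open>q\<close> each property fails finitely
  often; for \<open>Q\<close> the line is read backwards by \<open>1 - t\<close>.\<close>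

lemma generic_property_meet:
  assumes "generic_property P" "generic_property Q" "P p" "Q q"
  obtains r where "P r" "Q r"
proof -
  have "finite {t. \<not> P (segment_line p q t)}" using assms by (simp add: generic_property_def)
  moreover have "finite {t. \<not> Q (segment_line p q t)}"
  proof -
    have "finite ((\<lambda>t. 1 - t) ` {t. \<not> Q (segment_line q p t)})"
      using assms by (simp add: generic_property_def)
    moreover have "segment_line p q t = segment_line q p (1 - t)" for t
      by (simp add: fun_eq_iff segment_line_def algebra_simps)
    then have "{t. \<not> Q (segment_line p q t)} \<subseteq> (\<lambda>t. 1 - t) ` {t. \<not> Q (segment_line q p t)}"
      by (auto simp: image_iff intro!: exI[of _ "1 - _"])
    ultimately show ?thesis by (rule finite_subset[rotated])
  qed
  ultimately have "finite ({t. \<not> P (segment_line p q t)} \<union> {t. \<not> Q (segment_line p q t)})"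
    by simp
  then obtain t where "t \<notin> {t. \<not> P (segment_line p q t)} \<union> {t. \<not> Q (segment_line p q t)}"
    using ex_new_if_finite infinite_UNIV_char_0 by blast
  then show ?thesis using that by blast
qed

definition poly_along :: "(('v \<Rightarrow> real^2) \<Rightarrow> real) \<Rightarrow> bool" where
  "poly_along f \<longleftrightarrow> (\<forall>p q. \<exists>P. \<forall>t. f (segment_line p q t) = poly P t)"

lemma poly_along_const [simp]: "poly_along (\<lambda>p. c)"
  unfolding poly_along_def by (intro allI exI[of _ "[:c:]"]) simp

lemma poly_along_component [simp]: "poly_along (\<lambda>p. p v $ i)"
  unfolding poly_along_def
proof (intro allI)
  fix p q :: "'a \<Rightarrow> real^2"
  show "\<exists>P. \<forall>t. segment_line p q t v $ i = poly P t"
    by (rule exI[of _ "[:p v $ i, q v $ i - p v $ i:]"]) (simp add: segment_line_def)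
qed

lemma poly_along_ops [simp]:
  assumes "poly_along f" "poly_along g"
  shows "poly_along (\<lambda>p. f p + g p)" "poly_along (\<lambda>p. f p - g p)" "poly_along (\<lambda>p. f p * g p)"
proof -
  have "\<exists>R. \<forall>t. f (segment_line p q t) + g (segment_line p q t) = poly R t"
    "\<exists>R. \<forall>t. f (segment_line p q t) - g (segment_line p q t) = poly R t"
    "\<exists>R. \<forall>t. f (segment_line p q t) * g (segment_line p q t) = poly R t" for p q
  proof -
    obtain P Q where "\<And>t. f (segment_line p q t) = poly P t" "\<And>t. g (segment_line p q t) = poly Q t"
      using assms unfolding poly_along_def by blast
    then have "f (segment_line p q t) + g (segment_line p q t) = poly (P + Q) t"
      "f (segment_line p q t) - g (segment_line p q t) = poly (P - Q) t"
      "f (segment_line p q t) * g (segment_line p q t) = poly (P * Q) t" for t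
      by simp_all
    then show "\<exists>R. \<forall>t. f (segment_line p q t) + g (segment_line p q t) = poly R t"
      "\<exists>R. \<forall>t. f (segment_line p q t) - g (segment_line p q t) = poly R t"
      "\<exists>R. \<forall>t. f (segment_line p q t) * g (segment_line p q t) = poly R t" by blast+
  qed
  then show "poly_along (\<lambda>p. f p + g p)" "poly_along (\<lambda>p. f p - g p)" "poly_along (\<lambda>p. f p * g p)"
    unfolding poly_along_def by blast+
qed

lemma generic_property_nonzero:
  assumes "poly_along f"
  shows "generic_property (\<lambda>p. f p \<noteq> 0)"
  unfolding generic_property_def
proof (intro allI impI)
  fix p q assume nz: "f p \<noteq> 0"
  obtain P where P: "\<And>t. f (segment_line p q t) = poly P t"
    using assms unfolding poly_along_def by blast
  have "segment_line p q 0 = p" by (simp add: fun_eq_iff segment_line_def)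
  then have "P \<noteq> 0" using P[of 0] nz by auto
  then show "finite {t. \<not> f (segment_line p q t) \<noteq> 0}"
    by (simp add: P poly_roots_finite)
qed

text \<open>Fraction-free Gaussian elimination, so that the reduced rows stay polynomial.\<close>

lemma generic_property_rows_independent:
  fixes A :: "('v \<Rightarrow> real^2) \<Rightarrow> 'r \<Rightarrow> 'c \<Rightarrow> real"
  assumes "finite R" "\<And>i j. i \<in> R \<Longrightarrow> poly_along (\<lambda>p. A p i j)"
  shows "generic_property (\<lambda>p. rows_independent (A p) R C)"
  unfolding generic_property_def
proof (intro allI impI)
  fix p q assume "rows_independent (A p) R C"
  with assms show "finite {t. \<not> rows_independent (A (segment_line p q t)) R C}"
  proof (induction R arbitrary: A rule: finite_induct)
    case empty
    then show ?case by (simp add: rows_independent_def)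
  next
    case (insert e F)
    have "\<exists>k\<in>C. A p e k \<noteq> 0"
    proof (rule ccontr)
      assume z: "\<not> ?thesis"
      have "(if e = e then 1 else 0 :: real) = 0"
        using insert.hyps z
        by (intro rows_independentD[OF insert.prems(2), where c = "\<lambda>i. if i = e then 1 else 0"])
          (auto intro!: sum.neutral)
      then show False by simp
    qed
    then obtain k where k: "k \<in> C" "A p e k \<noteq> 0" by blast
    define B where "B p f j = A p e k * A p f j - A p f k * A p e j" for p f j
    \<comment> \<open>Where the pivot \<open>A r e k\<close> is nonzero, clearing column
      \<open>k\<close> without division preserves independence in both directions; the pivot is
      polynomial and so vanishes at finitely many points of the line.\<close>
    have key: "rows_independent (A r) (insert e F) C \<longleftrightarrow> rows_independent (B r) F C"
      if nz: "A r e k \<noteq> 0" for r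
    proof
      assume I: "rows_independent (A r) (insert e F) C"
      show "rows_independent (B r) F C" unfolding rows_independent_def
      proof (intro allI impI ballI)
        fix c f assume c: "\<forall>j\<in>C. (\<Sum>i\<in>F. c i * B r i j) = 0" and f: "f \<in> F"
        define d where "d i = (if i = e then - (\<Sum>i\<in>F. c i * A r i k) else c i * A r e k)" for i
        have "(\<Sum>i\<in>insert e F. d i * A r i j) = (\<Sum>i\<in>F. c i * B r i j)" for j
        proof -
          have "(\<Sum>i\<in>F. d i * A r i j) = (\<Sum>i\<in>F. c i * A r e k * A r i j)"
            using insert.hyps by (intro sum.cong) (auto simp: d_def)
          then show ?thesis using insert.hyps
            by (simp add: d_def B_def sum_distrib_left sum_distrib_right sum_subtractf right_diff_distrib
                mult_ac)
        qed
        then have "d f = 0" using c f by (intro rows_independentD[OF I, of d]) auto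
        then show "c f = 0" using nz insert.hyps f by (auto simp: d_def split: if_splits)
      qed
    next
      assume I: "rows_independent (B r) F C"
      show "rows_independent (A r) (insert e F) C" unfolding rows_independent_def
      proof (intro allI impI)
        fix c assume c: "\<forall>j\<in>C. (\<Sum>i\<in>insert e F. c i * A r i j) = 0"
        have "c e * A r e j + (\<Sum>i\<in>F. c i * A r i j) = 0" if "j \<in> C" for j
          using bspec[OF c that] insert.hyps by simp
        then have s: "(\<Sum>i\<in>F. c i * A r i j) = - c e * A r e j" if "j \<in> C" for j
          by (simp add: that add_eq_0_iff)
        have "(\<Sum>i\<in>F. c i * B r i j) = 0" if "j \<in> C" for j
        proof -
          have "(\<Sum>i\<in>F. c i * B r i j)
              = A r e k * (\<Sum>i\<in>F. c i * A r i j) - A r e j * (\<Sum>i\<in>F. c i * A r i k)"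
            by (simp add: B_def sum_distrib_left sum_subtractf right_diff_distrib mult_ac)
          then show ?thesis using s[OF that] s[OF k(1)] by simp
        qed
        then have F: "\<forall>i\<in>F. c i = 0" using I by (auto simp: rows_independent_def)
        then show "\<forall>i\<in>insert e F. c i = 0" using s[OF k(1)] nz by simp
      qed
    qed
    have "finite {t. \<not> rows_independent (B (segment_line p q t)) F C}"
    proof (rule insert.IH)
      show "poly_along (\<lambda>p. B p i j)" if "i \<in> F" for i j
        using insert.prems(1) that by (simp add: B_def)
      show "rows_independent (B p) F C" using key[OF k(2)] insert.prems(2) by simp
    qed
    moreover have "finite {t. \<not> A (segment_line p q t) e k \<noteq> 0}"
      using generic_property_nonzero[of "\<lambda>p. A p e k"] insert.prems k
      by (auto simp: generic_property_def)
    ultimately have "finite ({t. \<not> rows_independent (B (segment_line p q t)) F C}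
        \<union> {t. \<not> A (segment_line p q t) e k \<noteq> 0})" by simp
    then show ?case by (rule finite_subset[rotated]) (use key in auto)
  qed
qed

section \<open>Gain graphs with coordinates\<close>

text \<open>The gain of \<open>Edge i j s a b\<close> is the map \<open>(x, y) \<mapsto> (x + a, s y + b)\<close>, where \<open>s\<close> is a
  sign; the translation part may be any real vector.\<close>

datatype 'v gain_edge = Edge (src: 'v) (dst: 'v) (flip: real) (shx: real) (shy: real)

definition ends :: "('e \<Rightarrow> 'v gain_edge) \<Rightarrow> 'e set \<Rightarrow> 'v set" where
  "ends D F = (\<Union>e\<in>F. {src (D e), dst (D e)})"

definition edge_x :: "'v gain_edge \<Rightarrow> ('v \<Rightarrow> real^2) \<Rightarrow> real" where
  "edge_x d p = p (src d) $ 1 - p (dst d) $ 1 - shx d"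

definition edge_y :: "'v gain_edge \<Rightarrow> ('v \<Rightarrow> real^2) \<Rightarrow> real" where
  "edge_y d p = p (src d) $ 2 - flip d * p (dst d) $ 2 - shy d"

text \<open>The entry at the head is minus the linear part of the gain, which is its own inverse,
  applied to the entry at the tail. For a loop both contributions add up, so one formula covers
  loops and other edges.\<close>

definition edge_row :: "'v gain_edge \<Rightarrow> ('v \<Rightarrow> real^2) \<Rightarrow> 'v \<times> 2 \<Rightarrow> real" where
  "edge_row d p = (\<lambda>(v, k).
     if k = 1 then edge_x d p * (of_bool (v = src d) - of_bool (v = dst d))
     else edge_y d p * (of_bool (v = src d) - flip d * of_bool (v = dst d)))"

definition edge_pair :: "'v gain_edge \<Rightarrow> ('v \<Rightarrow> real^2) \<Rightarrow> ('v \<times> 2 \<Rightarrow> real) \<Rightarrow> real" where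
  "edge_pair d p u = edge_x d p * (u (src d, 1) - u (dst d, 1))
     + edge_y d p * (u (src d, 2) - flip d * u (dst d, 2))"

text \<open>All columns are taken, since those off \<open>ends D F\<close> vanish; thus no vertex
  set has to be carried through the induction.\<close>

definition indep_at :: "('e \<Rightarrow> 'v gain_edge) \<Rightarrow> 'e set \<Rightarrow> ('v \<Rightarrow> real^2) \<Rightarrow> bool" where
  "indep_at D F p \<longleftrightarrow> rows_independent (\<lambda>e. edge_row (D e) p) F UNIV"

definition in_kernel :: "('e \<Rightarrow> 'v gain_edge) \<Rightarrow> 'e set \<Rightarrow> ('v \<Rightarrow> real^2) \<Rightarrow> ('v \<times> 2 \<Rightarrow> real) \<Rightarrow> bool" where
  "in_kernel D F p u \<longleftrightarrow> (\<forall>e\<in>F. edge_pair (D e) p u = 0)"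

text \<open>The map \<open>(x, y) \<mapsto> (x + \<alpha> v, \<sigma> v y + \<beta> v)\<close> lifts the vertex \<open>v\<close> such that every
  gain becomes trivial; for \<open>k = 2\<close> only the signs become trivial.\<close>

definition potential ::
    "('e \<Rightarrow> 'v gain_edge) \<Rightarrow> 'e set \<Rightarrow> nat \<Rightarrow> ('v \<Rightarrow> real) \<Rightarrow> ('v \<Rightarrow> real) \<Rightarrow> ('v \<Rightarrow> real) \<Rightarrow> bool" where
  "potential D F k \<sigma> \<alpha> \<beta> \<longleftrightarrow> (\<forall>v. \<sigma> v * \<sigma> v = 1) \<and>
     (2 \<le> k \<longrightarrow> (\<forall>e\<in>F. \<sigma> (dst (D e)) = \<sigma> (src (D e)) * flip (D e))) \<and>
     (3 \<le> k \<longrightarrow> (\<forall>e\<in>F. \<alpha> (dst (D e)) = \<alpha> (src (D e)) + shx (D e) \<and>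
        \<beta> (dst (D e)) = \<beta> (src (D e)) + \<sigma> (src (D e)) * shy (D e)))"

text \<open>The values stand for balanced (translations and rotation survive), purely periodic (both
  translations survive) and arbitrary (the horizontal translation survives). Potentials make sense
  for disconnected edge sets as well.\<close>

definition defect :: "('e \<Rightarrow> 'v gain_edge) \<Rightarrow> 'e set \<Rightarrow> nat" where
  "defect D F = (if \<exists>\<sigma> \<alpha> \<beta>. potential D F 3 \<sigma> \<alpha> \<beta> then 3
     else if \<exists>\<sigma> \<alpha> \<beta>. potential D F 2 \<sigma> \<alpha> \<beta> then 2 else 1)"

definition count_sparse :: "('e \<Rightarrow> 'v gain_edge) \<Rightarrow> 'e set \<Rightarrow> bool" where
  "count_sparse D E \<longleftrightarrow>
     (\<forall>F\<subseteq>E. F \<noteq> {} \<longrightarrow> card F + defect D F \<le> 2 * card (ends D F))"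

lemma finite_ends [simp]: "finite F \<Longrightarrow> finite (ends D F)"
  by (simp add: ends_def)

lemma ends_Un [simp]: "ends D (F \<union> F') = ends D F \<union> ends D F'"
  by (auto simp: ends_def)

lemma ends_insert [simp]: "ends D (insert e F) = {src (D e), dst (D e)} \<union> ends D F"
  by (auto simp: ends_def)

lemma ends_empty [simp]: "ends D {} = {}"
  by (auto simp: ends_def)

lemma ends_mono: "F \<subseteq> F' \<Longrightarrow> ends D F \<subseteq> ends D F'"
  by (auto simp: ends_def)

lemma ends_eq_empty [simp]: "ends D F = {} \<longleftrightarrow> F = {}"
  by (auto simp: ends_def)

lemma src_in_ends [intro]: "e \<in> F \<Longrightarrow> src (D e) \<in> ends D F"
  and dst_in_ends [intro]: "e \<in> F \<Longrightarrow> dst (D e) \<in> ends D F"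
  by (auto simp: ends_def)

lemma ends_cong: "(\<And>e. e \<in> F \<Longrightarrow> D e = D' e) \<Longrightarrow> ends D F = ends D' F"
  by (auto simp: ends_def)

lemma potential_cong: "(\<And>e. e \<in> F \<Longrightarrow> D e = D' e) \<Longrightarrow> potential D F k = potential D' F k"
  unfolding potential_def fun_eq_iff by auto

lemma defect_cong: "(\<And>e. e \<in> F \<Longrightarrow> D e = D' e) \<Longrightarrow> defect D F = defect D' F"
  unfolding defect_def using potential_cong[of F D D'] by simp

lemma potential_mono: "potential D F k \<sigma> \<alpha> \<beta> \<Longrightarrow> F' \<subseteq> F \<Longrightarrow> k' \<le> k \<Longrightarrow> potential D F' k' \<sigma> \<alpha> \<beta>"
  unfolding potential_def by (meson order_trans subsetD)

lemma potential_trivial: "k < 2 \<Longrightarrow> potential D F k (\<lambda>_. 1) \<alpha> \<beta>"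
  by (simp add: potential_def)

lemma potential_sign: "potential D F k \<sigma> \<alpha> \<beta> \<Longrightarrow> \<sigma> v * \<sigma> v = 1"
  by (simp add: potential_def)

lemma potential_nonzero: "potential D F k \<sigma> \<alpha> \<beta> \<Longrightarrow> \<sigma> v \<noteq> 0"
  by (metis mult_zero_left potential_sign zero_neq_one)

lemma defect_potential: obtains \<sigma> \<alpha> \<beta> where "potential D F (defect D F) \<sigma> \<alpha> \<beta>"
proof -
  have "\<exists>\<sigma> \<alpha> \<beta>. potential D F (defect D F) \<sigma> \<alpha> \<beta>"
    unfolding defect_def using potential_trivial[of 1 D F] by (smt (verit) one_less_numeral_iff semiring_norm(76))
  then show ?thesis using that by blast
qed

lemma defect_cases: "defect D F = 1 \<or> defect D F = 2 \<or> defect D F = 3"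
  by (simp add: defect_def)

lemma defect_ge:
  assumes "potential D F k \<sigma> \<alpha> \<beta>" "k \<le> 3"
  shows "k \<le> defect D F"
proof -
  have "potential D F 3 \<sigma> \<alpha> \<beta>" if "k = 3" using assms that by simp
  moreover have "potential D F 2 \<sigma> \<alpha> \<beta>" if "k = 2" using assms that by simp
  moreover have "k < 2 \<or> k = 2 \<or> k = 3" using assms(2) by auto
  ultimately show ?thesis unfolding defect_def using assms(2) by auto
qed

lemma count_sparseD:
  "count_sparse D E \<Longrightarrow> F \<subseteq> E \<Longrightarrow> F \<noteq> {} \<Longrightarrow> card F + defect D F \<le> 2 * card (ends D F)"
  by (simp add: count_sparse_def)

lemma count_sparse_mono: "count_sparse D E \<Longrightarrow> E' \<subseteq> E \<Longrightarrow> count_sparse D E'"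
  by (auto simp: count_sparse_def)

lemma edge_row_outside: "v \<noteq> src d \<Longrightarrow> v \<noteq> dst d \<Longrightarrow> edge_row d p (v, k) = 0"
  by (simp add: edge_row_def)

lemma sum_Times_2: "(\<Sum>j\<in>W \<times> (UNIV :: 2 set). f j) = (\<Sum>v\<in>W. f (v, 1) + f (v, 2))"
  by (simp add: sum.cartesian_product' sum_2)

lemma sum_edge_row:
  assumes "finite W" "src d \<in> W" "dst d \<in> W"
  shows "(\<Sum>j\<in>W \<times> UNIV. edge_row d p j * u j) = edge_pair d p u"
proof -
  have "(\<Sum>v\<in>W. edge_row d p (v, 1) * u (v, 1) + edge_row d p (v, 2) * u (v, 2))
      = (\<Sum>v\<in>W. (if v = src d then edge_x d p * u (v, 1) + edge_y d p * u (v, 2) else 0)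
          - (if v = dst d then edge_x d p * u (v, 1) + edge_y d p * flip d * u (v, 2) else 0))"
    by (intro sum.cong) (auto simp: edge_row_def algebra_simps)
  also have "\<dots> = edge_pair d p u"
    using assms by (simp add: sum_subtractf sum.delta edge_pair_def algebra_simps)
  finally show ?thesis by (simp add: sum_Times_2)
qed

lemma indep_at_columns:
  assumes "ends D F \<subseteq> W"
  shows "indep_at D F p \<longleftrightarrow> rows_independent (\<lambda>e. edge_row (D e) p) F (W \<times> UNIV)"
  unfolding indep_at_def
proof (rule rows_independent_columns)
  fix e and j :: "'a \<times> 2"
  assume "e \<in> F" "j \<in> UNIV - W \<times> UNIV"
  moreover obtain v k where "j = (v, k)" by fastforce
  ultimately show "edge_row (D e) p j = 0"
    using assms by (auto intro!: edge_row_outside)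
qed simp

lemma indep_at_mono: "indep_at D F p \<Longrightarrow> F' \<subseteq> F \<Longrightarrow> finite F \<Longrightarrow> indep_at D F' p"
  unfolding indep_at_def by (rule rows_independent_mono)

lemma indep_at_row_nonzero:
  assumes "indep_at D F p" "e \<in> F" "finite F"
  shows "edge_x (D e) p \<noteq> 0 \<or> edge_y (D e) p \<noteq> 0"
proof (rule ccontr)
  assume z: "\<not> ?thesis"
  have r: "edge_row (D e) p j = 0" for j using z by (cases j) (simp add: edge_row_def)
  have "indep_at D {e} p" by (rule indep_at_mono) (use assms in auto)
  then have "(\<lambda>_. 1 :: real) e = 0"
    unfolding indep_at_def by (rule rows_independentD[where c = "\<lambda>_. 1"]) (simp_all add: r)
  then show False by simp
qed

lemma generic_property_indep_at:
  assumes "finite F"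
  shows "generic_property (indep_at D F)"
  unfolding indep_at_def
proof (rule generic_property_rows_independent[OF assms])
  fix e j
  show "poly_along (\<lambda>p. edge_row (D e) p j)"
    by (cases j; cases "snd j = 1") (simp_all add: edge_row_def edge_x_def edge_y_def)
qed

subsection \<open>Trivial motions and the necessity of the counts\<close>

definition lift_x :: "('v \<Rightarrow> real) \<Rightarrow> ('v \<Rightarrow> real^2) \<Rightarrow> 'v \<Rightarrow> real" where
  "lift_x \<alpha> p v = p v $ 1 + \<alpha> v"

definition lift_y :: "('v \<Rightarrow> real) \<Rightarrow> ('v \<Rightarrow> real) \<Rightarrow> ('v \<Rightarrow> real^2) \<Rightarrow> 'v \<Rightarrow> real" where
  "lift_y \<sigma> \<beta> p v = \<sigma> v * p v $ 2 + \<beta> v"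

text \<open>The two translations and the rotation about the origin of the lifted points, pulled back.\<close>

definition trivial_row ::
    "('v \<Rightarrow> real) \<Rightarrow> ('v \<Rightarrow> real) \<Rightarrow> ('v \<Rightarrow> real) \<Rightarrow> ('v \<Rightarrow> real^2) \<Rightarrow> nat \<Rightarrow> 'v \<times> 2 \<Rightarrow> real" where
  "trivial_row \<sigma> \<alpha> \<beta> p i = (\<lambda>(v, k).
     if i = 0 then of_bool (k = 1)
     else if i = 1 then (if k = 1 then 0 else \<sigma> v)
     else (if k = 1 then - lift_y \<sigma> \<beta> p v else \<sigma> v * lift_x \<alpha> p v))"

definition trivial_on ::
    "'v set \<Rightarrow> nat \<Rightarrow> ('v \<Rightarrow> real) \<Rightarrow> ('v \<Rightarrow> real) \<Rightarrow> ('v \<Rightarrow> real) \<Rightarrow> ('v \<Rightarrow> real^2) \<Rightarrow>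
      ('v \<times> 2 \<Rightarrow> real) \<Rightarrow> real \<Rightarrow> real \<Rightarrow> real \<Rightarrow> bool" where
  "trivial_on W k \<sigma> \<alpha> \<beta> p u \<theta> b c \<longleftrightarrow> (k < 3 \<longrightarrow> \<theta> = 0) \<and> (k < 2 \<longrightarrow> c = 0) \<and>
     (\<forall>v\<in>W. u (v, 1) = b - \<theta> * lift_y \<sigma> \<beta> p v \<and> u (v, 2) = \<sigma> v * (c + \<theta> * lift_x \<alpha> p v))"

text \<open>A balanced edge becomes an ordinary bar between lifted points: their difference is the
  edge vector moved by the linear part of the lift at the tail.\<close>

lemma lift_difference:
  assumes "potential D F 3 \<sigma> \<alpha> \<beta>" "e \<in> F"
  shows "lift_x \<alpha> p (src (D e)) - lift_x \<alpha> p (dst (D e)) = edge_x (D e) p"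
    "lift_y \<sigma> \<beta> p (src (D e)) - lift_y \<sigma> \<beta> p (dst (D e)) = \<sigma> (src (D e)) * edge_y (D e) p"
  using assms by (simp_all add: potential_def lift_x_def lift_y_def edge_x_def edge_y_def algebra_simps)

text \<open>A translation moves both ends of a bar alike, and the rotation moves a lifted bar at
  right angles to itself; signs that square to one carry this back to the unlifted edge.\<close>

lemma trivial_row_kernel:
  assumes pot: "potential D F k \<sigma> \<alpha> \<beta>" and i: "i < k" "k \<le> 3" and e: "e \<in> F"
  shows "edge_pair (D e) p (trivial_row \<sigma> \<alpha> \<beta> p i) = 0"
proof -
  let ?s = "\<sigma> (src (D e))" and ?t = "\<sigma> (dst (D e))" and ?f = "flip (D e)"
  consider "i = 0" | "i = 1" "2 \<le> k" | "i = 2" "k = 3" using i by linarith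
  then show ?thesis
  proof cases
    case 3
    have "?t = ?s * ?f" using pot e 3 by (simp add: potential_def)
    then have ft: "?f * ?t = ?s"
      using potential_sign[OF pot, of "src (D e)"] potential_sign[OF pot, of "dst (D e)"] by algebra
    note d = lift_difference[OF pot[unfolded 3(2)] e, of p]
    have "edge_pair (D e) p (trivial_row \<sigma> \<alpha> \<beta> p i)
        = edge_x (D e) p * - (lift_y \<sigma> \<beta> p (src (D e)) - lift_y \<sigma> \<beta> p (dst (D e)))
          + edge_y (D e) p * (?s * lift_x \<alpha> p (src (D e)) - (?f * ?t) * lift_x \<alpha> p (dst (D e)))"
      using 3 by (simp add: edge_pair_def trivial_row_def algebra_simps)
    also have "\<dots> = edge_x (D e) p * - (?s * edge_y (D e) p) + edge_y (D e) p * (?s * edge_x (D e) p)"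
      unfolding ft d by (simp add: right_diff_distrib[symmetric] d)
    finally show ?thesis by simp
  next
    case 2
    then have "?t = ?s * ?f" using pot e by (simp add: potential_def)
    then have "?f * ?t = ?s"
      using potential_sign[OF pot, of "src (D e)"] potential_sign[OF pot, of "dst (D e)"] by algebra
    then show ?thesis using 2 by (simp add: edge_pair_def trivial_row_def)
  qed (simp add: edge_pair_def trivial_row_def)
qed

lemma sum_trivial_row:
  assumes "k \<le> 3"
  shows "(\<Sum>i<k. c i * trivial_row \<sigma> \<alpha> \<beta> p i (v, 1))
      = (if 0 < k then c 0 else 0) - (if 2 < k then c 2 else 0) * lift_y \<sigma> \<beta> p v"
    "(\<Sum>i<k. c i * trivial_row \<sigma> \<alpha> \<beta> p i (v, 2))
      = \<sigma> v * ((if 1 < k then c 1 else 0) + (if 2 < k then c 2 else 0) * lift_x \<alpha> p v)"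
proof -
  consider "k = 0" | "k = 1" | "k = 2" | "k = 3" using assms by linarith
  then show "(\<Sum>i<k. c i * trivial_row \<sigma> \<alpha> \<beta> p i (v, 1))
      = (if 0 < k then c 0 else 0) - (if 2 < k then c 2 else 0) * lift_y \<sigma> \<beta> p v"
    "(\<Sum>i<k. c i * trivial_row \<sigma> \<alpha> \<beta> p i (v, 2))
      = \<sigma> v * ((if 1 < k then c 1 else 0) + (if 2 < k then c 2 else 0) * lift_x \<alpha> p v)"
    by (cases; simp add: trivial_row_def eval_nat_numeral algebra_simps)+
qed

text \<open>The rotation is separated from the translations only by two distinct lifted points,
  which \<open>two\<close> provides.\<close>

lemma trivial_rows_independent:
  assumes pot: "potential D F k \<sigma> \<alpha> \<beta>" and k: "k \<le> 3" and W: "W \<noteq> {}"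
    and two: "k = 3 \<Longrightarrow> \<exists>v\<in>W. \<exists>w\<in>W. lift_x \<alpha> p v \<noteq> lift_x \<alpha> p w \<or> lift_y \<sigma> \<beta> p v \<noteq> lift_y \<sigma> \<beta> p w"
  shows "rows_independent (trivial_row \<sigma> \<alpha> \<beta> p) {..<k} (W \<times> UNIV)"
  unfolding rows_independent_def
proof (intro allI impI)
  fix c assume c: "\<forall>j\<in>W \<times> UNIV. (\<Sum>i<k. c i * trivial_row \<sigma> \<alpha> \<beta> p i j) = 0"
  note nz = potential_nonzero[OF pot]
  have 1: "(if 0 < k then c 0 else 0) - (if 2 < k then c 2 else 0) * lift_y \<sigma> \<beta> p v = 0"
    and 2: "(if 1 < k then c 1 else 0) + (if 2 < k then c 2 else 0) * lift_x \<alpha> p v = 0"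
    if "v \<in> W" for v
    using bspec[OF c, of "(v, 1)"] bspec[OF c, of "(v, 2)"] that nz[of v]
    unfolding sum_trivial_row[OF k] by auto
  obtain v where v: "v \<in> W" using W by blast
  have c2: "(if 2 < k then c 2 else 0) = 0"
  proof (cases "k = 3")
    case True
    obtain x y where xy: "x \<in> W" "y \<in> W" "lift_x \<alpha> p x \<noteq> lift_x \<alpha> p y \<or> lift_y \<sigma> \<beta> p x \<noteq> lift_y \<sigma> \<beta> p y"
      using two[OF True] by blast
    have "c 0 - c 2 * lift_y \<sigma> \<beta> p x = 0" "c 0 - c 2 * lift_y \<sigma> \<beta> p y = 0"
      "c 1 + c 2 * lift_x \<alpha> p x = 0" "c 1 + c 2 * lift_x \<alpha> p y = 0"
      using 1[OF xy(1)] 1[OF xy(2)] 2[OF xy(1)] 2[OF xy(2)] True by simp_all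
    then have "c 2 * lift_y \<sigma> \<beta> p x = c 2 * lift_y \<sigma> \<beta> p y" "c 2 * lift_x \<alpha> p x = c 2 * lift_x \<alpha> p y"
      by linarith+
    then have "c 2 = 0" using xy(3) by (metis mult_cancel_left)
    then show ?thesis by simp
  qed (use k in auto)
  show "\<forall>i\<in>{..<k}. c i = 0"
  proof
    fix i assume "i \<in> {..<k}"
    then consider "i = 0" "0 < k" | "i = 1" "1 < k" | "i = 2" "2 < k" using k by fastforce
    then show "c i = 0" using 1[OF v] 2[OF v] c2 by cases auto
  qed
qed

text \<open>The rows and the \<open>defect D F\<close> trivial motions share the two columns of each
  vertex. In the balanced case the rotation counts, because a nonzero row separates the lifted ends
  of its edge.\<close>

lemma indep_at_imp_count_sparse:
  assumes "finite E" "indep_at D E p"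
  shows "count_sparse D E"
  unfolding count_sparse_def
proof (intro allI impI)
  fix F assume F: "F \<subseteq> E" "F \<noteq> {}"
  have finF: "finite F" using F assms finite_subset by blast
  have ind: "indep_at D F p" using indep_at_mono assms F by blast
  obtain \<sigma> \<alpha> \<beta> where pot: "potential D F (defect D F) \<sigma> \<alpha> \<beta>" by (rule defect_potential)
  have k: "defect D F \<le> 3" using defect_cases[of D F] by auto
  let ?W = "ends D F"
  have "card F + card {..<defect D F} \<le> card (?W \<times> (UNIV :: 2 set))"
  proof (rule card_rows_plus_kernel_le)
    show "rows_independent (\<lambda>e. edge_row (D e) p) F (?W \<times> UNIV)"
      using ind indep_at_columns by blast
    show "rows_independent (trivial_row \<sigma> \<alpha> \<beta> p) {..<defect D F} (?W \<times> UNIV)"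
    proof (rule trivial_rows_independent[OF pot k])
      assume 3: "defect D F = 3"
      obtain e where e: "e \<in> F" using F by blast
      have "\<sigma> (src (D e)) \<noteq> 0" by (rule potential_nonzero[OF pot])
      then have "lift_x \<alpha> p (src (D e)) \<noteq> lift_x \<alpha> p (dst (D e))
          \<or> lift_y \<sigma> \<beta> p (src (D e)) \<noteq> lift_y \<sigma> \<beta> p (dst (D e))"
        using lift_difference[OF pot[unfolded 3] e, of p] indep_at_row_nonzero[OF ind e finF] by auto
      then show "\<exists>v\<in>?W. \<exists>w\<in>?W. lift_x \<alpha> p v \<noteq> lift_x \<alpha> p w \<or> lift_y \<sigma> \<beta> p v \<noteq> lift_y \<sigma> \<beta> p w"
        using e by blast
    qed (use F in simp)
    show "(\<Sum>j\<in>?W \<times> UNIV. edge_row (D e) p j * trivial_row \<sigma> \<alpha> \<beta> p i j) = 0"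
      if "e \<in> F" "i \<in> {..<defect D F}" for e i
      using that trivial_row_kernel[OF pot _ k] finF by (subst sum_edge_row) auto
  qed (use finF in auto)
  then show "card F + defect D F \<le> 2 * card ?W" by (simp add: card_cartesian_product)
qed

text \<open>With this many independent edges the trivial motions already exhaust the kernel.
  \<open>W\<close> may exceed \<open>ends D F\<close>; later it contains neighbours of a removed
  vertex that the edge set itself may miss.\<close>

lemma kernel_trivial:
  assumes finF: "finite F" and ind: "indep_at D F p" and W: "finite W" "ends D F \<subseteq> W" "W \<noteq> {}"
    and pot: "potential D F k \<sigma> \<alpha> \<beta>" and k: "k \<le> 3" and u: "in_kernel D F p u"
    and two: "k = 3 \<Longrightarrow> \<exists>v\<in>W. \<exists>w\<in>W. lift_x \<alpha> p v \<noteq> lift_x \<alpha> p w \<or> lift_y \<sigma> \<beta> p v \<noteq> lift_y \<sigma> \<beta> p w"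
    and card: "2 * card W \<le> card F + k"
  shows "\<exists>\<theta> b c. trivial_on W k \<sigma> \<alpha> \<beta> p u \<theta> b c"
proof -
  have mem: "src (D e) \<in> W" "dst (D e) \<in> W" if "e \<in> F" for e using W that by blast+
  have "\<exists>c. \<forall>j\<in>W \<times> UNIV. u j = (\<Sum>i\<in>{..<k}. c i * trivial_row \<sigma> \<alpha> \<beta> p i j)"
  proof (rule kernel_spanned)
    show "rows_independent (\<lambda>e. edge_row (D e) p) F (W \<times> UNIV)"
      using ind W(2) indep_at_columns by blast
    show "rows_independent (trivial_row \<sigma> \<alpha> \<beta> p) {..<k} (W \<times> UNIV)"
      by (rule trivial_rows_independent[OF pot k W(3) two])
    show "(\<Sum>j\<in>W \<times> UNIV. edge_row (D e) p j * trivial_row \<sigma> \<alpha> \<beta> p i j) = 0"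
      if "e \<in> F" "i \<in> {..<k}" for e i
      using that trivial_row_kernel[OF pot _ k] W mem by (subst sum_edge_row) auto
    show "(\<Sum>j\<in>W \<times> UNIV. edge_row (D e) p j * u j) = 0" if "e \<in> F" for e
      using that u W mem by (subst sum_edge_row) (auto simp: in_kernel_def)
  qed (use finF W card in \<open>auto simp: card_cartesian_product\<close>)
  then obtain c where c: "\<forall>j\<in>W \<times> UNIV. u j = (\<Sum>i\<in>{..<k}. c i * trivial_row \<sigma> \<alpha> \<beta> p i j)"
    by (elim exE)
  let ?c = "\<lambda>i. if i < k then c i else 0"
  have "trivial_on W k \<sigma> \<alpha> \<beta> p u (?c 2) (?c 0) (?c 1)"
    unfolding trivial_on_def
  proof (intro conjI ballI)
    fix v assume v: "v \<in> W"
    show "u (v, 1) = ?c 0 - ?c 2 * lift_y \<sigma> \<beta> p v"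
      using bspec[OF c, of "(v, 1)"] v unfolding sum_trivial_row[OF k] by simp
    show "u (v, 2) = \<sigma> v * (?c 1 + ?c 2 * lift_x \<alpha> p v)"
      using bspec[OF c, of "(v, 2)"] v unfolding sum_trivial_row[OF k] by simp
  qed auto
  then show ?thesis by blast
qed

text \<open>Counterpart of \<open>kernel_trivial\<close>: few motions at a single placement force
  many edges.\<close>

lemma card_le_if_kernel_trivial:
  assumes finF: "finite F" and W: "finite W" "ends D F \<subseteq> W" and k: "1 \<le> k" "k \<le> 3"
    and sp: "\<And>u. in_kernel D F p u \<Longrightarrow> \<exists>\<theta> b c. trivial_on W k \<sigma> \<alpha> \<beta> p u \<theta> b c"
  shows "2 * card W \<le> card F + k"
proof -
  have mem: "src (D e) \<in> W" "dst (D e) \<in> W" if "e \<in> F" for e using W that by blast+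
  have "card (W \<times> (UNIV :: 2 set)) \<le> card F + card {..<k}"
  proof (rule card_columns_le[where A = "\<lambda>e. edge_row (D e) p" and U = "trivial_row \<sigma> \<alpha> \<beta> p"])
    fix u assume "\<And>e. e \<in> F \<Longrightarrow> (\<Sum>j\<in>W \<times> UNIV. edge_row (D e) p j * u j) = 0"
    then have "in_kernel D F p u" using W mem by (simp add: in_kernel_def sum_edge_row)
    then obtain \<theta> b c where t: "trivial_on W k \<sigma> \<alpha> \<beta> p u \<theta> b c" using sp by blast
    let ?c = "\<lambda>i::nat. if i = 0 then b else if i = 1 then c else \<theta>"
    have "u j = (\<Sum>i\<in>{..<k}. ?c i * trivial_row \<sigma> \<alpha> \<beta> p i j)" if "j \<in> W \<times> UNIV" for j
    proof -
      obtain v l where j: "j = (v, l)" "v \<in> W" using \<open>j \<in> W \<times> UNIV\<close> by auto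
      have "l = 1 \<or> l = 2" by (rule exhaust_2)
      then show ?thesis using t j k sum_trivial_row[OF k(2), of ?c \<sigma> \<alpha> \<beta> p v]
        unfolding trivial_on_def by auto
    qed
    then show "\<exists>c. \<forall>j\<in>W \<times> UNIV. u j = (\<Sum>i\<in>{..<k}. c i * trivial_row \<sigma> \<alpha> \<beta> p i j)"
      by (intro exI[of _ ?c] ballI)
  qed (use finF W in auto)
  then show ?thesis by (simp add: card_cartesian_product)
qed

section \<open>Blocked pairs of edges at a vertex of degree three\<close>

definition image_x :: "'v gain_edge \<Rightarrow> ('v \<Rightarrow> real^2) \<Rightarrow> real" where
  "image_x d p = p (dst d) $ 1 + shx d"

definition image_y :: "'v gain_edge \<Rightarrow> ('v \<Rightarrow> real^2) \<Rightarrow> real" where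
  "image_y d p = flip d * p (dst d) $ 2 + shy d"

text \<open>Twice the signed area of the triangle of the three heads, each moved by the gain of its
  edge, as seen from a common tail.\<close>

definition image_cross ::
    "'v gain_edge \<Rightarrow> 'v gain_edge \<Rightarrow> 'v gain_edge \<Rightarrow> ('v \<Rightarrow> real^2) \<Rightarrow> real" where
  "image_cross d d' d'' p =
     (image_x d' p - image_x d p) * (image_y d'' p - image_y d p)
     - (image_y d' p - image_y d p) * (image_x d'' p - image_x d p)"

lemma poly_along_image [simp]: "poly_along (image_x d)" "poly_along (image_y d)"
  using poly_along_component[of "dst d"] unfolding image_x_def[abs_def] image_y_def[abs_def] by simp_all

lemma generic_property_image_cross: "generic_property (\<lambda>p. image_cross d d' d'' p \<noteq> 0)"
  unfolding image_cross_def by (intro generic_property_nonzero) simp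

text \<open>All lifts are composed with the inverse of the lift at \<open>v\<close>.\<close>

lemma potential_normalized:
  assumes "potential D F k \<sigma> \<alpha> \<beta>"
  shows "\<exists>\<sigma> \<alpha> \<beta>. potential D F k \<sigma> \<alpha> \<beta> \<and> \<sigma> v = 1 \<and> \<alpha> v = 0 \<and> \<beta> v = 0"
proof (intro exI conjI)
  show "potential D F k (\<lambda>w. \<sigma> v * \<sigma> w) (\<lambda>w. \<alpha> w - \<alpha> v) (\<lambda>w. \<sigma> v * (\<beta> w - \<beta> v))"
    unfolding potential_def
  proof (intro conjI allI impI ballI)
    fix w show "\<sigma> v * \<sigma> w * (\<sigma> v * \<sigma> w) = 1"
      using potential_sign[OF assms, of v] potential_sign[OF assms, of w] by algebra
  qed (use assms in \<open>auto simp: potential_def algebra_simps\<close>)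
qed (use potential_sign[OF assms] in simp_all)

text \<open>Satisfiability is carried along because \<open>generic_property\<close> holds vacuously
  for a contradictory property.\<close>

lemma generic_property_finite_conj:
  assumes "finite I" "\<And>i. i \<in> I \<Longrightarrow> generic_property (Q i)" "\<And>i. i \<in> I \<Longrightarrow> \<exists>p. Q i p"
  shows "generic_property (\<lambda>p. \<forall>i\<in>I. Q i p) \<and> (\<exists>p. \<forall>i\<in>I. Q i p)"
  using assms
proof (induction I rule: finite_induct)
  case empty
  then show ?case by (simp add: generic_property_def)
next
  case (insert i I)
  then have 1: "generic_property (Q i)" and 2: "generic_property (\<lambda>p. \<forall>i\<in>I. Q i p)"
    and ex: "\<exists>p. Q i p" "\<exists>p. \<forall>i\<in>I. Q i p"
    by simp_all
  obtain p q where "Q i p" "\<forall>i\<in>I. Q i q" using ex by blast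
  then obtain r where "Q i r" "\<forall>i\<in>I. Q i r" by (rule generic_property_meet[OF 1 2])
  then show ?case using generic_property_conj[OF 1 2] by auto
qed

text \<open>The infinitesimal isometry with index \<open>k\<close> is known at the two corners of
  the triangle other than \<open>k\<close>. Two of them share a single corner, about which they may
  still differ by a rotation. Going once around the triangle gives a linear relation between two
  edge vectors with the differences of the angular velocities as coefficients, and nonzero area
  makes these vectors independent.\<close>

lemma rotations_agree:
  fixes t\<^sub>0 t\<^sub>1 t\<^sub>2 :: real
  assumes cross: "(x\<^sub>1 - x\<^sub>0) * (y\<^sub>2 - y\<^sub>0) - (y\<^sub>1 - y\<^sub>0) * (x\<^sub>2 - x\<^sub>0) \<noteq> 0"
    and 0: "u\<^sub>1 = b\<^sub>0 - t\<^sub>0 * y\<^sub>1" "w\<^sub>1 = c\<^sub>0 + t\<^sub>0 * x\<^sub>1" "u\<^sub>2 = b\<^sub>0 - t\<^sub>0 * y\<^sub>2" "w\<^sub>2 = c\<^sub>0 + t\<^sub>0 * x\<^sub>2"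
    and 1: "u\<^sub>0 = b\<^sub>1 - t\<^sub>1 * y\<^sub>0" "w\<^sub>0 = c\<^sub>1 + t\<^sub>1 * x\<^sub>0" "u\<^sub>2 = b\<^sub>1 - t\<^sub>1 * y\<^sub>2" "w\<^sub>2 = c\<^sub>1 + t\<^sub>1 * x\<^sub>2"
    and 2: "u\<^sub>0 = b\<^sub>2 - t\<^sub>2 * y\<^sub>0" "w\<^sub>0 = c\<^sub>2 + t\<^sub>2 * x\<^sub>0" "u\<^sub>1 = b\<^sub>2 - t\<^sub>2 * y\<^sub>1" "w\<^sub>1 = c\<^sub>2 + t\<^sub>2 * x\<^sub>1"
  shows "t\<^sub>1 = t\<^sub>0 \<and> b\<^sub>1 = b\<^sub>0 \<and> c\<^sub>1 = c\<^sub>0 \<and> t\<^sub>2 = t\<^sub>0 \<and> b\<^sub>2 = b\<^sub>0 \<and> c\<^sub>2 = c\<^sub>0"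
proof -
  let ?c = "(x\<^sub>1 - x\<^sub>0) * (y\<^sub>2 - y\<^sub>0) - (y\<^sub>1 - y\<^sub>0) * (x\<^sub>2 - x\<^sub>0)"
  have y: "(t\<^sub>2 - t\<^sub>1) * (y\<^sub>0 - y\<^sub>1) + (t\<^sub>0 - t\<^sub>1) * (y\<^sub>1 - y\<^sub>2) = 0"
    and x: "(t\<^sub>2 - t\<^sub>1) * (x\<^sub>0 - x\<^sub>1) + (t\<^sub>0 - t\<^sub>1) * (x\<^sub>1 - x\<^sub>2) = 0"
    using 0 1 2 by (simp_all add: algebra_simps)
  have "(t\<^sub>2 - t\<^sub>1) * ?c = 0" "(t\<^sub>0 - t\<^sub>1) * ?c = 0" using x y by algebra+
  then have t: "t\<^sub>2 = t\<^sub>1" "t\<^sub>0 = t\<^sub>1" using cross by auto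
  then show ?thesis using 0 1 2 by simp
qed

text \<open>If every \<open>T k\<close> is tight together with the two edges other than \<open>e k\<close>, the rigid motions of
  the three sets coincide because they agree on the triangle of neighbours. This bounds the
  kernel of the union by its defect, so the union has too many edges.\<close>

lemma not_all_pairs_blocked:
  fixes D :: "'e \<Rightarrow> 'v gain_edge" and e :: "nat \<Rightarrow> 'e"
  defines "pr k \<equiv> e ` ({..<3} - {k})"
  assumes sparse: "count_sparse D (E \<union> e ` {..<3})" and finE: "finite E"
    and inj: "inj_on e {..<3}" and new: "e ` {..<3} \<inter> E = {}"
    and src: "\<And>k. k < 3 \<Longrightarrow> src (D (e k)) = v" and dst: "\<And>k. k < 3 \<Longrightarrow> dst (D (e k)) \<noteq> v"
    and v: "v \<notin> ends D E"
    and ind: "\<exists>p. indep_at D E p"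
    and cross: "\<exists>p. image_cross (D (e 0)) (D (e 1)) (D (e 2)) p \<noteq> 0"
  shows "\<exists>k<3. \<forall>T\<subseteq>E. card T + defect D (T \<union> pr k) + 2 < 2 * card (ends D (T \<union> pr k))"
proof (rule ccontr)
  assume neg: "\<not> ?thesis"
  have "\<forall>k\<in>{..<3}. \<exists>T. T \<subseteq> E \<and> 2 * card (ends D (T \<union> pr k)) \<le> card T + defect D (T \<union> pr k) + 2"
    using neg by (metis lessThan_iff not_less)
  from bchoice[OF this] obtain T where
    T': "\<forall>k\<in>{..<3}. T k \<subseteq> E \<and> 2 * card (ends D (T k \<union> pr k)) \<le> card (T k) + defect D (T k \<union> pr k) + 2"
    by (elim exE)
  then have T: "T k \<subseteq> E" "2 * card (ends D (T k \<union> pr k)) \<le> card (T k) + defect D (T k \<union> pr k) + 2"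
    if "k < 3" for k using that by blast+
  define F where "F k = T k \<union> pr k" for k
  define d where "d k = defect D (F k)" for k
  \<comment> \<open>With all three potentials trivial at \<open>v\<close>, a potential of full rank
    lifts a neighbour of \<open>v\<close> to its image as seen from \<open>v\<close>, independently
    of \<open>k\<close>.\<close>
  have "\<exists>\<sigma> \<alpha> \<beta>. potential D (F k) (d k) \<sigma> \<alpha> \<beta> \<and> \<sigma> v = 1 \<and> \<alpha> v = 0 \<and> \<beta> v = 0" for k
    unfolding d_def using defect_potential[of D "F k"] potential_normalized by metis
  then obtain \<sigma> \<alpha> \<beta> where pot: "\<And>k. potential D (F k) (d k) (\<sigma> k) (\<alpha> k) (\<beta> k)"
    and at_v: "\<And>k. \<sigma> k v = 1" "\<And>k. \<alpha> k v = 0" "\<And>k. \<beta> k v = 0"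
    by metis
  have d: "1 \<le> d k" "d k \<le> 3" for k using defect_cases[of D "F k"] by (auto simp: d_def)
  define W where "W k = ends D (F k) - {v}" for k
  have e_in_F: "e i \<in> F k" if "i < 3" "k < 3" "i \<noteq> k" for i k
    using that by (auto simp: F_def pr_def)
  have finF: "finite (F k)" "finite (T k)" if "k < 3" for k
    using T(1)[OF that] finE finite_subset by (auto simp: F_def pr_def)
  have v_in: "v \<in> ends D (F k)" if "k < 3" for k
  proof -
    have "\<exists>i<3. i \<noteq> k" by (rule exI[of _ "if k = 0 then 1 else 0"]) simp
    then show ?thesis using src_in_ends[of _ "F k" D] e_in_F src that by metis
  qed
  have v_notin_T: "v \<notin> ends D (T k)" if "k < 3" for k using v ends_mono[OF T(1)[OF that], of D] by blast
  have T_W: "ends D (T k) \<subseteq> W k" if "k < 3" for k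
    using v_notin_T[OF that] by (auto simp: W_def F_def)
  have finW: "finite (W k)" if "k < 3" for k using finF[OF that] by (simp add: W_def)
  \<comment> \<open>Deleting \<open>v\<close> frees two columns and removes the two edges of
    \<open>pr k\<close>, so the bounds balance. Neighbours of \<open>v\<close> that
    \<open>T k\<close> misses still belong to \<open>W k\<close>.\<close>
  have tight: "2 * card (W k) \<le> card (T k) + d k" if "k < 3" for k
    using T(2)[OF that] v_in[OF that] finF[OF that] unfolding W_def d_def F_def
    by (simp add: card_Diff_singleton)
  have dst_W: "dst (D (e i)) \<in> W k" if "i < 3" "k < 3" "i \<noteq> k" for i k
    using dst_in_ends[OF e_in_F[OF that]] dst[OF that(1)] by (auto simp: W_def)

  define I where "I = (\<Union>k<3. W k) \<times> {..<3::nat} \<times> {..<3::nat}"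
  \<comment> \<open>If two lifts have opposite signs at \<open>z\<close>, then \<open>Q\<close> says
    that they send \<open>z\<close> to different heights. This will kill the rotation. The witness
    below makes the expression equal to one.\<close>
  define Q where "Q = (\<lambda>(z, i, j) (p :: 'v \<Rightarrow> real^2).
    \<sigma> i z * p z $ 2 * 2 + (\<beta> i z - \<beta> j z) \<noteq> 0)"
  have "generic_property (Q n) \<and> (\<exists>p. Q n p)" for n
  proof -
    obtain z i j where n: "n = (z, i, j)" by (cases n)
    have g: "generic_property (Q n)"
      unfolding n Q_def case_prod_conv by (intro generic_property_nonzero) simp
    have "\<sigma> i z \<noteq> 0" by (rule potential_nonzero[OF pot])
    then have "Q n (\<lambda>_. vec ((1 - (\<beta> i z - \<beta> j z)) / (2 * \<sigma> i z)))"
      unfolding n Q_def by (simp add: field_simps)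
    with g show ?thesis by blast
  qed
  moreover have "finite I" using finW by (simp add: I_def)
  ultimately have Q: "generic_property (\<lambda>p. \<forall>n\<in>I. Q n p)" "\<exists>p. \<forall>n\<in>I. Q n p"
    using generic_property_finite_conj[of I Q] by blast+
  let ?cr = "image_cross (D (e 0)) (D (e 1)) (D (e 2))"
  obtain p1 p2 where "indep_at D E p1" "?cr p2 \<noteq> 0" using ind cross by blast
  then obtain p3 where "indep_at D E p3 \<and> ?cr p3 \<noteq> 0"
    by (rule generic_property_meet[OF generic_property_indep_at[OF finE] generic_property_image_cross]) blast
  moreover obtain p4 where "\<forall>n\<in>I. Q n p4" using Q by blast
  ultimately obtain p where "indep_at D E p \<and> ?cr p \<noteq> 0" and pQ: "\<forall>n\<in>I. Q n p"
    by (rule generic_property_meet[OF generic_property_conj[OF generic_property_indep_at[OF finE]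
      generic_property_image_cross] Q(1)])
  then have indp: "indep_at D E p" and cr: "?cr p \<noteq> 0" by blast+

  have lift_at: "2 \<le> d k \<Longrightarrow> \<sigma> k (dst (D (e i))) = flip (D (e i))"
    "3 \<le> d k \<Longrightarrow> lift_x (\<alpha> k) p (dst (D (e i))) = image_x (D (e i)) p"
    "3 \<le> d k \<Longrightarrow> lift_y (\<sigma> k) (\<beta> k) p (dst (D (e i))) = image_y (D (e i)) p"
    if "i < 3" "k < 3" "i \<noteq> k" for i k
    using pot[of k] e_in_F[OF that] at_v src[OF that(1)]
    by (auto simp: potential_def lift_x_def lift_y_def image_x_def image_y_def)

  define H where "H = T 0 \<union> T 1 \<union> T 2"
  have less3: "k < 3 \<longleftrightarrow> k = 0 \<or> k = 1 \<or> k = 2" for k :: nat by auto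
  have T_H: "T k \<subseteq> H" if "k < 3" for k using that by (auto simp: H_def less3)
  have kernel: "\<exists>\<theta> b c. trivial_on (W k) (d k) (\<sigma> k) (\<alpha> k) (\<beta> k) p u \<theta> b c"
    if k: "k < 3" and u: "in_kernel D H p u" for k u
  proof (rule kernel_trivial[OF finF(2)[OF k] _ finW[OF k] T_W[OF k] _ _ d(2)])
    show "indep_at D (T k) p" by (rule indep_at_mono[OF indp T(1)[OF k] finE])
    show "W k \<noteq> {}"
      using dst_W[of 1 k] dst_W[of 0 k] k by (cases "k = 0") auto
    show "potential D (T k) (d k) (\<sigma> k) (\<alpha> k) (\<beta> k)"
      by (rule potential_mono[OF pot]) (auto simp: F_def)
    show "in_kernel D (T k) p u" using u T_H[OF k] by (auto simp: in_kernel_def)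
    show "2 * card (W k) \<le> card (T k) + d k" by (rule tight[OF k])
    assume 3: "d k = 3"
    define i j where "i = (if k = 0 then 1 else 0 :: nat)" and "j = (if k = 2 then 1 else 2 :: nat)"
    have ij: "i < 3" "i \<noteq> k" "j < 3" "j \<noteq> k" by (auto simp: i_def j_def)
    have "image_x (D (e i)) p \<noteq> image_x (D (e j)) p \<or> image_y (D (e i)) p \<noteq> image_y (D (e j)) p"
      using cr k by (auto simp: i_def j_def image_cross_def less3)
    then show "\<exists>x\<in>W k. \<exists>y\<in>W k. lift_x (\<alpha> k) p x \<noteq> lift_x (\<alpha> k) p y \<or>
        lift_y (\<sigma> k) (\<beta> k) p x \<noteq> lift_y (\<sigma> k) (\<beta> k) p y"
      using dst_W[OF ij(1) k ij(2)] dst_W[OF ij(3) k ij(4)] lift_at[OF ij(1) k ij(2)]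
        lift_at[OF ij(3) k ij(4)] 3 by (metis order_refl)
  qed
  have common: "\<exists>\<theta> b c. \<forall>k<3. trivial_on (W k) (d k) (\<sigma> k) (\<alpha> k) (\<beta> k) p u \<theta> b c"
    if u: "in_kernel D H p u" for u
  proof -
    have "\<exists>\<theta> b c. k < 3 \<longrightarrow> trivial_on (W k) (d k) (\<sigma> k) (\<alpha> k) (\<beta> k) p u \<theta> b c" for k
      using kernel[OF _ u] by blast
    then obtain \<theta> b c where t: "\<And>k. k < 3 \<Longrightarrow> trivial_on (W k) (d k) (\<sigma> k) (\<alpha> k) (\<beta> k) p u (\<theta> k) (b k) (c k)"
      by metis
    \<comment> \<open>When \<open>d k < 3\<close> the lift of a neighbour need not be its image, but
      then \<theta> vanishes; when \<open>d k < 2\<close> the sign may be wrong as well, but then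
      \<open>c k\<close> vanishes. So the formulas in terms of images hold for every defect.\<close>
    have nb: "u (dst (D (e i)), 1) = b k - \<theta> k * image_y (D (e i)) p"
      "flip (D (e i)) * u (dst (D (e i)), 2) = c k + \<theta> k * image_x (D (e i)) p"
      if ik: "i < 3" "k < 3" "i \<noteq> k" for i k
    proof -
      let ?z = "dst (D (e i))"
      have u1: "u (?z, 1) = b k - \<theta> k * lift_y (\<sigma> k) (\<beta> k) p ?z"
        and u2: "u (?z, 2) = \<sigma> k ?z * (c k + \<theta> k * lift_x (\<alpha> k) p ?z)"
        and th: "d k < 3 \<Longrightarrow> \<theta> k = 0" and c: "d k < 2 \<Longrightarrow> c k = 0"
        using t[OF ik(2)] dst_W[OF ik] by (auto simp: trivial_on_def)
      have sq: "\<sigma> k ?z * \<sigma> k ?z = 1" by (rule potential_sign[OF pot])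
      have "\<theta> k = 0 \<or> lift_y (\<sigma> k) (\<beta> k) p ?z = image_y (D (e i)) p \<and> lift_x (\<alpha> k) p ?z = image_x (D (e i)) p"
        using th lift_at[OF ik] by (cases "d k < 3") auto
      then have y: "\<theta> k * lift_y (\<sigma> k) (\<beta> k) p ?z = \<theta> k * image_y (D (e i)) p"
        and x: "\<theta> k * lift_x (\<alpha> k) p ?z = \<theta> k * image_x (D (e i)) p" by auto
      show "u (?z, 1) = b k - \<theta> k * image_y (D (e i)) p" using u1 y by simp
      show "flip (D (e i)) * u (?z, 2) = c k + \<theta> k * image_x (D (e i)) p"
      proof (cases "d k < 2")
        case True
        then show ?thesis using u2 th c by simp
      next
        case False
        then have "flip (D (e i)) = \<sigma> k ?z" using lift_at(1)[OF ik] by simp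
        then show ?thesis using u2 x sq by (simp add: mult.assoc[symmetric])
      qed
    qed
    have "\<theta> 1 = \<theta> 0 \<and> b 1 = b 0 \<and> c 1 = c 0 \<and> \<theta> 2 = \<theta> 0 \<and> b 2 = b 0 \<and> c 2 = c 0"
      by (rule rotations_agree[OF cr[unfolded image_cross_def] nb[of 1 0] nb[of 2 0] nb[of 0 1] nb[of 2 1]
            nb[of 0 2] nb[of 1 2]]) simp_all
    then have "trivial_on (W k) (d k) (\<sigma> k) (\<alpha> k) (\<beta> k) p u (\<theta> 0) (b 0) (c 0)" if "k < 3" for k
      using t[OF that] that by (auto simp: less3)
    then show ?thesis by blast
  qed

  let ?W = "W 0 \<union> W 1 \<union> W 2" and ?H = "H \<union> e ` {..<3}"
  have W_k: "W k \<subseteq> ?W" if "k < 3" for k using that by (auto simp: less3)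
  have finH: "finite H" and H_E: "H \<subseteq> E" using finF T by (auto simp: H_def)
  have finW3: "finite ?W" using finW by simp
  have HF: "?H = F 0 \<union> F 1 \<union> F 2"
  proof -
    have "{..<3::nat} = {0, 1, 2}" by auto
    then show ?thesis by (auto simp: H_def F_def pr_def)
  qed
  have ends_H: "ends D ?H = insert v ?W"
    unfolding HF W_def using v_in[of 0] by auto
  have "card ?H + defect D ?H \<le> 2 * card (ends D ?H)"
  proof -
    have "e 0 \<in> ?H" by simp
    then have "?H \<noteq> {}" by blast
    moreover have "?H \<subseteq> E \<union> e ` {..<3}" using H_E by blast
    ultimately show ?thesis using sparse[unfolded count_sparse_def, rule_format, of ?H] by blast
  qed
  moreover have "card ?H = card H + 3"
    using inj new H_E finH by (subst card_Un_disjoint) (auto simp: card_image)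
  moreover have "card (ends D ?H) = Suc (card ?W)"
    unfolding ends_H using finW3 by (subst card_insert_disjoint) (auto simp: W_def)
  \<comment> \<open>The three edges at \<open>v\<close> outweigh its two columns, which makes the
    inequality strict. Each case below bounds the motions of \<open>H\<close> by at most
    \<open>defect D ?H\<close> parameters and contradicts it.\<close>
  ultimately have count: "card H + defect D ?H < 2 * card ?W" by simp
  have H_W: "ends D H \<subseteq> ?W" using T_W[of 0] T_W[of 1] T_W[of 2] by (auto simp: H_def)

  show False
  \<comment> \<open>The cases follow how much of the three potentials fits together: not even the
    signs, the signs only, or everything. Whatever fits glues to a potential of \<open>?H\<close>;
    what does not fit kills a parameter of the common motion.\<close>
  proof (cases "(\<exists>k<3. d k = 1) \<or> (\<exists>i<3. \<exists>j<3. \<exists>z\<in>W i \<inter> W j. \<sigma> i z \<noteq> \<sigma> j z)")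
    case True
    have "2 * card ?W \<le> card H + 1"
    proof (rule card_le_if_kernel_trivial[OF finH finW3 H_W])
      fix u assume "in_kernel D H p u"
      then obtain \<theta> b c where t: "\<And>k. k < 3 \<Longrightarrow> trivial_on (W k) (d k) (\<sigma> k) (\<alpha> k) (\<beta> k) p u \<theta> b c"
        using common by blast
      have z: "\<theta> = 0 \<and> c = 0" using True
      proof
        assume "\<exists>k<3. d k = 1"
        then show ?thesis using t by (force simp: trivial_on_def)
      next
        assume "\<exists>i<3. \<exists>j<3. \<exists>z\<in>W i \<inter> W j. \<sigma> i z \<noteq> \<sigma> j z"
        then obtain i j z where ij: "i < 3" "j < 3" "z \<in> W i" "z \<in> W j" and ne: "\<sigma> i z \<noteq> \<sigma> j z" by blast
        have "\<sigma> i z * \<sigma> i z = \<sigma> j z * \<sigma> j z"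
          using potential_sign[OF pot[of i], of z] potential_sign[OF pot[of j], of z] by simp
        then have neg: "\<sigma> j z = - \<sigma> i z" using ne by (simp add: square_eq_iff)
        have "(z, i, j) \<in> I" using ij by (auto simp: I_def)
        then have q: "\<sigma> i z * p z $ 2 * 2 + (\<beta> i z - \<beta> j z) \<noteq> 0" using pQ by (auto simp: Q_def)
        have "\<theta> * lift_y (\<sigma> i) (\<beta> i) p z = \<theta> * lift_y (\<sigma> j) (\<beta> j) p z"
          using t[OF ij(1)] t[OF ij(2)] ij by (auto simp: trivial_on_def)
        then have "\<theta> * (\<sigma> i z * p z $ 2 * 2 + (\<beta> i z - \<beta> j z)) = 0"
          by (simp add: lift_y_def neg algebra_simps)
        then have th: "\<theta> = 0" using q by simp
        then have "\<sigma> i z * c = \<sigma> j z * c"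
          using t[OF ij(1)] t[OF ij(2)] ij unfolding trivial_on_def by (metis mult_zero_left add_0_right)
        then have "c = 0" using ne by simp
        with th show ?thesis by simp
      qed
      have "trivial_on ?W 1 (\<lambda>_. 1) (\<lambda>_. 0) (\<lambda>_. 0) p u 0 b 0"
        using t[of 0] t[of 1] t[of 2] z by (auto simp: trivial_on_def)
      then show "\<exists>\<theta> b c. trivial_on ?W 1 (\<lambda>_. 1) (\<lambda>_. 0) (\<lambda>_. 0) p u \<theta> b c" by blast
    qed simp_all
    then show False using count defect_cases[of D ?H] by auto
  next
    case False
    then have d2: "2 \<le> d k" if "k < 3" for k using that d(1)[of k] by (metis One_nat_def Suc_1 not_less_eq_eq le_antisym)
    have cons: "\<sigma> i z = \<sigma> j z" if "i < 3" "j < 3" "z \<in> W i" "z \<in> W j" for i j z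
      using False that by blast
    define kk where "kk z = (SOME k. k < 3 \<and> z \<in> W k)" for z
    have kk: "kk z < 3 \<and> z \<in> W (kk z)" if "k < 3" "z \<in> W k" for k z
      unfolding kk_def by (rule someI[of _ k]) (use that in simp)
    have v_W: "v \<notin> W k" for k by (simp add: W_def)
    \<comment> \<open>A vertex may lie in several \<open>W k\<close>, but wherever the potentials
      agree the choice of index is immaterial; at \<open>v\<close> they agree by
      normalisation.\<close>
    define g where "g f z = (if z = v then f 0 v else f (kk z) z)" for f :: "nat \<Rightarrow> 'v \<Rightarrow> real" and z
    have \<sigma>_eq: "g \<sigma> z = \<sigma> k z" if "k < 3" "z \<in> insert v (W k)" for k z
      using that cons[of "kk z" k z] kk[of k z] by (auto simp: g_def at_v v_W)
    have F_W: "src (D x) \<in> insert v (W k)" "dst (D x) \<in> insert v (W k)" if "x \<in> F k" for x k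
      using src_in_ends[OF that, of D] dst_in_ends[OF that, of D] by (auto simp: W_def)
    have x_F: "\<exists>k<3. x \<in> F k" if "x \<in> ?H" for x
      using that unfolding HF by (auto simp: less3)
    have sq: "g \<sigma> z * g \<sigma> z = 1" for z
      unfolding g_def using potential_sign[OF pot] by simp
    have pot2: "potential D ?H 2 (g \<sigma>) \<alpha>' \<beta>'" for \<alpha>' \<beta>'
      unfolding potential_def
    proof (intro conjI allI impI ballI)
      fix x assume "x \<in> ?H"
      then obtain k where k: "k < 3" "x \<in> F k" using x_F by blast
      show "g \<sigma> (dst (D x)) = g \<sigma> (src (D x)) * flip (D x)"
        using pot[of k] d2[OF k(1)] k F_W[OF k(2)] \<sigma>_eq[OF k(1)] by (simp add: potential_def)
    qed (simp_all add: sq)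
    show False
    proof (cases "\<forall>i<3. d i = 3 \<and> (\<forall>j<3. \<forall>z\<in>W i \<inter> W j. \<alpha> i z = \<alpha> j z \<and> \<beta> i z = \<beta> j z)")
      case True
      have \<alpha>\<beta>_eq: "g \<alpha> z = \<alpha> k z" "g \<beta> z = \<beta> k z" if "k < 3" "z \<in> insert v (W k)" for k z
        using that True kk[of k z] by (auto simp: g_def at_v v_W)
      have pot3: "potential D ?H 3 (g \<sigma>) (g \<alpha>) (g \<beta>)"
        unfolding potential_def
      proof (intro conjI allI impI)
        show "\<forall>x\<in>?H. g \<sigma> (dst (D x)) = g \<sigma> (src (D x)) * flip (D x)"
          using pot2[of "g \<alpha>" "g \<beta>"] by (simp add: potential_def)
        show "\<forall>x\<in>?H. g \<alpha> (dst (D x)) = g \<alpha> (src (D x)) + shx (D x) \<and>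
            g \<beta> (dst (D x)) = g \<beta> (src (D x)) + g \<sigma> (src (D x)) * shy (D x)"
        proof
          fix x assume "x \<in> ?H"
          then obtain k where k: "k < 3" "x \<in> F k" using x_F by blast
          show "g \<alpha> (dst (D x)) = g \<alpha> (src (D x)) + shx (D x) \<and>
              g \<beta> (dst (D x)) = g \<beta> (src (D x)) + g \<sigma> (src (D x)) * shy (D x)"
            using pot[of k] True k F_W[OF k(2)] \<sigma>_eq[OF k(1)] \<alpha>\<beta>_eq[OF k(1)]
            by (simp add: potential_def)
        qed
      qed (simp add: sq)
      have "2 * card ?W \<le> card H + 3"
      proof (rule card_le_if_kernel_trivial[OF finH finW3 H_W])
        fix u assume "in_kernel D H p u"
        then obtain \<theta> b c where t: "\<And>k. k < 3 \<Longrightarrow> trivial_on (W k) (d k) (\<sigma> k) (\<alpha> k) (\<beta> k) p u \<theta> b c"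
          using common by blast
        have f: "u (z, 1) = b - \<theta> * lift_y (g \<sigma>) (g \<beta>) p z \<and> u (z, 2) = g \<sigma> z * (c + \<theta> * lift_x (g \<alpha>) p z)"
          if "k < 3" "z \<in> W k" for k z
          using t[OF that(1)] that \<sigma>_eq[of k z] \<alpha>\<beta>_eq[of k z]
          by (auto simp: trivial_on_def lift_x_def lift_y_def)
        have "trivial_on ?W 3 (g \<sigma>) (g \<alpha>) (g \<beta>) p u \<theta> b c"
          using f[of 0] f[of 1] f[of 2] by (auto simp: trivial_on_def)
        then show "\<exists>\<theta> b c. trivial_on ?W 3 (g \<sigma>) (g \<alpha>) (g \<beta>) p u \<theta> b c" by blast
      qed simp_all
      then show False using count defect_ge[OF pot3] by simp
    next
      case False
      have "2 * card ?W \<le> card H + 2"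
      proof (rule card_le_if_kernel_trivial[OF finH finW3 H_W])
        fix u assume "in_kernel D H p u"
        then obtain \<theta> b c where t: "\<And>k. k < 3 \<Longrightarrow> trivial_on (W k) (d k) (\<sigma> k) (\<alpha> k) (\<beta> k) p u \<theta> b c"
          using common by blast
        obtain i where i: "i < 3" "d i \<noteq> 3 \<or> (\<exists>j<3. \<exists>z\<in>W i \<inter> W j. \<alpha> i z \<noteq> \<alpha> j z \<or> \<beta> i z \<noteq> \<beta> j z)"
          using False by blast
        have "\<theta> = 0" using i(2)
        proof
          assume "d i \<noteq> 3"
          then show ?thesis using t[OF i(1)] d(2)[of i] by (simp add: trivial_on_def)
        next
          assume "\<exists>j<3. \<exists>z\<in>W i \<inter> W j. \<alpha> i z \<noteq> \<alpha> j z \<or> \<beta> i z \<noteq> \<beta> j z"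
          then obtain j z where j: "j < 3" "z \<in> W i" "z \<in> W j" "\<alpha> i z \<noteq> \<alpha> j z \<or> \<beta> i z \<noteq> \<beta> j z" by blast
          have s: "\<sigma> j z = \<sigma> i z" using cons[OF i(1) j(1-3)] by simp
          have nz: "\<sigma> i z \<noteq> 0" by (rule potential_nonzero[OF pot])
          \<comment> \<open>One isometry acts on two lifts of \<open>z\<close> that differ by a
            nonzero translation; equal velocities leave no rotation.\<close>
          have "\<theta> * lift_y (\<sigma> i) (\<beta> i) p z = \<theta> * lift_y (\<sigma> j) (\<beta> j) p z"
            "\<sigma> i z * (c + \<theta> * lift_x (\<alpha> i) p z) = \<sigma> j z * (c + \<theta> * lift_x (\<alpha> j) p z)"
            using t[OF i(1), unfolded trivial_on_def, THEN conjunct2, THEN conjunct2, rule_format, OF j(2)]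
              t[OF j(1), unfolded trivial_on_def, THEN conjunct2, THEN conjunct2, rule_format, OF j(3)]
            by linarith+
          then have "\<theta> * (\<beta> i z - \<beta> j z) = 0" "\<theta> * (\<alpha> i z - \<alpha> j z) = 0"
            using nz by (simp_all add: s lift_x_def lift_y_def algebra_simps)
          then show ?thesis using j(4) by auto
        qed
        then have f: "u (z, 1) = b \<and> u (z, 2) = g \<sigma> z * c" if "k < 3" "z \<in> W k" for k z
          using t[OF that(1)] that \<sigma>_eq[of k z] by (auto simp: trivial_on_def)
        have "trivial_on ?W 2 (g \<sigma>) (\<lambda>_. 0) (\<lambda>_. 0) p u 0 b c"
          using f[of 0] f[of 1] f[of 2] by (auto simp: trivial_on_def)
        then show "\<exists>\<theta> b c. trivial_on ?W 2 (g \<sigma>) (\<lambda>_. 0) (\<lambda>_. 0) p u \<theta> b c" by blast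
      qed simp_all
      then show False using count defect_ge[OF pot2] by fastforce
    qed
  qed
qed

section \<open>Extensions\<close>

lemma rows_vanish_at: "v \<notin> ends D E \<Longrightarrow> (\<Sum>e\<in>E. c e * edge_row (D e) p (v, k)) = 0"
  by (intro sum.neutral) (auto simp: ends_def edge_row_outside)

lemma split_rows:
  assumes fin: "finite E" "finite S" and disj: "E \<inter> S = {}" and v: "v \<notin> ends D E"
    and pq: "\<And>w. w \<noteq> v \<Longrightarrow> q w = p w"
  shows "(\<Sum>e\<in>E \<union> S. c e * edge_row (D e) q j)
    = (\<Sum>e\<in>E. c e * edge_row (D e) p j) + (\<Sum>e\<in>S. c e * edge_row (D e) q j)"
proof -
  have "edge_row (D e) q = edge_row (D e) p" if "e \<in> E" for e
  proof -
    have "q (src (D e)) = p (src (D e))" "q (dst (D e)) = p (dst (D e))"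
      using v that pq by (auto simp: ends_def)
    then have x: "edge_x (D e) q = edge_x (D e) p" and y: "edge_y (D e) q = edge_y (D e) p"
      by (simp_all add: edge_x_def edge_y_def)
    show ?thesis unfolding edge_row_def x y ..
  qed
  then show ?thesis by (simp add: sum.union_disjoint[OF fin disj])
qed

text \<open>The matrix is block triangular: the rows of \<open>E\<close> vanish in the columns of
  \<open>v\<close>, so these columns determine the coefficients on \<open>S\<close> first.\<close>

lemma indep_at_extend:
  assumes fin: "finite E" "finite S" and disj: "E \<inter> S = {}" and v: "v \<notin> ends D E"
    and ind: "indep_at D E p" and pq: "\<And>w. w \<noteq> v \<Longrightarrow> q w = p w"
    and S: "\<And>c. (\<And>k. (\<Sum>e\<in>S. c e * edge_row (D e) q (v, k)) = 0) \<Longrightarrow> \<forall>e\<in>S. c e = 0"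
  shows "indep_at D (E \<union> S) q"
  unfolding indep_at_def rows_independent_def
proof (intro allI impI)
  fix c assume c: "\<forall>j\<in>UNIV. (\<Sum>e\<in>E \<union> S. c e * edge_row (D e) q j) = 0"
  have s0: "(\<Sum>e\<in>E. c e * edge_row (D e) p j) + (\<Sum>e\<in>S. c e * edge_row (D e) q j) = 0" for j
    using bspec[OF c UNIV_I, of j] split_rows[OF fin disj v, of q p c j] pq by simp
  note at_v = rows_vanish_at[OF v, where c = c]
  have cS: "\<forall>e\<in>S. c e = 0"
  proof (rule S)
    show "(\<Sum>e\<in>S. c e * edge_row (D e) q (v, k)) = 0" for k
      using s0[of "(v, k)"] at_v[of p k] by simp
  qed
  then have "(\<Sum>e\<in>E. c e * edge_row (D e) p j) = 0" for j using s0[of j] by simp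
  then have "c e = 0" if "e \<in> E" for e
    using rows_independentD[OF ind[unfolded indep_at_def], of c e] that by simp
  with cS show "\<forall>e\<in>E \<union> S. c e = 0" by blast
qed

text \<open>The linear side of a 1-extension: the rows of the edges at \<open>v\<close> are traded for the row of the
  new edge.\<close>

lemma indep_at_eliminate:
  assumes fin: "finite E" "finite S" and disj: "E \<inter> S = {}" and v: "v \<notin> ends D E"
    and e: "e\<^sub>1 \<notin> E" and ind: "indep_at (D(e\<^sub>1 := d)) (insert e\<^sub>1 E) p"
    and pq: "\<And>w. w \<noteq> v \<Longrightarrow> q w = p w"
    and S: "\<And>c. (\<And>k. (\<Sum>e\<in>S. c e * edge_row (D e) q (v, k)) = 0) \<Longrightarrow>
      \<exists>t. (\<forall>j. (\<Sum>e\<in>S. c e * edge_row (D e) q j) = t * edge_row d p j) \<and> (t = 0 \<longrightarrow> (\<forall>e\<in>S. c e = 0))"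
  shows "indep_at D (E \<union> S) q"
  unfolding indep_at_def rows_independent_def
proof (intro allI impI)
  fix c assume c: "\<forall>j\<in>UNIV. (\<Sum>e\<in>E \<union> S. c e * edge_row (D e) q j) = 0"
  have s0: "(\<Sum>e\<in>E. c e * edge_row (D e) p j) + (\<Sum>e\<in>S. c e * edge_row (D e) q j) = 0" for j
    using bspec[OF c UNIV_I, of j] split_rows[OF fin disj v, of q p c j] pq by simp
  note at_v = rows_vanish_at[OF v, where c = c]
  have "(\<Sum>e\<in>S. c e * edge_row (D e) q (v, k)) = 0" for k
    using s0[of "(v, k)"] at_v[of p k] by simp
  then obtain t where t: "\<And>j. (\<Sum>e\<in>S. c e * edge_row (D e) q j) = t * edge_row d p j"
    and t0: "t = 0 \<Longrightarrow> \<forall>e\<in>S. c e = 0"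
    using S[of c] by blast
  have E: "(\<Sum>e\<in>E. c e * edge_row (D e) p j) + t * edge_row d p j = 0" for j
    using s0[of j] t[of j] by simp
  let ?c = "c(e\<^sub>1 := t)" and ?D = "D(e\<^sub>1 := d)"
  have "(\<Sum>e\<in>insert e\<^sub>1 E. ?c e * edge_row (?D e) p j) = 0" for j
  proof -
    have "(\<Sum>e\<in>E. ?c e * edge_row (?D e) p j) = (\<Sum>e\<in>E. c e * edge_row (D e) p j)"
      using e by (intro sum.cong) auto
    then show ?thesis using E[of j] fin e by simp
  qed
  then have z: "?c e = 0" if "e \<in> insert e\<^sub>1 E" for e
    using rows_independentD[OF ind[unfolded indep_at_def], of ?c e] that by simp
  have "t = 0" using z[of e\<^sub>1] by simp
  moreover have "c e = 0" if "e \<in> E" for e using z[of e] that e by (auto split: if_splits)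
  ultimately show "\<forall>e\<in>E \<union> S. c e = 0" using t0 by blast
qed

lemma edge_row_at_src:
  assumes "src d = v" "dst d \<noteq> v"
  shows "edge_row d (p(v := m)) (v, 1) = m $ 1 - image_x d p"
    "edge_row d (p(v := m)) (v, 2) = m $ 2 - image_y d p"
  using assms by (simp_all add: edge_row_def edge_x_def edge_y_def image_x_def image_y_def)

lemma edge_row_from_src:
  assumes "src d = v" "dst d \<noteq> v" "w \<noteq> v"
  shows "edge_row d (p(v := m)) (w, 1) = - (m $ 1 - image_x d p) * of_bool (w = dst d)"
    "edge_row d (p(v := m)) (w, 2) = - (m $ 2 - image_y d p) * flip d * of_bool (w = dst d)"
  using assms by (simp_all add: edge_row_def edge_x_def edge_y_def image_x_def image_y_def algebra_simps)

lemma one_edge_extension: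
  assumes fin: "finite E" and v: "v \<notin> ends D E" and ind: "indep_at D E p"
    and e: "e \<notin> E" "src (D e) = v" "dst (D e) \<noteq> v"
  shows "\<exists>q. indep_at D (E \<union> {e}) q"
proof -
  let ?m = "vector [image_x (D e) p + 1, image_y (D e) p] :: real^2"
  have "indep_at D (E \<union> {e}) (p(v := ?m))"
  proof (rule indep_at_extend[OF fin _ _ v ind])
    fix c assume "\<And>k. (\<Sum>e\<in>{e}. c e * edge_row (D e) (p(v := ?m)) (v, k)) = 0"
    from this[of 1] show "\<forall>e\<in>{e}. c e = 0" by (simp add: edge_row_at_src[OF e(2,3)])
  qed (use e in auto)
  then show ?thesis by blast
qed

lemma two_edge_extension:
  assumes fin: "finite E" and v: "v \<notin> ends D E" and ind: "indep_at D E p"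
    and e: "e \<notin> E" "src (D e) = v" "dst (D e) \<noteq> v"
    and f: "f \<notin> E" "src (D f) = v" "dst (D f) \<noteq> v" "e \<noteq> f"
    and ne: "image_x (D e) p \<noteq> image_x (D f) p \<or> image_y (D e) p \<noteq> image_y (D f) p"
  shows "\<exists>q. indep_at D (E \<union> {e, f}) q"
proof -
  define dx dy where "dx = image_x (D f) p - image_x (D e) p"
    and "dy = image_y (D f) p - image_y (D e) p"
  \<comment> \<open>A quarter turn of the vector between the two images puts \<open>v\<close> off
    their line; the determinant at \<open>v\<close> is then the squared distance of the
    images.\<close>
  let ?m = "vector [image_x (D e) p - dy, image_y (D e) p + dx] :: real^2"
  have sq: "dx * dx + dy * dy \<noteq> 0" using ne by (auto simp: dx_def dy_def sum_squares_eq_zero_iff)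
  have "indep_at D (E \<union> {e, f}) (p(v := ?m))"
  proof (rule indep_at_extend[OF fin _ _ v ind])
    fix c assume c: "\<And>k. (\<Sum>e\<in>{e, f}. c e * edge_row (D e) (p(v := ?m)) (v, k)) = 0"
    have 1: "c e * - dy + c f * (- dy - dx) = 0" and 2: "c e * dx + c f * (dx - dy) = 0"
      using c[of 1] c[of 2] f(4)
      by (simp_all add: edge_row_at_src[OF e(2,3)] edge_row_at_src[OF f(2,3)] dx_def dy_def algebra_simps)
    have "c f * (dx * dx + dy * dy) = 0" "(c e + c f) * (dx * dx + dy * dy) = 0"
      using 1 2 by algebra+
    then show "\<forall>e\<in>{e, f}. c e = 0" using sq by auto
  qed (use e f in auto)
  then show ?thesis by blast
qed

text \<open>A reflecting loop constrains only the vertical coordinate of \<open>v\<close>, so one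
  further edge can be accommodated by giving it a horizontal component.\<close>

lemma loop_extension:
  assumes fin: "finite E" "finite S" and v: "v \<notin> ends D E" and ind: "indep_at D E p"
    and l: "l \<notin> E" "src (D l) = v" "dst (D l) = v" "flip (D l) = - 1"
    and S: "S \<subseteq> {f}" "f \<in> S \<Longrightarrow> f \<notin> E \<and> f \<noteq> l \<and> src (D f) = v \<and> dst (D f) \<noteq> v"
  shows "\<exists>q. indep_at D (E \<union> insert l S) q"
proof -
  \<comment> \<open>The first coordinate gives \<open>f\<close> the horizontal entry 1, the second
    makes the loop row \<open>(0, 2)\<close>.\<close>
  let ?m = "vector [image_x (D f) p + 1, (shy (D l) + 1) / 2] :: real^2"
  let ?q = "p(v := ?m)"
  have row: "edge_row (D l) ?q (v, 1) = 0" "edge_row (D l) ?q (v, 2) = 2"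
    using l by (simp_all add: edge_row_def edge_y_def field_simps)
  have "indep_at D (E \<union> insert l S) ?q"
  proof (rule indep_at_extend[OF fin(1) _ _ v ind])
    fix c assume c: "\<And>k. (\<Sum>e\<in>insert l S. c e * edge_row (D e) ?q (v, k)) = 0"
    consider "S = {}" | "S = {f}" "f \<noteq> l" "src (D f) = v" "dst (D f) \<noteq> v" using S by blast
    then show "\<forall>e\<in>insert l S. c e = 0"
      using c[of 1] c[of 2] row by cases (auto simp: edge_row_at_src)
  qed (use l S fin in auto)
  then show ?thesis by blast
qed

text \<open>The walk backwards along \<open>d\<close> and forwards along \<open>d'\<close>, with net
  gain the inverse gain of \<open>d\<close> times the gain of \<open>d'\<close>; the formula uses
  that a sign is its own inverse.\<close>

definition contracted_edge :: "'v gain_edge \<Rightarrow> 'v gain_edge \<Rightarrow> 'v gain_edge" where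
  "contracted_edge d d' = Edge (dst d) (dst d') (flip d * flip d') (shx d' - shx d) (flip d * (shy d' - shy d))"

lemma edge_row_contracted:
  assumes "flip d * flip d = 1"
  shows "edge_row (contracted_edge d d') p (w, 1)
      = (image_x d p - image_x d' p) * (of_bool (w = dst d) - of_bool (w = dst d'))"
    "edge_row (contracted_edge d d') p (w, 2)
      = (image_y d p - image_y d' p) * (flip d * of_bool (w = dst d) - flip d' * of_bool (w = dst d'))"
proof -
  show "edge_row (contracted_edge d d') p (w, 1)
      = (image_x d p - image_x d' p) * (of_bool (w = dst d) - of_bool (w = dst d'))"
    by (simp add: edge_row_def edge_x_def image_x_def contracted_edge_def)
  have "edge_y (contracted_edge d d') p = flip d * (image_y d p - image_y d' p)"
    using assms by (simp add: edge_y_def image_y_def contracted_edge_def algebra_simps)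
  then have "edge_row (contracted_edge d d') p (w, 2) = flip d * (image_y d p - image_y d' p)
      * (of_bool (w = dst d) - flip d * flip d' * of_bool (w = dst d'))"
    by (simp add: edge_row_def) (simp add: contracted_edge_def)
  moreover have "flip d * r * (a - flip d * flip d' * b) = r * (flip d * a - flip d' * b)" for r a b
    using assms by algebra
  ultimately show "edge_row (contracted_edge d d') p (w, 2)
      = (image_y d p - image_y d' p) * (flip d * of_bool (w = dst d) - flip d' * of_bool (w = dst d'))"
    by simp
qed

text \<open>The hypotheses are the two columns at \<open>v\<close>, doubled, with \<open>v\<close>
  at the midpoint of the first two images: there the first two rows are opposite, and the third
  points off their line.\<close>

lemma midpoint_dependency:
  fixes c\<^sub>1 c\<^sub>2 c\<^sub>3 :: real
  assumes 1: "(c\<^sub>1 - c\<^sub>2) * (x\<^sub>2 - x\<^sub>1) + c\<^sub>3 * (x\<^sub>1 + x\<^sub>2 - 2 * x\<^sub>3) = 0"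
    and 2: "(c\<^sub>1 - c\<^sub>2) * (y\<^sub>2 - y\<^sub>1) + c\<^sub>3 * (y\<^sub>1 + y\<^sub>2 - 2 * y\<^sub>3) = 0"
    and cross: "(x\<^sub>2 - x\<^sub>1) * (y\<^sub>3 - y\<^sub>1) - (y\<^sub>2 - y\<^sub>1) * (x\<^sub>3 - x\<^sub>1) \<noteq> 0"
  shows "c\<^sub>3 = 0" "c\<^sub>1 = c\<^sub>2"
proof -
  let ?c = "(x\<^sub>2 - x\<^sub>1) * (y\<^sub>3 - y\<^sub>1) - (y\<^sub>2 - y\<^sub>1) * (x\<^sub>3 - x\<^sub>1)"
  have "2 * c\<^sub>3 * ?c = 0" using 1 2 by algebra
  then show c3: "c\<^sub>3 = 0" using cross by simp
  have "x\<^sub>2 - x\<^sub>1 \<noteq> 0 \<or> y\<^sub>2 - y\<^sub>1 \<noteq> 0" using cross by auto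
  then show "c\<^sub>1 = c\<^sub>2" using 1 2 c3 by auto
qed

lemma three_edge_extension:
  assumes fin: "finite E" and v: "v \<notin> ends D E"
    and new: "e\<^sub>1 \<notin> E" "e\<^sub>2 \<notin> E" "e\<^sub>3 \<notin> E" and ne: "e\<^sub>1 \<noteq> e\<^sub>2" "e\<^sub>1 \<noteq> e\<^sub>3" "e\<^sub>2 \<noteq> e\<^sub>3"
    and src: "src (D e\<^sub>1) = v" "src (D e\<^sub>2) = v" "src (D e\<^sub>3) = v"
    and dst: "dst (D e\<^sub>1) \<noteq> v" "dst (D e\<^sub>2) \<noteq> v" "dst (D e\<^sub>3) \<noteq> v"
    and sign: "flip (D e\<^sub>1) * flip (D e\<^sub>1) = 1"
    and ind: "indep_at (D(e\<^sub>1 := contracted_edge (D e\<^sub>1) (D e\<^sub>2))) (insert e\<^sub>1 E) p"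
    and cross: "image_cross (D e\<^sub>1) (D e\<^sub>2) (D e\<^sub>3) p \<noteq> 0"
  shows "\<exists>q. indep_at D (E \<union> {e\<^sub>1, e\<^sub>2, e\<^sub>3}) q"
proof -
  let ?x1 = "image_x (D e\<^sub>1) p" and ?x2 = "image_x (D e\<^sub>2) p" and ?x3 = "image_x (D e\<^sub>3) p"
  let ?y1 = "image_y (D e\<^sub>1) p" and ?y2 = "image_y (D e\<^sub>2) p" and ?y3 = "image_y (D e\<^sub>3) p"
  \<comment> \<open>With \<open>v\<close> at the midpoint, the sum of the first two rows is half the contracted row.\<close>
  let ?m = "vector [(?x1 + ?x2) / 2, (?y1 + ?y2) / 2] :: real^2"
  let ?q = "p(v := ?m)" and ?d = "contracted_edge (D e\<^sub>1) (D e\<^sub>2)"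
  note rows_at = edge_row_at_src[OF src(1) dst(1)] edge_row_at_src[OF src(2) dst(2)] edge_row_at_src[OF src(3) dst(3)]
  note rows_from = edge_row_from_src[OF src(1) dst(1)] edge_row_from_src[OF src(2) dst(2)]
  have "indep_at D (E \<union> {e\<^sub>1, e\<^sub>2, e\<^sub>3}) ?q"
  proof (rule indep_at_eliminate[OF fin _ _ v new(1) ind])
    fix c assume c: "\<And>k. (\<Sum>e\<in>{e\<^sub>1, e\<^sub>2, e\<^sub>3}. c e * edge_row (D e) ?q (v, k)) = 0"
    have "(c e\<^sub>1 - c e\<^sub>2) * (?x2 - ?x1) + c e\<^sub>3 * (?x1 + ?x2 - 2 * ?x3) = 0"
      "(c e\<^sub>1 - c e\<^sub>2) * (?y2 - ?y1) + c e\<^sub>3 * (?y1 + ?y2 - 2 * ?y3) = 0"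
      using c[of 1] c[of 2] ne by (simp_all add: rows_at field_simps)
    from midpoint_dependency[OF this cross[unfolded image_cross_def]]
    have c3: "c e\<^sub>3 = 0" and c12: "c e\<^sub>2 = c e\<^sub>1" by simp_all
    have row: "edge_row (D e\<^sub>1) ?q j + edge_row (D e\<^sub>2) ?q j = edge_row ?d p j / 2" for j
    proof -
      obtain w k where j: "j = (w, k)" by fastforce
      have "k = 1 \<or> k = 2" by (rule exhaust_2)
      then show ?thesis using dst
        unfolding j by (cases "w = v") (auto simp: rows_at rows_from edge_row_contracted[OF sign] field_simps)
    qed
    have "(\<Sum>e\<in>{e\<^sub>1, e\<^sub>2, e\<^sub>3}. c e * edge_row (D e) ?q j) = c e\<^sub>1 / 2 * edge_row ?d p j" for j
      using ne c3 c12 row[of j] by (simp add: distrib_left[symmetric])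
    then show "\<exists>t. (\<forall>j. (\<Sum>e\<in>{e\<^sub>1, e\<^sub>2, e\<^sub>3}. c e * edge_row (D e) ?q j) = t * edge_row ?d p j) \<and>
        (t = 0 \<longrightarrow> (\<forall>e\<in>{e\<^sub>1, e\<^sub>2, e\<^sub>3}. c e = 0))"
      using c3 c12 by (intro exI[of _ "c e\<^sub>1 / 2"]) auto
  qed (use new in auto)
  then show ?thesis by blast
qed

text \<open>With three parallel edges the images of \<open>w\<close> are collinear if the gains have equal horizontal
  parts, so the midpoint position is not available. Eliminating \<open>v\<close> from a generic position leaves a row at \<open>w\<close> that is vertical, hence a multiple of the row of the loop.\<close>

lemma triple_edge_extension:
  assumes fin: "finite E" and v: "v \<notin> ends D E"
    and new: "e\<^sub>1 \<notin> E" "e\<^sub>2 \<notin> E" "e\<^sub>3 \<notin> E" and ne: "e\<^sub>1 \<noteq> e\<^sub>2" "e\<^sub>1 \<noteq> e\<^sub>3" "e\<^sub>2 \<noteq> e\<^sub>3"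
    and src: "src (D e\<^sub>1) = v" "src (D e\<^sub>2) = v" "src (D e\<^sub>3) = v"
    and dst: "dst (D e\<^sub>1) = w" "dst (D e\<^sub>2) = w" "dst (D e\<^sub>3) = w" and w: "w \<noteq> v"
    and flip: "flip (D e\<^sub>1) * flip (D e\<^sub>1) = 1" "flip (D e\<^sub>2) = - flip (D e\<^sub>1)" "flip (D e\<^sub>3) = flip (D e\<^sub>1)"
    and diff: "D e\<^sub>1 \<noteq> D e\<^sub>3"
    and ind: "indep_at (D(e\<^sub>1 := contracted_edge (D e\<^sub>1) (D e\<^sub>2))) (insert e\<^sub>1 E) p"
  shows "\<exists>q. indep_at D (E \<union> {e\<^sub>1, e\<^sub>2, e\<^sub>3}) q"
proof -
  let ?d = "contracted_edge (D e\<^sub>1) (D e\<^sub>2)" and ?s = "flip (D e\<^sub>1)"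
  define x1 y1 y2 dx dy where "x1 = image_x (D e\<^sub>1) p" and "y1 = image_y (D e\<^sub>1) p"
    and "y2 = image_y (D e\<^sub>2) p" and "dx = shx (D e\<^sub>3) - shx (D e\<^sub>1)" and "dy = shy (D e\<^sub>3) - shy (D e\<^sub>1)"
  have d3: "image_x (D e\<^sub>3) p = x1 + dx" "image_y (D e\<^sub>3) p = y1 + dy"
    using dst flip by (simp_all add: image_x_def image_y_def x1_def y1_def dx_def dy_def)
  have dxy: "dx \<noteq> 0 \<or> dy \<noteq> 0"
    using diff src dst flip by (auto simp: dx_def dy_def intro: gain_edge.expand)
  \<comment> \<open>\<open>v\<close> is placed at offset \<open>(\<epsilon>, h)\<close> from the
    first image. Then \<open>cr\<close> is, up to sign, the determinant of the first and third rows
    at \<open>v\<close>, and the second condition on \<open>h\<close> keeps the vertical entry of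
    the second row nonzero.\<close>
  obtain h where h: "h \<noteq> 0" "h \<noteq> y2 - y1"
    using ex_new_if_finite[of "{0, y2 - y1}"] infinite_UNIV_char_0 by blast
  define \<epsilon> where "\<epsilon> = (if dx = 0 then 1 else 0 :: real)"
  have cr: "\<epsilon> * dy - h * dx \<noteq> 0" using dxy h by (auto simp: \<epsilon>_def)
  let ?m = "vector [x1 + \<epsilon>, y1 + h] :: real^2"
  let ?q = "p(v := ?m)"
  note dst' = w[folded dst(1)] w[folded dst(2)] w[folded dst(3)]
  note rows_at = edge_row_at_src[OF src(1) dst'(1)] edge_row_at_src[OF src(2) dst'(2)] edge_row_at_src[OF src(3) dst'(3)]
  note rows_from = edge_row_from_src[OF src(1) dst'(1)] edge_row_from_src[OF src(2) dst'(2)] edge_row_from_src[OF src(3) dst'(3)]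
  have d_row: "edge_row ?d p (z, 1) = 0" "edge_row ?d p (z, 2) = 2 * edge_y ?d p * of_bool (z = w)" for z
    using dst flip by (auto simp: edge_row_def contracted_edge_def edge_x_def)
  have d_nz: "edge_y ?d p \<noteq> 0"
  proof
    assume z: "edge_y ?d p = 0"
    have "edge_row ?d p j = 0" for j
    proof -
      obtain w k where j: "j = (w, k)" by fastforce
      have "k = 1 \<or> k = 2" by (rule exhaust_2)
      then show ?thesis unfolding j using d_row z by auto
    qed
    then have "(\<Sum>e\<in>insert e\<^sub>1 E. (if e = e\<^sub>1 then 1 else 0) * edge_row ((D(e\<^sub>1 := ?d)) e) p j) = 0" for j
      by (intro sum.neutral) auto
    from rows_independentD[OF ind[unfolded indep_at_def] this, of e\<^sub>1] show False by simp
  qed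
  have "indep_at D (E \<union> {e\<^sub>1, e\<^sub>2, e\<^sub>3}) ?q"
  proof (rule indep_at_eliminate[OF fin _ _ v new(1) ind])
    fix c assume c: "\<And>k. (\<Sum>e\<in>{e\<^sub>1, e\<^sub>2, e\<^sub>3}. c e * edge_row (D e) ?q (v, k)) = 0"
    define x2 where "x2 = image_x (D e\<^sub>2) p"
    have 1: "c e\<^sub>1 * \<epsilon> + c e\<^sub>2 * (x1 + \<epsilon> - x2) + c e\<^sub>3 * (\<epsilon> - dx) = 0"
      and 2: "c e\<^sub>1 * h + c e\<^sub>2 * (y1 + h - y2) + c e\<^sub>3 * (h - dy) = 0"
      using c[of 1] c[of 2] ne
      by (simp_all add: rows_at d3 x1_def[symmetric] y1_def[symmetric] x2_def[symmetric] y2_def[symmetric] algebra_simps)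
    \<comment> \<open>At \<open>w\<close> the horizontal entries cancel by the relation at
      \<open>v\<close>. Vertically the opposite sign of \<open>e\<^sub>2\<close> turns the
      cancellation into twice its term; \<open>t\<close> compares this remainder with the loop
      entry.\<close>
    define t where "t = ?s * c e\<^sub>2 * (y1 + h - y2) / edge_y ?d p"
    have "(\<Sum>e\<in>{e\<^sub>1, e\<^sub>2, e\<^sub>3}. c e * edge_row (D e) ?q j) = t * edge_row ?d p j" for j
    proof -
      obtain z k where j: "j = (z, k)" by fastforce
      consider "z = v" | "z \<noteq> v" "k = 1" | "z \<noteq> v" "k = 2" using exhaust_2[of k] by blast
      then show ?thesis
      proof cases
        case 1
        then have "edge_row ?d p j = 0" using w d_row exhaust_2[of k] by (auto simp: j)
        then show ?thesis using c[of k] 1 j by simp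
      next
        case 2
        have "(\<Sum>e\<in>{e\<^sub>1, e\<^sub>2, e\<^sub>3}. c e * edge_row (D e) ?q j)
            = - (c e\<^sub>1 * \<epsilon> + c e\<^sub>2 * (x1 + \<epsilon> - x2) + c e\<^sub>3 * (\<epsilon> - dx)) * of_bool (z = w)"
          using ne 2 unfolding j
          by (simp add: rows_from dst d3 x1_def[symmetric] x2_def[symmetric] algebra_simps)
        then show ?thesis using \<open>c e\<^sub>1 * \<epsilon> + _ + _ = 0\<close> d_row 2 j by simp
      next
        case 3
        have "(\<Sum>e\<in>{e\<^sub>1, e\<^sub>2, e\<^sub>3}. c e * edge_row (D e) ?q j)
            = (2 * c e\<^sub>2 * (y1 + h - y2) - (c e\<^sub>1 * h + c e\<^sub>2 * (y1 + h - y2) + c e\<^sub>3 * (h - dy)))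
              * ?s * of_bool (z = w)"
          using ne 3 unfolding j
          by (simp add: rows_from dst flip d3 y1_def[symmetric] y2_def[symmetric] algebra_simps)
        then show ?thesis using 2 d_row 3 j d_nz by (simp add: t_def)
      qed
    qed
    moreover have "\<forall>e\<in>{e\<^sub>1, e\<^sub>2, e\<^sub>3}. c e = 0" if "t = 0"
    proof -
      have "?s \<noteq> 0" using flip by auto
      then have c2: "c e\<^sub>2 = 0" using that d_nz h by (auto simp: t_def)
      have "c e\<^sub>3 * (\<epsilon> * dy - h * dx) = 0" "c e\<^sub>1 * (\<epsilon> * dy - h * dx) = 0"
        using 1 2 c2 by algebra+
      then show ?thesis using c2 cr by simp
    qed
    ultimately show "\<exists>t. (\<forall>j. (\<Sum>e\<in>{e\<^sub>1, e\<^sub>2, e\<^sub>3}. c e * edge_row (D e) ?q j) = t * edge_row ?d p j) \<and>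
        (t = 0 \<longrightarrow> (\<forall>e\<in>{e\<^sub>1, e\<^sub>2, e\<^sub>3}. c e = 0))"
      by blast
  qed (use new in auto)
  then show ?thesis by blast
qed

section \<open>Sparse gain graphs are generically independent\<close>

text \<open>A potential on the contracted set extends to \<open>v\<close> by solving the equation of
  \<open>e\<^sub>1\<close> for its tail; the equation of \<open>e\<^sub>2\<close> is then that of
  the contracted edge.\<close>

lemma defect_insert_contracted_le:
  assumes new: "e\<^sub>1 \<notin> T" and src: "src (D e\<^sub>1) = v" "src (D e\<^sub>2) = v"
    and dst: "dst (D e\<^sub>1) \<noteq> v" "dst (D e\<^sub>2) \<noteq> v" and v: "v \<notin> ends D T"
    and sign: "flip (D e\<^sub>1) * flip (D e\<^sub>1) = 1"
  shows "defect (D(e\<^sub>1 := contracted_edge (D e\<^sub>1) (D e\<^sub>2))) (insert e\<^sub>1 T) \<le> defect D (T \<union> {e\<^sub>1, e\<^sub>2})"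
proof -
  let ?D = "D(e\<^sub>1 := contracted_edge (D e\<^sub>1) (D e\<^sub>2))" and ?w = "dst (D e\<^sub>1)" and ?w' = "dst (D e\<^sub>2)"
  let ?k = "defect ?D (insert e\<^sub>1 T)"
  obtain \<sigma> \<alpha> \<beta> where pot: "potential ?D (insert e\<^sub>1 T) ?k \<sigma> \<alpha> \<beta>" by (rule defect_potential)
  define s where "s = \<sigma> ?w * flip (D e\<^sub>1)"
  have s: "s * flip (D e\<^sub>1) = \<sigma> ?w" "s * s = 1"
    unfolding s_def using sign potential_sign[OF pot, of ?w] by algebra+
  have neq: "src (D e) \<noteq> v" "dst (D e) \<noteq> v" "?D e = D e" if "e \<in> T" for e
    using v that new by (auto simp: ends_def)
  have "potential D (T \<union> {e\<^sub>1, e\<^sub>2}) ?k (\<sigma>(v := s)) (\<alpha>(v := \<alpha> ?w - shx (D e\<^sub>1))) (\<beta>(v := \<beta> ?w - s * shy (D e\<^sub>1)))"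
    unfolding potential_def
  proof (intro conjI allI impI ballI)
    fix z show "(\<sigma>(v := s)) z * (\<sigma>(v := s)) z = 1" using potential_sign[OF pot, of z] s by simp
  next
    fix e assume k: "2 \<le> ?k" and e: "e \<in> T \<union> {e\<^sub>1, e\<^sub>2}"
    have "\<sigma> ?w' = \<sigma> ?w * (flip (D e\<^sub>1) * flip (D e\<^sub>2))"
      using pot k by (auto simp: potential_def contracted_edge_def)
    moreover have "\<sigma> (dst (D e)) = \<sigma> (src (D e)) * flip (D e)" if "e \<in> T"
      using pot k that neq(3)[OF that] by (auto simp: potential_def)
    ultimately show "(\<sigma>(v := s)) (dst (D e)) = (\<sigma>(v := s)) (src (D e)) * flip (D e)"
      using e neq[of e] src dst s by (auto simp: s_def)
  next
    fix e assume k: "3 \<le> ?k" and e: "e \<in> T \<union> {e\<^sub>1, e\<^sub>2}"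
    have "\<alpha> ?w' = \<alpha> ?w + (shx (D e\<^sub>2) - shx (D e\<^sub>1))"
      "\<beta> ?w' = \<beta> ?w + s * (shy (D e\<^sub>2) - shy (D e\<^sub>1))"
      using pot k by (auto simp: potential_def contracted_edge_def s_def)
    moreover have "\<alpha> (dst (D e)) = \<alpha> (src (D e)) + shx (D e) \<and>
        \<beta> (dst (D e)) = \<beta> (src (D e)) + \<sigma> (src (D e)) * shy (D e)" if "e \<in> T"
      using pot k that neq(3)[OF that] by (auto simp: potential_def)
    ultimately have
      "(\<alpha>(v := \<alpha> ?w - shx (D e\<^sub>1))) (dst (D e)) = (\<alpha>(v := \<alpha> ?w - shx (D e\<^sub>1))) (src (D e)) + shx (D e) \<and>
       (\<beta>(v := \<beta> ?w - s * shy (D e\<^sub>1))) (dst (D e)) =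
         (\<beta>(v := \<beta> ?w - s * shy (D e\<^sub>1))) (src (D e)) + (\<sigma>(v := s)) (src (D e)) * shy (D e)"
      using e neq[of e] src dst by (auto simp: algebra_simps)
    then show "(\<alpha>(v := \<alpha> ?w - shx (D e\<^sub>1))) (dst (D e)) = (\<alpha>(v := \<alpha> ?w - shx (D e\<^sub>1))) (src (D e)) + shx (D e)"
      "(\<beta>(v := \<beta> ?w - s * shy (D e\<^sub>1))) (dst (D e)) =
         (\<beta>(v := \<beta> ?w - s * shy (D e\<^sub>1))) (src (D e)) + (\<sigma>(v := s)) (src (D e)) * shy (D e)"
      by blast+
  qed
  then show ?thesis by (rule defect_ge) (use defect_cases[of ?D "insert e\<^sub>1 T"] in auto)
qed

lemma count_sparse_insertI:
  assumes sparse: "count_sparse D E" and fin: "finite E" and new: "e\<^sub>1 \<notin> E"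
    and ins: "\<And>T. T \<subseteq> E \<Longrightarrow> card T + 1 + defect (D(e\<^sub>1 := d)) (insert e\<^sub>1 T)
      \<le> 2 * card ({src d, dst d} \<union> ends D T)"
  shows "count_sparse (D(e\<^sub>1 := d)) (insert e\<^sub>1 E)"
  unfolding count_sparse_def
proof (intro allI impI)
  fix F assume F: "F \<subseteq> insert e\<^sub>1 E" "F \<noteq> {}"
  have same: "ends (D(e\<^sub>1 := d)) T = ends D T" "defect (D(e\<^sub>1 := d)) T = defect D T" if "T \<subseteq> E" for T
    using that new by (intro ends_cong defect_cong; force)+
  show "card F + defect (D(e\<^sub>1 := d)) F \<le> 2 * card (ends (D(e\<^sub>1 := d)) F)"
  proof (cases "e\<^sub>1 \<in> F")
    case False
    then have "F \<subseteq> E" using F by blast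
    then show ?thesis using sparse F(2) same[of F] by (simp add: count_sparse_def)
  next
    case True
    define T where "T = F - {e\<^sub>1}"
    have T: "T \<subseteq> E" "F = insert e\<^sub>1 T" "e\<^sub>1 \<notin> T" "finite T"
      using F True fin finite_subset unfolding T_def by (auto intro: finite_subset)
    show ?thesis using ins[OF T(1)] T same(1)[OF T(1)] by simp
  qed
qed

text \<open>Contracting trades two edges for one and gives up the two columns of \<open>v\<close>,
  so the bound worsens by one; the strict inequality \<open>free\<close> pays for this. The label
  \<open>e\<^sub>1\<close> is reused for the new edge, which keeps the type of labels fixed in the
  induction.\<close>

lemma count_sparse_contracted:
  assumes sparse: "count_sparse D E" and fin: "finite E" and v: "v \<notin> ends D E"
    and new: "e\<^sub>1 \<notin> E" and src: "src (D e\<^sub>1) = v" "src (D e\<^sub>2) = v"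
    and dst: "dst (D e\<^sub>1) \<noteq> v" "dst (D e\<^sub>2) \<noteq> v" and sign: "flip (D e\<^sub>1) * flip (D e\<^sub>1) = 1"
    and free: "\<And>T. T \<subseteq> E \<Longrightarrow> card T + defect D (T \<union> {e\<^sub>1, e\<^sub>2}) + 2 < 2 * card (ends D (T \<union> {e\<^sub>1, e\<^sub>2}))"
  shows "count_sparse (D(e\<^sub>1 := contracted_edge (D e\<^sub>1) (D e\<^sub>2))) (insert e\<^sub>1 E)"
proof (rule count_sparse_insertI[OF sparse fin new])
  fix T assume T: "T \<subseteq> E"
  let ?d = "contracted_edge (D e\<^sub>1) (D e\<^sub>2)"
  have vT: "v \<notin> ends D T" using v ends_mono[OF T, of D] by blast
  have finT: "finite T" using T fin finite_subset by blast
  have "ends D (T \<union> {e\<^sub>1, e\<^sub>2}) = insert v ({src ?d, dst ?d} \<union> ends D T)"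
    using src by (auto simp: contracted_edge_def)
  then have "card (ends D (T \<union> {e\<^sub>1, e\<^sub>2})) = Suc (card ({src ?d, dst ?d} \<union> ends D T))"
    using vT dst finT by (simp add: contracted_edge_def)
  moreover have "defect (D(e\<^sub>1 := ?d)) (insert e\<^sub>1 T) \<le> defect D (T \<union> {e\<^sub>1, e\<^sub>2})"
    using T new src dst vT sign by (intro defect_insert_contracted_le) auto
  ultimately show "card T + 1 + defect (D(e\<^sub>1 := ?d)) (insert e\<^sub>1 T) \<le> 2 * card ({src ?d, dst ?d} \<union> ends D T)"
    using free[OF T] by simp
qed

section \<open>Small edge sets excluded by the count\<close>

lemma sparse_loop_flip:
  assumes "count_sparse D E" "l \<in> E" "src (D l) = dst (D l)" "flip (D l) * flip (D l) = 1"
  shows "flip (D l) = - 1"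
proof (rule ccontr)
  assume "flip (D l) \<noteq> - 1"
  then have "flip (D l) = 1" using assms(4) square_eq_1_iff by blast
  then have "potential D {l} 2 (\<lambda>_. 1) (\<lambda>_. 0) (\<lambda>_. 0)" by (simp add: potential_def)
  then have "2 \<le> defect D {l}" by (rule defect_ge) simp
  moreover have "card {l} + defect D {l} \<le> 2 * card (ends D {l})"
    by (rule count_sparseD[OF assms(1)]) (use assms(2) in auto)
  ultimately show False using assms(3) by simp
qed

lemma sparse_parallel_distinct:
  assumes "count_sparse D E" "e \<in> E" "f \<in> E" "e \<noteq> f" "src (D e) \<noteq> dst (D e)"
    and sign: "flip (D e) * flip (D e) = 1"
  shows "D e \<noteq> D f"
proof
  assume eq: "D e = D f"
  let ?w = "dst (D e)"
  have "potential D {e, f} 3 (\<lambda>z. if z = ?w then flip (D e) else 1)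
      (\<lambda>z. if z = ?w then shx (D e) else 0) (\<lambda>z. if z = ?w then shy (D e) else 0)"
    using assms(5) sign by (simp add: potential_def eq[symmetric])
  then have "3 \<le> defect D {e, f}" by (rule defect_ge) simp
  moreover have "card {e, f} + defect D {e, f} \<le> 2 * card (ends D {e, f})"
    by (rule count_sparseD[OF assms(1)]) (use assms(2,3) in auto)
  ultimately show False using assms(4,5) by (simp add: eq[symmetric])
qed

text \<open>With equal signs the three edges would have defect at least two, and 3 + 2 exceeds the
  four columns of their ends.\<close>

lemma sparse_triple_flips:
  assumes "count_sparse D E" "{e\<^sub>1, e\<^sub>2, e\<^sub>3} \<subseteq> E" and ne: "e\<^sub>1 \<noteq> e\<^sub>2" "e\<^sub>1 \<noteq> e\<^sub>3" "e\<^sub>2 \<noteq> e\<^sub>3"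
    and src: "src (D e\<^sub>1) = v" "src (D e\<^sub>2) = v" "src (D e\<^sub>3) = v"
    and dst: "dst (D e\<^sub>1) = w" "dst (D e\<^sub>2) = w" "dst (D e\<^sub>3) = w" and w: "w \<noteq> v"
    and sign: "flip (D e\<^sub>1) * flip (D e\<^sub>1) = 1"
  shows "\<not> (flip (D e\<^sub>2) = flip (D e\<^sub>1) \<and> flip (D e\<^sub>3) = flip (D e\<^sub>1))"
proof
  assume eq: "flip (D e\<^sub>2) = flip (D e\<^sub>1) \<and> flip (D e\<^sub>3) = flip (D e\<^sub>1)"
  let ?F = "{e\<^sub>1, e\<^sub>2, e\<^sub>3}"
  have "potential D ?F 2 (\<lambda>z. if z = w then flip (D e\<^sub>1) else 1) (\<lambda>_. 0) (\<lambda>_. 0)"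
    using sign eq src dst w by (auto simp: potential_def)
  then have "2 \<le> defect D ?F" by (rule defect_ge) simp
  moreover have "card ?F + defect D ?F \<le> 2 * card (ends D ?F)"
    by (rule count_sparseD[OF assms(1,2)]) simp
  moreover have "ends D ?F = {v, w}" using src dst by auto
  ultimately show False using ne w by simp
qed

section \<open>Placements with distinct or noncollinear images\<close>

lemma exists_distinct_images:
  assumes "d \<noteq> d'" "src d = src d'"
  shows "\<exists>p. image_x d p \<noteq> image_x d' p \<or> image_y d p \<noteq> image_y d' p"
proof (cases "dst d = dst d'")
  case False
  let ?p = "(\<lambda>_. 0)(dst d := vec (shx d' - shx d + 1)) :: 'a \<Rightarrow> real^2"
  have "image_x d ?p \<noteq> image_x d' ?p" using False by (simp add: image_x_def)
  then show ?thesis by blast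
next
  case True
  show ?thesis
  proof (rule ccontr)
    assume "\<not> ?thesis"
    then have x: "image_x d p = image_x d' p" and y: "image_y d p = image_y d' p" for p by blast+
    have "shx d = shx d'" "shy d = shy d'"
      using x[of "\<lambda>_. 0"] y[of "\<lambda>_. 0"] by (simp_all add: image_x_def image_y_def)
    moreover have "flip d = flip d'"
      using y[of "\<lambda>_. vec 1"] \<open>shy d = shy d'\<close> by (simp add: image_y_def)
    ultimately have "d = d'" using True assms(2) by (intro gain_edge.expand) simp
    with assms(1) show False ..
  qed
qed

text \<open>The third neighbour can be moved without disturbing the first two images. A quarter turn
  of their difference vector locates its image, and the area expression becomes a sum of two
  squares.\<close>

lemma exists_image_cross_aux:
  assumes "d \<noteq> d'" "src d = src d'" "dst d'' \<noteq> dst d" "dst d'' \<noteq> dst d'" "flip d'' * flip d'' = 1"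
  shows "\<exists>p. image_cross d d' d'' p \<noteq> 0"
proof -
  obtain p where p: "image_x d p \<noteq> image_x d' p \<or> image_y d p \<noteq> image_y d' p"
    using exists_distinct_images[OF assms(1,2)] by blast
  define a b where "a = image_x d' p - image_x d p" and "b = image_y d' p - image_y d p"
  define q where "q = p(dst d'' := vector [image_x d p - b - shx d'', flip d'' * (image_y d p + a - shy d'')])"
  have q: "image_x d q = image_x d p" "image_y d q = image_y d p"
    "image_x d' q = image_x d' p" "image_y d' q = image_y d' p"
    using assms(3,4) by (auto simp: q_def image_x_def image_y_def)
  have q'': "image_x d'' q = image_x d p - b" "image_y d'' q = image_y d p + a"
    using assms(5) by (simp_all add: q_def image_x_def image_y_def mult.assoc[symmetric])
  have "image_cross d d' d'' q = a * a + b * b"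
    unfolding image_cross_def q q'' by (simp add: a_def b_def algebra_simps)
  moreover have "a * a + b * b \<noteq> 0" using p by (auto simp: a_def b_def sum_squares_eq_zero_iff)
  ultimately show ?thesis by metis
qed

lemma image_cross_rotate: "image_cross d' d'' d p = image_cross d d' d'' p"
  by (simp add: image_cross_def algebra_simps)

lemma exists_image_cross:
  assumes "d \<noteq> d'" "d \<noteq> d''" "d' \<noteq> d''" "src d = src d'" "src d = src d''"
    and "\<not> (dst d = dst d' \<and> dst d = dst d'')"
    and "flip d * flip d = 1" "flip d' * flip d' = 1" "flip d'' * flip d'' = 1"
  shows "\<exists>p. image_cross d d' d'' p \<noteq> 0"
proof -
  consider "dst d'' \<noteq> dst d" "dst d'' \<noteq> dst d'" | "dst d \<noteq> dst d'" "dst d \<noteq> dst d''"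
    | "dst d' \<noteq> dst d''" "dst d' \<noteq> dst d" using assms(6) by metis
  then show ?thesis
  proof cases
    case 1
    then show ?thesis using exists_image_cross_aux[of d d' d''] assms by simp
  next
    case 2
    then show ?thesis using exists_image_cross_aux[of d' d'' d] assms by (simp add: image_cross_rotate[of d' d'' d])
  next
    case 3
    then show ?thesis using exists_image_cross_aux[of d'' d d'] assms by (simp add: image_cross_rotate[of d'' d d'] image_cross_rotate[of d' d'' d])
  qed
qed

section \<open>Independence from the orientation of edges\<close>

definition reversed :: "'v gain_edge \<Rightarrow> 'v gain_edge" where
  "reversed d = Edge (dst d) (src d) (flip d) (- shx d) (- flip d * shy d)"

lemma edge_row_reversed:
  assumes "flip d * flip d = 1"
  shows "edge_row (reversed d) p = edge_row d p"
proof
  fix j :: "'a \<times> 2"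
  obtain w k where j: "j = (w, k)" by fastforce
  have x: "edge_x (reversed d) p = - edge_x d p" by (simp add: edge_x_def reversed_def)
  have y: "edge_y (reversed d) p = - flip d * edge_y d p"
    using assms unfolding edge_y_def reversed_def gain_edge.sel by algebra
  have "- flip d * edge_y d p * (of_bool (w = dst d) - flip d * of_bool (w = src d))
      = edge_y d p * (of_bool (w = src d) - flip d * of_bool (w = dst d))"
    using assms by algebra
  then show "edge_row (reversed d) p j = edge_row d p j"
    by (simp add: j edge_row_def x y) (simp add: reversed_def algebra_simps)
qed

lemma potential_reversed:
  assumes "\<And>e. e \<in> F \<Longrightarrow> flip (D e) * flip (D e) = 1"
    and "\<And>e. e \<in> F \<Longrightarrow> D' e = D e \<or> D' e = reversed (D e)"
    and "potential D' F k \<sigma> \<alpha> \<beta>"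
  shows "potential D F k \<sigma> \<alpha> \<beta>"
  unfolding potential_def
proof (intro conjI impI ballI allI)
  show "\<sigma> v * \<sigma> v = 1" for v by (rule potential_sign[OF assms(3)])
next
  fix e assume k: "2 \<le> k" and e: "e \<in> F"
  have "\<sigma> (dst (D' e)) = \<sigma> (src (D' e)) * flip (D' e)" using assms(3) k e by (simp add: potential_def)
  then show "\<sigma> (dst (D e)) = \<sigma> (src (D e)) * flip (D e)"
    using assms(2)[OF e] assms(1)[OF e] by (auto simp: reversed_def)
next
  fix e assume k: "3 \<le> k" and e: "e \<in> F"
  have p: "\<sigma> (dst (D' e)) = \<sigma> (src (D' e)) * flip (D' e)" "\<alpha> (dst (D' e)) = \<alpha> (src (D' e)) + shx (D' e)"
    "\<beta> (dst (D' e)) = \<beta> (src (D' e)) + \<sigma> (src (D' e)) * shy (D' e)"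
    using assms(3) k e by (simp_all add: potential_def)
  then show "\<alpha> (dst (D e)) = \<alpha> (src (D e)) + shx (D e)"
    using assms(2)[OF e] by (auto simp: reversed_def)
  show "\<beta> (dst (D e)) = \<beta> (src (D e)) + \<sigma> (src (D e)) * shy (D e)"
    using assms(2)[OF e] assms(1)[OF e] p by (auto simp: reversed_def)
qed

text \<open>The count gives fewer than two edges per vertex, hence an average degree below four; a
  loop contributes to both summands.\<close>

lemma exists_low_degree:
  assumes "count_sparse D E" "finite E" "E \<noteq> {}"
  shows "\<exists>v\<in>ends D E. card {e\<in>E. src (D e) = v} + card {e\<in>E. dst (D e) = v} \<le> 3"
proof -
  let ?V = "ends D E"
  have "(\<Sum>v\<in>?V. card {e\<in>E. src (D e) = v}) = card E" "(\<Sum>v\<in>?V. card {e\<in>E. dst (D e) = v}) = card E"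
    using sum.group[OF assms(2) finite_ends[OF assms(2)], of "\<lambda>e. src (D e)" D "\<lambda>_. 1 :: nat"]
      sum.group[OF assms(2) finite_ends[OF assms(2)], of "\<lambda>e. dst (D e)" D "\<lambda>_. 1 :: nat"]
    by (auto simp: image_subset_iff)
  then have sum: "(\<Sum>v\<in>?V. card {e\<in>E. src (D e) = v} + card {e\<in>E. dst (D e) = v}) = 2 * card E"
    by (simp add: sum.distrib)
  have "card E + defect D E \<le> 2 * card ?V" using count_sparseD[OF assms(1) order_refl assms(3)] .
  then have lt: "2 * card E < 4 * card ?V" using defect_cases[of D E] by auto
  show ?thesis
  proof (rule ccontr)
    assume "\<not> ?thesis"
    then have "4 \<le> card {e\<in>E. src (D e) = v} + card {e\<in>E. dst (D e) = v}" if "v \<in> ?V" for v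
      using that by fastforce
    then have "(\<Sum>v\<in>?V. 4) \<le> 2 * card E" unfolding sum[symmetric] by (intro sum_mono) blast
    then show False using lt by simp
  qed
qed


lemma edge_conditions_reversed:
  assumes sign: "\<And>e. e \<in> E \<Longrightarrow> flip (D e) * flip (D e) = 1"
    and rev: "\<And>e. e \<in> E \<Longrightarrow> D' e = D e \<or> D' e = reversed (D e)"
  shows "count_sparse D E \<Longrightarrow> count_sparse D' E" "indep_at D' E p = indep_at D E p"
proof -
  have sp: "defect D' F \<le> defect D F" "ends D' F = ends D F" if "F \<subseteq> E" for F
  proof -
    obtain \<sigma> \<alpha> \<beta> where "potential D' F (defect D' F) \<sigma> \<alpha> \<beta>" by (rule defect_potential)
    then have "potential D F (defect D' F) \<sigma> \<alpha> \<beta>"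
      by (rule potential_reversed[rotated 2]) (use that sign rev in auto)
    then show "defect D' F \<le> defect D F" by (rule defect_ge) (use defect_cases[of D' F] in auto)
    have "{src (D' e), dst (D' e)} = {src (D e), dst (D e)}" if "e \<in> E" for e
      using rev[OF that] by (auto simp: reversed_def)
    then show "ends D' F = ends D F" using that by (auto simp: ends_def)
  qed
  show "count_sparse D' E" if "count_sparse D E"
    unfolding count_sparse_def
  proof (intro allI impI)
    fix F assume F: "F \<subseteq> E" "F \<noteq> {}"
    show "card F + defect D' F \<le> 2 * card (ends D' F)"
      using count_sparseD[OF that F] sp[OF F(1)] by simp
  qed
  show "indep_at D' E p = indep_at D E p"
    unfolding indep_at_def
  proof (rule rows_independent_cong)
    fix e j assume "e \<in> E"
    then show "edge_row (D' e) p j = edge_row (D e) p j"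
      using rev[of e] edge_row_reversed[OF sign, of e p] by auto
  qed
qed

section \<open>The inductive step at a vertex of low degree\<close>

lemma contracted_pair_step:
  fixes D :: "'e \<Rightarrow> 'v gain_edge"
  assumes IH: "\<And>D' (E' :: 'e set). card E' < card E + 3 \<Longrightarrow> finite E' \<Longrightarrow>
      (\<And>e. e \<in> E' \<Longrightarrow> flip (D' e :: 'v gain_edge) * flip (D' e) = 1) \<Longrightarrow> count_sparse D' E' \<Longrightarrow>
      \<exists>p. indep_at D' E' p"
    and fin: "finite E" and new: "e\<^sub>1 \<notin> E"
    and sign: "\<And>e. e \<in> insert e\<^sub>1 (insert e\<^sub>2 E) \<Longrightarrow> flip (D e) * flip (D e) = 1"
    and sparse: "count_sparse (D(e\<^sub>1 := contracted_edge (D e\<^sub>1) (D e\<^sub>2))) (insert e\<^sub>1 E)"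
  shows "\<exists>p. indep_at (D(e\<^sub>1 := contracted_edge (D e\<^sub>1) (D e\<^sub>2))) (insert e\<^sub>1 E) p"
proof (rule IH[OF _ _ _ sparse])
  show "card (insert e\<^sub>1 E) < card E + 3" using fin new by simp
  fix e assume "e \<in> insert e\<^sub>1 E"
  then show "flip ((D(e\<^sub>1 := contracted_edge (D e\<^sub>1) (D e\<^sub>2))) e) *
      flip ((D(e\<^sub>1 := contracted_edge (D e\<^sub>1) (D e\<^sub>2))) e) = 1"
    using sign[of e] sign[of e\<^sub>1] sign[of e\<^sub>2] by (auto simp: contracted_edge_def mult_ac)
qed (use fin in auto)

lemma degree_three_step:
  fixes D :: "'e \<Rightarrow> 'v gain_edge"
  assumes IH: "\<And>D' (E' :: 'e set). card E' < card E + 3 \<Longrightarrow> finite E' \<Longrightarrow>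
      (\<And>e. e \<in> E' \<Longrightarrow> flip (D' e :: 'v gain_edge) * flip (D' e) = 1) \<Longrightarrow> count_sparse D' E' \<Longrightarrow>
      \<exists>p. indep_at D' E' p"
    and fin: "finite E" and v: "v \<notin> ends D E"
    and new: "e\<^sub>1 \<notin> E" "e\<^sub>2 \<notin> E" "e\<^sub>3 \<notin> E" and ne: "e\<^sub>1 \<noteq> e\<^sub>2" "e\<^sub>1 \<noteq> e\<^sub>3" "e\<^sub>2 \<noteq> e\<^sub>3"
    and src: "src (D e\<^sub>1) = v" "src (D e\<^sub>2) = v" "src (D e\<^sub>3) = v"
    and dst: "dst (D e\<^sub>1) \<noteq> v" "dst (D e\<^sub>2) \<noteq> v" "dst (D e\<^sub>3) \<noteq> v"
    and sign: "\<And>e. e \<in> E \<union> {e\<^sub>1, e\<^sub>2, e\<^sub>3} \<Longrightarrow> flip (D e) * flip (D e) = 1"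
    and sparse: "count_sparse D (E \<union> {e\<^sub>1, e\<^sub>2, e\<^sub>3})"
    and ind: "\<exists>p. indep_at D E p"
    and nbrs: "\<not> (dst (D e\<^sub>1) = dst (D e\<^sub>2) \<and> dst (D e\<^sub>1) = dst (D e\<^sub>3))"
  shows "\<exists>p. indep_at D (E \<union> {e\<^sub>1, e\<^sub>2, e\<^sub>3}) p"
proof -
  have sparse0: "count_sparse D E" by (rule count_sparse_mono[OF sparse]) auto
  have diff: "D e\<^sub>1 \<noteq> D e\<^sub>2" "D e\<^sub>1 \<noteq> D e\<^sub>3" "D e\<^sub>2 \<noteq> D e\<^sub>3"
    using sparse_parallel_distinct[OF sparse, of e\<^sub>1 e\<^sub>2] sparse_parallel_distinct[OF sparse, of e\<^sub>1 e\<^sub>3]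
      sparse_parallel_distinct[OF sparse, of e\<^sub>2 e\<^sub>3] ne src dst sign[of e\<^sub>1] sign[of e\<^sub>2] by auto
  have cross: "\<exists>p. image_cross (D e\<^sub>1) (D e\<^sub>2) (D e\<^sub>3) p \<noteq> 0"
    using exists_image_cross[OF diff _ _ nbrs sign sign sign] src by auto
  \<comment> \<open>Stated for an arbitrary order of the three edges, since it is not known which
    pair is free.\<close>
  have pair: "\<exists>p. indep_at D (E \<union> {a, b, c}) p"
    if S: "{a, b, c} = {e\<^sub>1, e\<^sub>2, e\<^sub>3}" "a \<noteq> b" "a \<noteq> c" "b \<noteq> c"
      and free: "\<And>T. T \<subseteq> E \<Longrightarrow> card T + defect D (T \<union> {a, b}) + 2 < 2 * card (ends D (T \<union> {a, b}))"
      and cr: "\<exists>p. image_cross (D a) (D b) (D c) p \<noteq> 0" for a b c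
  proof -
    have abc: "x \<in> {e\<^sub>1, e\<^sub>2, e\<^sub>3}" if "x = a \<or> x = b \<or> x = c" for x using S(1) that by blast
    have props: "x \<notin> E" "src (D x) = v" "dst (D x) \<noteq> v" "flip (D x) * flip (D x) = 1"
      if "x = a \<or> x = b \<or> x = c" for x
      using abc[OF that] new src dst sign[of x] by auto
    have sp: "count_sparse (D(a := contracted_edge (D a) (D b))) (insert a E)"
      using props by (intro count_sparse_contracted[OF sparse0 fin v _ _ _ _ _ _ free]) auto
    have "\<exists>p. indep_at (D(a := contracted_edge (D a) (D b))) (insert a E) p"
      using sp
    proof (rule contracted_pair_step[rotated 4])
      show "flip (D e) * flip (D e) = 1" if "e \<in> insert a (insert b E)" for e
        using sign props that by blast
      show "a \<notin> E" using props by blast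
    qed (fact IH fin)+
    then obtain p where p: "indep_at (D(a := contracted_edge (D a) (D b))) (insert a E) p" by blast
    obtain p' where p': "image_cross (D a) (D b) (D c) p' \<noteq> 0" using cr by blast
    have "finite (insert a E)" using fin by simp
    \<comment> \<open>The induction gives independence, a separate construction gives noncollinear
      images; both must hold at one placement before \<open>v\<close> is added.\<close>
    from generic_property_meet[OF generic_property_indep_at[OF this] generic_property_image_cross p p']
    obtain q where q: "indep_at (D(a := contracted_edge (D a) (D b))) (insert a E) q"
      "image_cross (D a) (D b) (D c) q \<noteq> 0" by blast
    show ?thesis
      by (rule three_edge_extension[OF fin v _ _ _ S(2-4) _ _ _ _ _ _ _ q]) (use props in auto)
  qed
  define e where "e k = (if k = 0 then e\<^sub>1 else if k = 1 then e\<^sub>2 else e\<^sub>3)" for k :: nat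
  have l3: "{..<3::nat} = {0, 1, 2}" by auto
  have img: "e ` {..<3} = {e\<^sub>1, e\<^sub>2, e\<^sub>3}" by (auto simp: e_def l3)
  have "\<exists>k<3. \<forall>T\<subseteq>E. card T + defect D (T \<union> e ` ({..<3} - {k})) + 2
      < 2 * card (ends D (T \<union> e ` ({..<3} - {k})))"
  proof (rule not_all_pairs_blocked)
    show "count_sparse D (E \<union> e ` {..<3})" using sparse by (simp add: img)
    show "inj_on e {..<3}" using ne by (auto simp: inj_on_def e_def l3)
    show "e ` {..<3} \<inter> E = {}" using new by (simp add: img)
    show "\<exists>p. image_cross (D (e 0)) (D (e 1)) (D (e 2)) p \<noteq> 0" using cross by (simp add: e_def)
  qed (use fin v ind src dst in \<open>auto simp: e_def\<close>)
  then obtain k where k: "k < 3"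
    "\<And>T. T \<subseteq> E \<Longrightarrow> card T + defect D (T \<union> e ` ({..<3} - {k})) + 2
      < 2 * card (ends D (T \<union> e ` ({..<3} - {k})))"
    by blast
  \<comment> \<open>The pairs are listed in cyclic order, under which \<open>image_cross\<close> is
    invariant.\<close>
  have pairs: "{..<3::nat} - {0} = {1, 2}" "{..<3::nat} - {1} = {2, 0}" "{..<3::nat} - {2} = {0, 1}"
    by auto
  consider (1) "k = 0" | (2) "k = 1" | (3) "k = 2" using k(1) by linarith
  then show ?thesis
  proof cases
    case 1
    have pr: "e ` ({..<3} - {k}) = {e\<^sub>2, e\<^sub>3}" 
      unfolding 1 pairs(1) by (simp add: e_def insert_commute)
    have "\<exists>p. indep_at D (E \<union> {e\<^sub>2, e\<^sub>3, e\<^sub>1}) p"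
      by (rule pair[OF _ _ _ _ k(2)[unfolded pr]]) (use ne cross in \<open>auto simp: image_cross_rotate[of "D e\<^sub>2" "D e\<^sub>3" "D e\<^sub>1"]\<close>)
    then show ?thesis by (simp add: insert_commute)
  next
    case 2
    have pr: "e ` ({..<3} - {k}) = {e\<^sub>3, e\<^sub>1}" 
      unfolding 2 pairs(2) by (simp add: e_def insert_commute)
    have "\<exists>p. indep_at D (E \<union> {e\<^sub>3, e\<^sub>1, e\<^sub>2}) p"
      by (rule pair[OF _ _ _ _ k(2)[unfolded pr]]) (use ne cross in \<open>auto simp: image_cross_rotate[of "D e\<^sub>3" "D e\<^sub>1" "D e\<^sub>2"] image_cross_rotate[of "D e\<^sub>2" "D e\<^sub>3" "D e\<^sub>1"]\<close>)
    then show ?thesis by (simp add: insert_commute)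
  next
    case 3
    have pr: "e ` ({..<3} - {k}) = {e\<^sub>1, e\<^sub>2}" 
      unfolding 3 pairs(3) by (simp add: e_def insert_commute)
    show ?thesis
      by (rule pair[OF _ _ _ _ k(2)[unfolded pr]]) (use ne cross in auto)
  qed
qed

text \<open>No pair with opposite signs is ever blocked here: its contraction is a reflecting loop
  at \<open>w\<close>, so every set containing the loop has defect one. Replacing the three edges by
  the loop drops two edges together with the two columns of \<open>v\<close>, which preserves the
  bound.\<close>

lemma triple_edge_step:
  fixes D :: "'e \<Rightarrow> 'v gain_edge"
  assumes IH: "\<And>D' (E' :: 'e set). card E' < card E + 3 \<Longrightarrow> finite E' \<Longrightarrow>
      (\<And>e. e \<in> E' \<Longrightarrow> flip (D' e :: 'v gain_edge) * flip (D' e) = 1) \<Longrightarrow> count_sparse D' E' \<Longrightarrow>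
      \<exists>p. indep_at D' E' p"
    and fin: "finite E" and v: "v \<notin> ends D E"
    and new: "e\<^sub>1 \<notin> E" "e\<^sub>2 \<notin> E" "e\<^sub>3 \<notin> E" and ne: "e\<^sub>1 \<noteq> e\<^sub>2" "e\<^sub>1 \<noteq> e\<^sub>3" "e\<^sub>2 \<noteq> e\<^sub>3"
    and src: "src (D e\<^sub>1) = v" "src (D e\<^sub>2) = v" "src (D e\<^sub>3) = v"
    and dst: "dst (D e\<^sub>1) = w" "dst (D e\<^sub>2) = w" "dst (D e\<^sub>3) = w" and w: "w \<noteq> v"
    and sign: "\<And>e. e \<in> E \<union> {e\<^sub>1, e\<^sub>2, e\<^sub>3} \<Longrightarrow> flip (D e) * flip (D e) = 1"
    and flips: "flip (D e\<^sub>2) = - flip (D e\<^sub>1)" "flip (D e\<^sub>3) = flip (D e\<^sub>1)"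
    and sparse: "count_sparse D (E \<union> {e\<^sub>1, e\<^sub>2, e\<^sub>3})"
  shows "\<exists>p. indep_at D (E \<union> {e\<^sub>1, e\<^sub>2, e\<^sub>3}) p"
proof -
  let ?d = "contracted_edge (D e\<^sub>1) (D e\<^sub>2)"
  have sparse0: "count_sparse D E" by (rule count_sparse_mono[OF sparse]) auto
  have s1: "flip (D e\<^sub>1) * flip (D e\<^sub>1) = 1" using sign by simp
  have "count_sparse (D(e\<^sub>1 := ?d)) (insert e\<^sub>1 E)"
  proof (rule count_sparse_insertI[OF sparse0 fin new(1)])
    fix T assume T: "T \<subseteq> E"
    let ?S = "T \<union> {e\<^sub>1, e\<^sub>2, e\<^sub>3}"
    have finT: "finite T" using T fin finite_subset by blast
    have "defect (D(e\<^sub>1 := ?d)) (insert e\<^sub>1 T) < 2"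
    proof (rule ccontr)
      assume big: "\<not> ?thesis"
      obtain \<sigma> \<alpha> \<beta> where
        "potential (D(e\<^sub>1 := ?d)) (insert e\<^sub>1 T) (defect (D(e\<^sub>1 := ?d)) (insert e\<^sub>1 T)) \<sigma> \<alpha> \<beta>"
        by (rule defect_potential)
      then have "\<sigma> w = \<sigma> w * (flip (D e\<^sub>1) * flip (D e\<^sub>2))" "\<sigma> w \<noteq> 0"
        using big dst potential_nonzero by (fastforce simp: potential_def contracted_edge_def)+
      then show False using flips s1 by simp
    qed
    moreover have "card ?S + defect D ?S \<le> 2 * card (ends D ?S)"
      by (rule count_sparseD[OF sparse]) (use T in auto)
    moreover have "card ?S = card T + 3"
      using T new ne finT by (subst card_Un_disjoint) auto
    moreover have "card (ends D ?S) = Suc (card ({src ?d, dst ?d} \<union> ends D T))"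
    proof -
      have es: "ends D ?S = insert v ({src ?d, dst ?d} \<union> ends D T)"
        using src dst by (auto simp: contracted_edge_def)
      have vn: "v \<notin> {src ?d, dst ?d} \<union> ends D T"
        using v w dst ends_mono[OF T, of D] by (auto simp: contracted_edge_def)
      have fn: "finite ({src ?d, dst ?d} \<union> ends D T)" using finT by simp
      show ?thesis unfolding es by (rule card_insert_disjoint[OF fn vn])
    qed
    moreover have "1 \<le> defect D ?S" using defect_cases[of D ?S] by auto
    ultimately show "card T + 1 + defect (D(e\<^sub>1 := ?d)) (insert e\<^sub>1 T) \<le> 2 * card ({src ?d, dst ?d} \<union> ends D T)"
      by simp
  qed
  then have "\<exists>p. indep_at (D(e\<^sub>1 := ?d)) (insert e\<^sub>1 E) p"
  proof (rule contracted_pair_step[rotated 4])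
    show "flip (D e) * flip (D e) = 1" if "e \<in> insert e\<^sub>1 (insert e\<^sub>2 E)" for e using sign that by blast
  qed (fact IH fin new)+
  then obtain p where p: "indep_at (D(e\<^sub>1 := ?d)) (insert e\<^sub>1 E) p" by blast
  have "D e\<^sub>1 \<noteq> D e\<^sub>3"
  proof (rule sparse_parallel_distinct[OF sparse _ _ ne(2) _ s1])
    show "src (D e\<^sub>1) \<noteq> dst (D e\<^sub>1)" unfolding src dst using w by (rule not_sym)
  qed simp_all
  from triple_edge_extension[OF fin v new ne src dst w s1 flips this p] show ?thesis .
qed

lemma vertex_step:
  fixes D :: "'e \<Rightarrow> 'v gain_edge"
  assumes IH: "\<And>D' (E' :: 'e set). card E' < card E \<Longrightarrow> finite E' \<Longrightarrow>
      (\<And>e. e \<in> E' \<Longrightarrow> flip (D' e :: 'v gain_edge) * flip (D' e) = 1) \<Longrightarrow> count_sparse D' E' \<Longrightarrow>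
      \<exists>p. indep_at D' E' p"
    and fin: "finite E" and sign: "\<And>e. e \<in> E \<Longrightarrow> flip (D e) * flip (D e) = 1"
    and sparse: "count_sparse D E" and v: "v \<in> ends D E"
    and deg: "card {e\<in>E. src (D e) = v} + card {e\<in>E. dst (D e) = v} \<le> 3"
    and orient: "\<And>e. e \<in> E \<Longrightarrow> dst (D e) = v \<Longrightarrow> src (D e) = v"
  shows "\<exists>p. indep_at D E p"
proof -
  define S where "S = {e\<in>E. src (D e) = v}"
  define L where "L = {e\<in>E. dst (D e) = v}"
  define E\<^sub>0 where "E\<^sub>0 = E - S"
  have E: "E = E\<^sub>0 \<union> S" "E\<^sub>0 \<inter> S = {}" and finE0: "finite E\<^sub>0" and finS: "finite S" and finL: "finite L"
    and L_S: "L \<subseteq> S" using fin orient by (auto simp: E\<^sub>0_def S_def L_def)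
  have v0: "v \<notin> ends D E\<^sub>0" using orient by (auto simp: ends_def E\<^sub>0_def S_def)
  have "S \<noteq> {}"
  proof
    assume "S = {}"
    then show False using v v0 E(1) by simp
  qed
  then have cS: "card S > 0" using finS by (simp add: card_gt_0_iff)
  have cE: "card E = card E\<^sub>0 + card S" using card_Un_disjoint[OF finE0 finS E(2)] E(1) by simp
  have sparse0: "count_sparse D E\<^sub>0" by (rule count_sparse_mono[OF sparse]) (simp add: E\<^sub>0_def)
  have sign0: "flip (D e) * flip (D e) = 1" if "e \<in> E\<^sub>0" for e using sign that by (simp add: E\<^sub>0_def)
  have ind0: "\<exists>p. indep_at D E\<^sub>0 p"
    by (rule IH[OF _ finE0 sign0 sparse0]) (use cE cS in auto)
  have deg': "card S + card L \<le> 3" using deg by (simp add: S_def L_def)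
  have S_E: "e \<in> E" "src (D e) = v" "e \<notin> E\<^sub>0" if "e \<in> S" for e using that by (auto simp: S_def E\<^sub>0_def)
  show ?thesis
  proof (cases "L = {}")
    case False
    then obtain l where l: "l \<in> L" by blast
    have cL: "card L > 0" using l finL by (auto simp: card_gt_0_iff)
    \<comment> \<open>A loop is counted in \<open>S\<close> and again in \<open>L\<close>, so degree
      three leaves at most one other edge.\<close>
    have "card (S - {l}) \<le> 1" using deg' cL l L_S finS by (simp add: card_Diff_singleton subsetD)
    then obtain f where f: "S - {l} \<subseteq> {f}"
      using finS by (metis card_le_Suc0_iff_eq finite_Diff One_nat_def subsetI singletonI)
    have f_dst: "dst (D f) \<noteq> v" if "f \<in> S - {l}"
    proof
      assume "dst (D f) = v"
      then have "{l, f} \<subseteq> L" using that l S_E by (auto simp: L_def)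
      then have "card {l, f} \<le> card L" "card {l, f} \<le> card S"
        using finL finS L_S by (auto intro!: card_mono)
      then show False using that deg' by auto
    qed
    have l': "l \<in> E" "src (D l) = v" "dst (D l) = v" "l \<in> S" using l L_S S_E by (auto simp: L_def)
    have flip: "flip (D l) = - 1" by (rule sparse_loop_flip[OF sparse]) (use l' sign in auto)
    obtain p where p: "indep_at D E\<^sub>0 p" using ind0 by blast
    have "\<exists>q. indep_at D (E\<^sub>0 \<union> insert l (S - {l})) q"
      using finE0 finS v0 p l' flip f f_dst S_E
      by (intro loop_extension[where f = f and v = v and p = p]) auto
    moreover have "E\<^sub>0 \<union> insert l (S - {l}) = E" using l' E(1) by blast
    ultimately show ?thesis by (simp only:)
  next
    case True
    then have dst: "dst (D e) \<noteq> v" if "e \<in> S" for e using that S_E by (auto simp: L_def)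
    have "card S \<le> 3" using deg' by simp
    then consider "card S = 1" | "card S = 2" | "card S = 3" using cS by linarith
    then show ?thesis
    proof cases
      case 1
      then obtain e where e: "S = {e}" by (auto simp: card_1_singleton_iff)
      obtain p where p: "indep_at D E\<^sub>0 p" using ind0 by blast
      have "\<exists>q. indep_at D (E\<^sub>0 \<union> {e}) q"
        by (rule one_edge_extension[OF finE0 v0 p]) (use S_E dst e in auto)
      then show ?thesis using E(1) e by simp
    next
      case 2
      then obtain e f where ef: "S = {e, f}" "e \<noteq> f" by (auto simp: card_2_iff)
      have "D e \<noteq> D f"
        by (rule sparse_parallel_distinct[OF sparse]) (use S_E[of e] S_E[of f] dst[of e] sign[of e] ef in auto)
      then obtain p' where p': "image_x (D e) p' \<noteq> image_x (D f) p' \<or> image_y (D e) p' \<noteq> image_y (D f) p'"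
        using exists_distinct_images[of "D e" "D f"] S_E ef by auto
      \<comment> \<open>A squared distance turns the disjunction into the nonvanishing of one
        polynomial.\<close>
      let ?sq = "\<lambda>p. (image_x (D e) p - image_x (D f) p) * (image_x (D e) p - image_x (D f) p)
        + (image_y (D e) p - image_y (D f) p) * (image_y (D e) p - image_y (D f) p)"
      have sq: "?sq p \<noteq> 0 \<longleftrightarrow> image_x (D e) p \<noteq> image_x (D f) p \<or> image_y (D e) p \<noteq> image_y (D f) p" for p
        by (simp add: sum_squares_eq_zero_iff)
      have gen: "generic_property (\<lambda>p. ?sq p \<noteq> 0)" by (intro generic_property_nonzero) simp
      obtain p where p: "indep_at D E\<^sub>0 p" using ind0 by blast
      obtain q where q: "indep_at D E\<^sub>0 q" "?sq q \<noteq> 0"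
        using generic_property_meet[OF generic_property_indep_at[OF finE0] gen p] p' sq by metis
      have "\<exists>q. indep_at D (E\<^sub>0 \<union> {e, f}) q"
        using two_edge_extension[OF finE0 v0 q(1), of e f] S_E[of e] S_E[of f] dst[of e] dst[of f] ef sq q(2)
        by simp
      then show ?thesis using E(1) ef by simp
    next
      case 3
      then obtain a b c where abc: "S = {a, b, c}" "a \<noteq> b" "a \<noteq> c" "b \<noteq> c"
        by (auto simp: card_3_iff)
      have IH': "\<exists>p. indep_at D' E' p" if "card E' < card E\<^sub>0 + 3" "finite E'"
        "\<And>e. e \<in> E' \<Longrightarrow> flip (D' e) * flip (D' e) = 1" "count_sparse D' E'" for D' :: "'e \<Rightarrow> 'v gain_edge" and E'
        using IH[OF _ that(2-4)] that(1) cE 3 by simp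
      have props: "x \<notin> E\<^sub>0" "src (D x) = v" "dst (D x) \<noteq> v" if "x = a \<or> x = b \<or> x = c" for x
        using that S_E[of x] dst[of x] abc by auto
      have sparse': "count_sparse D (E\<^sub>0 \<union> {x, y, z})" if "{x, y, z} = S" for x y z
        using sparse E(1) that by simp
      have sign': "flip (D e) * flip (D e) = 1" if "{x, y, z} = S" "e \<in> E\<^sub>0 \<union> {x, y, z}" for x y z e
        using sign E(1) that by simp
      show ?thesis
      proof (cases "dst (D a) = dst (D b) \<and> dst (D a) = dst (D c)")
        case False
        have "\<exists>p. indep_at D (E\<^sub>0 \<union> {a, b, c}) p"
          by (rule degree_three_step[OF IH' finE0 v0 _ _ _ abc(2-4) _ _ _ _ _ _ sign' sparse' ind0 False])
            (use props abc in auto)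
        then show ?thesis using E(1) abc(1) by simp
      next
        case True
        let ?w = "dst (D a)"
        have step: "\<exists>p. indep_at D E p"
          if "{x, y, z} = S" "x \<noteq> y" "x \<noteq> z" "y \<noteq> z" "flip (D y) = - flip (D x)" "flip (D z) = flip (D x)" for x y z
        proof -
          have mem: "e = a \<or> e = b \<or> e = c" if "e = x \<or> e = y \<or> e = z" for e
            using that \<open>{x, y, z} = S\<close> abc(1) by blast
          have "dst (D e) = ?w" if "e = x \<or> e = y \<or> e = z" for e using mem[OF that] True by auto
          note pr = props[OF mem] this
          have "\<exists>p. indep_at D (E\<^sub>0 \<union> {x, y, z}) p"
            by (rule triple_edge_step[OF IH' finE0 v0 _ _ _ that(2-4) _ _ _ _ _ _ _ sign'[OF that(1)] that(5,6) sparse'[OF that(1)]])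
              (use pr props(3)[of a] in auto)
          then show ?thesis using E(1) that(1) by simp
        qed
        have "flip (D x) = 1 \<or> flip (D x) = - 1" if "x \<in> S" for x
          using sign[OF S_E(1)[OF that]] by (simp add: square_eq_1_iff)
        then have fl: "flip (D a) = 1 \<or> flip (D a) = - 1" "flip (D b) = 1 \<or> flip (D b) = - 1"
          "flip (D c) = 1 \<or> flip (D c) = - 1" using abc(1) by simp_all
        have "\<not> (flip (D b) = flip (D a) \<and> flip (D c) = flip (D a))"
          by (rule sparse_triple_flips[OF sparse _ abc(2-4), where v = v and w = ?w])
            (use S_E abc(1) True props sign in auto)
        \<comment> \<open>Two possible signs on three edges, not all equal, leave one odd edge; it
          takes the middle place in \<open>step\<close>.\<close>
        then consider "flip (D b) = - flip (D a)" "flip (D c) = flip (D a)"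
          | "flip (D c) = - flip (D a)" "flip (D b) = flip (D a)"
          | "flip (D a) = - flip (D b)" "flip (D c) = flip (D b)"
          using fl by fastforce
        then show ?thesis
        proof cases
          case 1
          then show ?thesis using step[of a b c] abc by simp
        next
          case 2
          then show ?thesis using step[of a c b] abc by (simp add: insert_commute)
        next
          case 3
          then show ?thesis using step[of b a c] abc by (simp add: insert_commute)
        qed
      qed
    qed
  qed
qed

theorem count_sparse_imp_indep:
  fixes D :: "'e \<Rightarrow> 'v gain_edge"
  assumes "finite E" "\<And>e. e \<in> E \<Longrightarrow> flip (D e) * flip (D e) = 1" "count_sparse D E"
  shows "\<exists>p. indep_at D E p"
  using assms
proof (induction "card E" arbitrary: D E rule: less_induct)
  case less
  show ?case
  proof (cases "E = {}")
    case True
    then have "indep_at D E (\<lambda>_. 0)" by (simp add: indep_at_def rows_independent_def)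
    then show ?thesis by blast
  next
    case False
    obtain v where v: "v \<in> ends D E" "card {e\<in>E. src (D e) = v} + card {e\<in>E. dst (D e) = v} \<le> 3"
      using exists_low_degree[OF less.prems(3,1) False] by blast
    \<comment> \<open>Edges ending at \<open>v\<close> are turned around so that all edges at
      \<open>v\<close> start there. Loops at \<open>v\<close> are reversed too, which keeps them
      loops.\<close>
    define D' where "D' e = (if dst (D e) = v then reversed (D e) else D e)" for e
    have D': "D' e = D e \<or> D' e = reversed (D e)" for e by (simp add: D'_def)
    \<comment> \<open>The two summands of the degree change, but union and intersection of the
      incidence sets do not, and these determine the sum.\<close>
    have sets: "{e\<in>E. src (D' e) = v} \<union> {e\<in>E. dst (D' e) = v} = {e\<in>E. src (D e) = v} \<union> {e\<in>E. dst (D e) = v}"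
      "{e\<in>E. src (D' e) = v} \<inter> {e\<in>E. dst (D' e) = v} = {e\<in>E. src (D e) = v} \<inter> {e\<in>E. dst (D e) = v}"
      by (auto simp: D'_def reversed_def)
    have "\<exists>p. indep_at D' E p"
    proof (rule vertex_step[OF less.hyps])
      show "flip (D' e) * flip (D' e) = 1" if "e \<in> E" for e
        using less.prems(2)[OF that] by (simp add: D'_def reversed_def)
      show "count_sparse D' E"
        by (rule edge_conditions_reversed(1)[OF less.prems(2) D' less.prems(3)])
      show "v \<in> ends D' E" using v(1) by (auto simp: ends_def D'_def reversed_def)
      show "card {e\<in>E. src (D' e) = v} + card {e\<in>E. dst (D' e) = v} \<le> 3"
        using v(2) sets card_Un_Int[of "{e\<in>E. src (D e) = v}" "{e\<in>E. dst (D e) = v}"]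
          card_Un_Int[of "{e\<in>E. src (D' e) = v}" "{e\<in>E. dst (D' e) = v}"] less.prems(1) by simp
      show "src (D' e) = v" if "dst (D' e) = v" for e
        using that by (auto simp: D'_def reversed_def split: if_splits)
    qed (use less.prems(1) in auto)
    moreover have "indep_at D' E p = indep_at D E p" for p
      by (rule edge_conditions_reversed(2)[OF less.prems(2) D'])
    ultimately show ?thesis by simp
  qed
qed

section \<open>Coordinates of the group\<close>

text \<open>Evaluating at the vertical unit vector reads off the sign without choosing a
  decomposition of the isometry.\<close>

definition gain_flip :: "plane_map \<Rightarrow> real" where
  "gain_flip \<gamma> = \<gamma> (axis 2 1) $ 2 - \<gamma> 0 $ 2"

lemma pm_apply:
  assumes "\<gamma> \<in> carrier pm"
  shows "\<gamma> x $ 1 = x $ 1 + \<gamma> 0 $ 1" "\<gamma> x $ 2 = gain_flip \<gamma> * x $ 2 + \<gamma> 0 $ 2"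
    "gain_flip \<gamma> * gain_flip \<gamma> = 1"
proof -
  obtain t where "\<gamma> = (\<lambda>x. x + t) \<or> \<gamma> = (\<lambda>x. reflection x + t)"
    using assms by (auto simp: pm_carrier_iff)
  then show "\<gamma> x $ 1 = x $ 1 + \<gamma> 0 $ 1" "\<gamma> x $ 2 = gain_flip \<gamma> * x $ 2 + \<gamma> 0 $ 2"
    "gain_flip \<gamma> * gain_flip \<gamma> = 1"
    by (auto simp: gain_flip_def axis_def reflection_zero)
qed

lemma pm_mult: "\<gamma> \<otimes>\<^bsub>pm\<^esub> \<delta> = \<gamma> \<circ> \<delta>" and pm_one: "\<one>\<^bsub>pm\<^esub> = id"
  by (simp_all add: pm_def)

lemma pm_eqI:
  assumes "\<gamma> \<in> carrier pm" "\<delta> \<in> carrier pm" "gain_flip \<gamma> = gain_flip \<delta>" "\<gamma> 0 = \<delta> 0"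
  shows "\<gamma> = \<delta>"
proof
  fix x
  have "\<gamma> x $ 1 = \<delta> x $ 1" "\<gamma> x $ 2 = \<delta> x $ 2"
    using pm_apply(1,2)[OF assms(1), of x] pm_apply(1,2)[OF assms(2), of x] assms(3,4) by simp_all
  then show "\<gamma> x = \<delta> x" by (simp add: vec_eq_iff forall_2)
qed

lemma gain_flip_id [simp]: "gain_flip id = 1"
  by (simp add: gain_flip_def axis_def)

lemma gain_flip_comp:
  assumes "\<gamma> \<in> carrier pm" "\<delta> \<in> carrier pm"
  shows "gain_flip (\<gamma> \<circ> \<delta>) = gain_flip \<gamma> * gain_flip \<delta>"
  by (simp add: gain_flip_def[of "\<gamma> \<circ> \<delta>"] pm_apply(2)[OF assms(1), of "\<delta> _"]
      pm_apply(2)[OF assms(2), of "axis 2 1"] algebra_simps)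

lemma pm_inv_closed: "\<gamma> \<in> carrier pm \<Longrightarrow> inv\<^bsub>pm\<^esub> \<gamma> \<in> carrier pm"
  by (rule group.inv_closed[OF group_pm])

lemma pm_inv_apply:
  assumes "\<gamma> \<in> carrier pm"
  shows "(inv\<^bsub>pm\<^esub> \<gamma>) (\<gamma> x) = x" "\<gamma> ((inv\<^bsub>pm\<^esub> \<gamma>) x) = x"
  using group.l_inv[OF group_pm assms] group.r_inv[OF group_pm assms]
  by (simp_all add: pm_mult pm_one fun_eq_iff)

lemma pm_inv_components:
  assumes "\<gamma> \<in> carrier pm"
  shows "(inv\<^bsub>pm\<^esub> \<gamma>) x $ 1 = x $ 1 - \<gamma> 0 $ 1" "(inv\<^bsub>pm\<^esub> \<gamma>) x $ 2 = gain_flip \<gamma> * (x $ 2 - \<gamma> 0 $ 2)"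
    "gain_flip (inv\<^bsub>pm\<^esub> \<gamma>) = gain_flip \<gamma>"
proof -
  let ?y = "(inv\<^bsub>pm\<^esub> \<gamma>) x"
  have 1: "?y $ 1 + \<gamma> 0 $ 1 = x $ 1" and 2: "gain_flip \<gamma> * ?y $ 2 + \<gamma> 0 $ 2 = x $ 2"
    using pm_apply(1,2)[OF assms, of ?y] pm_inv_apply(2)[OF assms, of x] by simp_all
  have solve: "y = f * (x - b)" if "f * y + b = x" "f * f = 1" for f x y b :: real
  proof -
    have "x - b = f * y" using that(1) by simp
    then show ?thesis using that(2) by (simp add: mult.assoc[symmetric])
  qed
  show "?y $ 1 = x $ 1 - \<gamma> 0 $ 1" using 1 by simp
  show "?y $ 2 = gain_flip \<gamma> * (x $ 2 - \<gamma> 0 $ 2)" 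
    by (rule solve[OF 2 pm_apply(3)[OF assms]])
  have "gain_flip \<gamma> * gain_flip (inv\<^bsub>pm\<^esub> \<gamma>) = 1"
    using gain_flip_comp[OF assms pm_inv_closed[OF assms]] group.r_inv[OF group_pm assms]
    by (simp add: pm_mult pm_one)
  then show "gain_flip (inv\<^bsub>pm\<^esub> \<gamma>) = gain_flip \<gamma>"
    using solve[of "gain_flip \<gamma>" _ 0 1] pm_apply(3)[OF assms] by simp
qed

lemma pm_translations_iff: "\<gamma> \<in> pm_translations \<longleftrightarrow> \<gamma> \<in> carrier pm \<and> gain_flip \<gamma> = 1"
proof
  assume "\<gamma> \<in> pm_translations"
  then obtain t where "t \<in> int_lattice" "\<gamma> = (\<lambda>x. x + t)" by (auto simp: pm_translations_def)
  then show "\<gamma> \<in> carrier pm \<and> gain_flip \<gamma> = 1"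
    unfolding pm_carrier_iff by (auto simp: gain_flip_def axis_def)
next
  assume "\<gamma> \<in> carrier pm \<and> gain_flip \<gamma> = 1"
  then obtain t where t: "t \<in> int_lattice" "\<gamma> = (\<lambda>x. x + t) \<or> \<gamma> = (\<lambda>x. reflection x + t)"
    and f: "gain_flip \<gamma> = 1"
    by (auto simp: pm_carrier_iff)
  then show "\<gamma> \<in> pm_translations" by (auto simp: pm_translations_def gain_flip_def axis_def)
qed

lemma linear_part_components:
  assumes "\<gamma> \<in> carrier pm"
  shows "linear_part \<gamma> x $ 1 = x $ 1" "linear_part \<gamma> x $ 2 = gain_flip \<gamma> * x $ 2"
  by (simp_all add: linear_part_def pm_apply(1,2)[OF assms, of x])

section \<open>Orbit matrix and symmetric rigidity in coordinates\<close>

definition to_edge :: "('v, 'e) pre_digraph \<Rightarrow> ('e \<Rightarrow> plane_map) \<Rightarrow> 'e \<Rightarrow> 'v gain_edge" where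
  "to_edge G m e = Edge (tail G e) (head G e) (gain_flip (m e)) (m e 0 $ 1) (m e 0 $ 2)"

lemma to_edge_sel [simp]:
  "src (to_edge G m e) = tail G e" "dst (to_edge G m e) = head G e"
  "flip (to_edge G m e) = gain_flip (m e)" "shx (to_edge G m e) = m e 0 $ 1"
  "shy (to_edge G m e) = m e 0 $ 2"
  by (simp_all add: to_edge_def)

lemma edge_to_edge:
  assumes "m e \<in> carrier pm"
  shows "edge_x (to_edge G m e) p = (p (tail G e) - m e (p (head G e))) $ 1"
    "edge_y (to_edge G m e) p = (p (tail G e) - m e (p (head G e))) $ 2"
  by (simp_all add: edge_x_def edge_y_def pm_apply(1,2)[OF assms, of "p (head G e)"])

lemma edge_pair_to_edge:
  assumes "m e \<in> carrier pm"
  shows "edge_pair (to_edge G m e) p w = (p (tail G e) - m e (p (head G e))) \<bullet>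
    (vector [w (tail G e, 1), w (tail G e, 2)] - linear_part (m e) (vector [w (head G e, 1), w (head G e, 2)]))"
  by (simp add: edge_pair_def edge_to_edge[where m = m and e = e, OF assms] inner_vec_def sum_2 linear_part_components[OF assms])

context pm_gain_graph
begin

abbreviation D :: "'e \<Rightarrow> 'v gain_edge" where "D \<equiv> to_edge G m"

lemma gain_flip_square: "e \<in> arcs G \<Longrightarrow> flip (D e) * flip (D e) = 1"
  using pm_apply(3)[OF gain_in_pm] by simp

lemma ends_subset_verts: "ends D (arcs G) \<subseteq> verts G"
  by (auto simp: ends_def)

text \<open>Since the sign squares to one, the inverse gain has explicit coordinates, and both the
  loop row and the ordinary row take the form of \<open>edge_row\<close>.\<close>

lemma orbit_matrix_eq:
  assumes "e \<in> arcs G"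
  shows "orbit_matrix G m p e j = edge_row (D e) p j"
proof -
  obtain v k where j: "j = (v, k)" by fastforce
  note g = gain_in_pm[OF assms]
  have "k = 1 \<or> k = 2" by (rule exhaust_2)
  then show ?thesis
  proof
    assume k: "k = 1"
    then show ?thesis
      by (simp add: j orbit_matrix_def Let_def edge_row_def edge_x_def pm_apply(1)[OF g, of "p _"]
          pm_inv_components[OF g])
  next
    assume k: "k = 2"
    define f b y z where "f = gain_flip (m e)" and "b = m e 0 $ 2"
      and "y = p (tail G e) $ 2" and "z = p (head G e) $ 2"
    have sq: "f * f = 1" unfolding f_def by (rule pm_apply(3)[OF g])
    have row: "edge_row (D e) p j = (y - f * z - b) * (of_bool (v = tail G e) - f * of_bool (v = head G e))"
      by (simp add: j k edge_row_def edge_y_def f_def b_def y_def z_def)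
    have om: "orbit_matrix G m p e j =
        (if tail G e = head G e then (if v = tail G e then 2 * y - (f * y + b) - f * (y - b) else 0)
         else if v = tail G e then y - (f * z + b) else if v = head G e then z - f * (y - b) else 0)"
      by (simp add: j k orbit_matrix_def Let_def pm_apply(2)[OF g, of "p _"] pm_inv_components[OF g]
          f_def b_def y_def z_def)
    consider "tail G e = head G e" "v = tail G e" | "tail G e = head G e" "v \<noteq> tail G e"
      | "tail G e \<noteq> head G e" "v = tail G e" | "tail G e \<noteq> head G e" "v = head G e"
      | "v \<noteq> tail G e" "v \<noteq> head G e" by blast
    then show ?thesis
    proof cases
      case 1
      have "2 * y - (f * y + b) - f * (y - b) = (y - f * y - b) * (1 - f)" using sq by algebra
      moreover have "z = y" using 1 by (simp add: y_def z_def)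
      ultimately show ?thesis unfolding row om using 1 by simp
    next
      case 4
      have "z - f * (y - b) = (y - f * z - b) * (0 - f * 1)" using sq by algebra
      then show ?thesis unfolding row om using 4 by simp
    qed (simp_all add: row om)
  qed
qed

lemma orbit_rows_independent_iff:
  "rows_independent (orbit_matrix G m p) (arcs G) (orbit_cols G) \<longleftrightarrow> indep_at D (arcs G) p"
  unfolding indep_at_columns[OF ends_subset_verts]
  by (rule rows_independent_cong) (rule orbit_matrix_eq)

lemma derived_arcD:
  assumes "((u, \<gamma>), (v, \<delta>)) \<in> parcs (derived_graph G m)"
  obtains e where "e \<in> arcs G" "\<gamma> \<in> carrier pm" "\<delta> \<in> carrier pm"
    "tail G e = u \<and> head G e = v \<and> \<delta> = \<gamma> \<circ> m e \<or> head G e = u \<and> tail G e = v \<and> \<gamma> = \<delta> \<circ> m e"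
proof -
  obtain e where e: "e \<in> arcs G" "\<gamma> \<in> carrier pm" "\<delta> \<in> carrier pm"
    and alt: "tail G e = u \<and> head G e = v \<and> m e = inv\<^bsub>pm\<^esub> \<gamma> \<otimes>\<^bsub>pm\<^esub> \<delta> \<or>
       head G e = u \<and> tail G e = v \<and> inv\<^bsub>pm\<^esub> (m e) = inv\<^bsub>pm\<^esub> \<gamma> \<otimes>\<^bsub>pm\<^esub> \<delta>"
    using assms by (auto simp: derived_graph_def)
  have "\<delta> = \<gamma> \<circ> m e" if "m e = inv\<^bsub>pm\<^esub> \<gamma> \<otimes>\<^bsub>pm\<^esub> \<delta>"
    unfolding that by (simp add: fun_eq_iff pm_mult pm_inv_apply[OF e(2)])
  moreover have "\<gamma> = \<delta> \<circ> m e" if i: "inv\<^bsub>pm\<^esub> (m e) = inv\<^bsub>pm\<^esub> \<gamma> \<otimes>\<^bsub>pm\<^esub> \<delta>"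
  proof
    fix x
    have "(inv\<^bsub>pm\<^esub> \<gamma>) (\<delta> (m e x)) = x"
      using fun_cong[OF i, of "m e x"] pm_inv_apply(1)[OF gain_in_pm[OF e(1)], of x] by (simp add: pm_mult)
    then show "\<gamma> x = (\<delta> \<circ> m e) x" using pm_inv_apply(2)[OF e(2), of "\<delta> (m e x)"] by simp
  qed
  ultimately show ?thesis using that e alt by blast
qed

lemma derived_arcI:
  assumes "e \<in> arcs G"
  shows "((tail G e, id), (head G e, m e)) \<in> parcs (derived_graph G m)"
proof -
  have "id \<in> carrier pm" "inv\<^bsub>pm\<^esub> id = id"
    using monoid.one_closed[OF group.is_monoid[OF group_pm]] monoid.inv_one[OF group.is_monoid[OF group_pm]]
    by (simp_all add: pm_one)
  then show ?thesis
    using assms gain_in_pm[OF assms] by (auto simp: derived_graph_def pm_mult)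
qed

text \<open>Group elements are injective, so one representative of each orbit of edges
  suffices.\<close>

lemma configuration_iff:
  "configuration G m p \<longleftrightarrow> (\<forall>e\<in>arcs G. p (tail G e) \<noteq> m e (p (head G e)))"
proof
  assume c: "configuration G m p"
  show "\<forall>e\<in>arcs G. p (tail G e) \<noteq> m e (p (head G e))"
  proof
    fix e assume "e \<in> arcs G"
    from derived_arcI[OF this] show "p (tail G e) \<noteq> m e (p (head G e))"
      using c by (auto simp: configuration_def lift_conf_def)
  qed
next
  assume r: "\<forall>e\<in>arcs G. p (tail G e) \<noteq> m e (p (head G e))"
  have inj: "\<gamma> x \<noteq> \<gamma> y" if "\<gamma> \<in> carrier pm" "x \<noteq> y" for \<gamma> x y
    using pm_inv_apply(1)[OF that(1)] that(2) by metis
  show "configuration G m p"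
    unfolding configuration_def
  proof
    fix xy assume xy: "xy \<in> parcs (derived_graph G m)"
    obtain x \<gamma> y \<delta> where xy_eq: "xy = ((x, \<gamma>), (y, \<delta>))" by (metis surj_pair)
    obtain e where e: "e \<in> arcs G" "\<gamma> \<in> carrier pm" "\<delta> \<in> carrier pm"
      "tail G e = x \<and> head G e = y \<and> \<delta> = \<gamma> \<circ> m e \<or> head G e = x \<and> tail G e = y \<and> \<gamma> = \<delta> \<circ> m e"
      using derived_arcD xy unfolding xy_eq by metis
    have "\<gamma> (p (tail G e)) \<noteq> \<gamma> (m e (p (head G e)))" "\<delta> (p (tail G e)) \<noteq> \<delta> (m e (p (head G e)))"
      using inj e(2,3) r e(1) by blast+
    then have "\<gamma> (p x) \<noteq> \<delta> (p y)" using e(4) by auto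
    then show "case xy of (x, y) \<Rightarrow> lift_conf p x \<noteq> lift_conf p y"
      by (simp add: xy_eq lift_conf_def)
  qed
qed

text \<open>The ends of an ordinary edge are separated by moving its tail. For a loop this needs a
  gain other than the identity: a reflecting gain moves points off its axis and a translation moves
  every point.\<close>

lemma configurations_generic:
  "generic_property (configuration G m) \<and> (\<exists>p. configuration G m p)"
proof -
  let ?f = "\<lambda>e p. edge_x (D e) p * edge_x (D e) p + edge_y (D e) p * edge_y (D e) p"
  have iff: "?f e p \<noteq> 0 \<longleftrightarrow> p (tail G e) \<noteq> m e (p (head G e))" if "e \<in> arcs G" for e p
    using edge_to_edge[where G = G and p = p and m = m and e = e, OF gain_in_pm[OF that]]
    by (simp add: sum_squares_eq_zero_iff vec_eq_iff[of "p _"] forall_2)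
  have "generic_property (\<lambda>p. \<forall>e\<in>arcs G. ?f e p \<noteq> 0) \<and> (\<exists>p. \<forall>e\<in>arcs G. ?f e p \<noteq> 0)"
  proof (rule generic_property_finite_conj)
    fix e assume e: "e \<in> arcs G"
    show "generic_property (\<lambda>p. ?f e p \<noteq> 0)"
      by (intro generic_property_nonzero) (simp add: edge_x_def edge_y_def)
    note g = gain_in_pm[OF e]
    show "\<exists>p. ?f e p \<noteq> 0"
    proof (cases "tail G e = head G e")
      case False
      let ?p = "(\<lambda>_. 0)(tail G e := vec (m e 0 $ 1 + 1)) :: 'v \<Rightarrow> real^2"
      have "edge_x (D e) ?p \<noteq> 0" using False by (simp add: edge_x_def)
      then show ?thesis by (metis sum_squares_eq_zero_iff)
    next
      case True
      have "m e \<noteq> id" using loop_gain[OF e True] by (simp add: pm_one)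
      then have "gain_flip (m e) \<noteq> 1 \<or> m e 0 \<noteq> 0"
        using pm_eqI[OF g, of id] monoid.one_closed[OF group.is_monoid[OF group_pm]] by (auto simp: pm_one)
      then show ?thesis
      proof
        assume "gain_flip (m e) \<noteq> 1"
        then have "gain_flip (m e) = - 1" using pm_apply(3)[OF g] by (simp add: square_eq_1_iff)
        then have "edge_y (D e) (\<lambda>_. vec ((m e 0 $ 2 + 1) / 2)) \<noteq> 0"
          by (simp add: edge_y_def field_simps)
        then show ?thesis by (metis sum_squares_eq_zero_iff)
      next
        assume "m e 0 \<noteq> 0"
        then have "edge_x (D e) (\<lambda>_. 0) \<noteq> 0 \<or> edge_y (D e) (\<lambda>_. 0) \<noteq> 0"
          by (simp add: edge_x_def edge_y_def vec_eq_iff forall_2)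
        then show ?thesis by (metis sum_squares_eq_zero_iff)
      qed
    qed
  qed simp
  moreover have "configuration G m = (\<lambda>p. \<forall>e\<in>arcs G. ?f e p \<noteq> 0)"
    using iff by (simp add: configuration_iff fun_eq_iff)
  ultimately show ?thesis by simp
qed

lemma rank_eq_card_iff:
  fixes p defines "A \<equiv> orbit_matrix G m p"
  shows "matrix_rank A (arcs G) (orbit_cols G) \<le> card (arcs G)"
    "matrix_rank A (arcs G) (orbit_cols G) = card (arcs G) \<longleftrightarrow>
      rows_independent A (arcs G) (orbit_cols G)"
proof -
  let ?S = "{card F |F. F \<subseteq> arcs G \<and> rows_independent A F (orbit_cols G)}"
  have bound: "x \<le> card (arcs G)" if "x \<in> ?S" for x using that by (auto intro: card_mono)
  have fin: "finite ?S"
    unfolding finite_nat_set_iff_bounded_le by (intro exI[of _ "card (arcs G)"] ballI bound)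
  have "card {} \<in> ?S" by (intro CollectI exI[of _ "{}"]) (simp add: rows_independent_def)
  then have ne: "?S \<noteq> {}" by blast
  have mem: "Max ?S \<in> ?S" by (rule Max_in[OF fin ne])
  show le: "matrix_rank A (arcs G) (orbit_cols G) \<le> card (arcs G)"
    unfolding matrix_rank_def by (rule bound[OF mem])
  show "matrix_rank A (arcs G) (orbit_cols G) = card (arcs G) \<longleftrightarrow>
      rows_independent A (arcs G) (orbit_cols G)"
  proof
    assume "matrix_rank A (arcs G) (orbit_cols G) = card (arcs G)"
    then obtain F where "F \<subseteq> arcs G" "rows_independent A F (orbit_cols G)" "card F = card (arcs G)"
      using mem unfolding matrix_rank_def by auto
    then show "rows_independent A (arcs G) (orbit_cols G)"
      using card_subset_eq[OF finite_arcs] by metis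
  next
    assume "rows_independent A (arcs G) (orbit_cols G)"
    then have "card (arcs G) \<in> ?S" by blast
    then have "card (arcs G) \<le> Max ?S" by (rule Max_ge[OF fin])
    then show "matrix_rank A (arcs G) (orbit_cols G) = card (arcs G)"
      using le unfolding matrix_rank_def by simp
  qed
qed

text \<open>\<open>rigid\<close> and \<open>gain_independent\<close> quantify over all generic
  placements and would be vacuous without one. The rank is bounded by the number of edges, so a
  maximum is attained.\<close>

lemma generic_exists: "\<exists>p. generic G m p"
proof -
  let ?r = "\<lambda>p. matrix_rank (orbit_matrix G m p) (arcs G) (orbit_cols G)"
  obtain p0 where p0: "configuration G m p0" using configurations_generic by blast
  have "\<forall>q. configuration G m q \<longrightarrow> ?r q < Suc (card (arcs G))"
    by (intro allI impI le_imp_less_Suc rank_eq_card_iff(1))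
  then have "\<exists>p. configuration G m p \<and> (\<forall>q. configuration G m q \<longrightarrow> ?r q \<le> ?r p)"
    by (rule Lattices_Big.ex_has_greatest_nat[where P = "configuration G m" and f = ?r, OF p0])
  then show ?thesis unfolding generic_def .
qed

text \<open>The placement \<open>p\<close> may fail to be a configuration, so it is first replaced
  by one with the same independence; its full rank then forces full rank at every generic
  \<open>q\<close>.\<close>

lemma generic_indep:
  assumes "indep_at D (arcs G) p" "generic G m q"
  shows "indep_at D (arcs G) q"
proof -
  obtain c where "configuration G m c" using configurations_generic by blast
  then obtain r where r: "indep_at D (arcs G) r" "configuration G m r"
    by (rule generic_property_meet[OF generic_property_indep_at[OF finite_arcs]
          conjunct1[OF configurations_generic] assms(1)])
  then have "matrix_rank (orbit_matrix G m r) (arcs G) (orbit_cols G) = card (arcs G)"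
    unfolding rank_eq_card_iff(2) orbit_rows_independent_iff by simp
  then have "card (arcs G) \<le> matrix_rank (orbit_matrix G m q) (arcs G) (orbit_cols G)"
    using assms(2) r(2) unfolding generic_def by metis
  then have "matrix_rank (orbit_matrix G m q) (arcs G) (orbit_cols G) = card (arcs G)"
    using rank_eq_card_iff(1)[of q] by simp
  then show ?thesis unfolding rank_eq_card_iff(2) orbit_rows_independent_iff .
qed

text \<open>A symmetric motion is determined by its values at the identity copies, and these form a
  kernel vector. A trivial symmetric motion has no rotation, because its velocity is the same at all
  lattice translates of a vertex, and symmetry under the reflection removes the vertical
  translation.\<close>

lemma inf_rigid_iff:
  "symmetrically_inf_rigid G m p \<longleftrightarrow>
    (\<forall>w. in_kernel D (arcs G) p w \<longrightarrow> (\<exists>b. \<forall>v\<in>verts G. w (v, 1) = b \<and> w (v, 2) = 0))"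
proof
  assume rigid: "symmetrically_inf_rigid G m p"
  show "\<forall>w. in_kernel D (arcs G) p w \<longrightarrow> (\<exists>b. \<forall>v\<in>verts G. w (v, 1) = b \<and> w (v, 2) = 0)"
  proof (intro allI impI)
    fix w assume w: "in_kernel D (arcs G) p w"
    define W where "W v = (vector [w (v, 1), w (v, 2)] :: real^2)" for v
    define u where "u = (\<lambda>(v, \<gamma>). linear_part \<gamma> (W v))"
    \<comment> \<open>The linear part of \<gamma> is orthogonal, so the condition on any copy of an
      edge reduces to the copy at the identity.\<close>
    have arc: "(\<gamma> (p (tail G e)) - (\<gamma> \<circ> m e) (p (head G e))) \<bullet>
        (linear_part \<gamma> (W (tail G e)) - linear_part (\<gamma> \<circ> m e) (W (head G e))) = 0"
      if e: "e \<in> arcs G" and \<gamma>: "\<gamma> \<in> carrier pm" for e \<gamma>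
    proof -
      note g = gain_in_pm[OF e]
      have c: "\<gamma> \<circ> m e \<in> carrier pm"
        using monoid.m_closed[OF group.is_monoid[OF group_pm] \<gamma> g] by (simp add: pm_mult)
      have "edge_pair (D e) p w = 0" using w e by (simp add: in_kernel_def)
      then have z: "(p (tail G e) - m e (p (head G e))) $ 1 * (W (tail G e) $ 1 - W (head G e) $ 1)
          + (p (tail G e) - m e (p (head G e))) $ 2 * (W (tail G e) $ 2 - gain_flip (m e) * W (head G e) $ 2) = 0"
        by (simp add: edge_pair_def edge_to_edge[where m = m and e = e, OF g] W_def)
      let ?f = "gain_flip \<gamma>"
      have "(\<gamma> (p (tail G e)) - (\<gamma> \<circ> m e) (p (head G e))) \<bullet>
          (linear_part \<gamma> (W (tail G e)) - linear_part (\<gamma> \<circ> m e) (W (head G e)))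
        = (p (tail G e) - m e (p (head G e))) $ 1 * (W (tail G e) $ 1 - W (head G e) $ 1)
          + (?f * ?f) * ((p (tail G e) - m e (p (head G e))) $ 2 * (W (tail G e) $ 2 - gain_flip (m e) * W (head G e) $ 2))"
        by (simp add: inner_vec_def sum_2 linear_part_components[OF \<gamma>] linear_part_components[OF c]
            gain_flip_comp[OF \<gamma> g] pm_apply(1,2)[OF \<gamma>, of "p _"] pm_apply(1,2)[OF \<gamma>, of "m e _"] algebra_simps)
      then show ?thesis using z pm_apply(3)[OF \<gamma>] by simp
    qed
    have "symmetric_motion G m p u"
      unfolding symmetric_motion_def
    proof (intro conjI ballI)
      fix v \<gamma> show "u (v, \<gamma>) = linear_part \<gamma> (u (v, \<one>\<^bsub>pm\<^esub>))"
        by (simp add: u_def pm_one linear_part_def[of id])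
    next
      fix xy assume xy: "xy \<in> parcs (derived_graph G m)"
      obtain x \<gamma> y \<delta> where xy_eq: "xy = ((x, \<gamma>), (y, \<delta>))" by (metis surj_pair)
      obtain e where e: "e \<in> arcs G" "\<gamma> \<in> carrier pm" "\<delta> \<in> carrier pm"
        "tail G e = x \<and> head G e = y \<and> \<delta> = \<gamma> \<circ> m e \<or> head G e = x \<and> tail G e = y \<and> \<gamma> = \<delta> \<circ> m e"
        using derived_arcD xy unfolding xy_eq by metis
      have "(\<gamma> (p x) - \<delta> (p y)) \<bullet> (linear_part \<gamma> (W x) - linear_part \<delta> (W y)) = 0"
        using e(4)
      proof
        assume "tail G e = x \<and> head G e = y \<and> \<delta> = \<gamma> \<circ> m e"
        then show ?thesis using arc[OF e(1,2)] by auto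
      next
        assume "head G e = x \<and> tail G e = y \<and> \<gamma> = \<delta> \<circ> m e"
        then have "(\<delta> (p y) - \<gamma> (p x)) \<bullet> (linear_part \<delta> (W y) - linear_part \<gamma> (W x)) = 0"
          using arc[OF e(1,3)] by auto
        then show ?thesis by (metis inner_minus_left inner_minus_right minus_diff_eq minus_zero)
      qed
      then show "case xy of (x, y) \<Rightarrow> (lift_conf p x - lift_conf p y) \<bullet> (u x - u y) = 0"
        by (simp add: xy_eq lift_conf_def u_def)
    qed
    then have "trivial_motion G m p u" using rigid by (simp add: symmetrically_inf_rigid_def)
    then obtain A :: "real^2^2" and b where
      t: "\<And>v \<gamma>. v \<in> verts G \<Longrightarrow> \<gamma> \<in> carrier pm \<Longrightarrow> linear_part \<gamma> (W v) = A *v \<gamma> (p v) + b"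
      by (auto simp: trivial_motion_def derived_graph_def lift_conf_def u_def)
    define tr where "tr t = (\<lambda>x :: real^2. x + t)" for t
    have tr: "tr t \<in> carrier pm" if "t \<in> int_lattice" for t
      unfolding pm_carrier_iff tr_def using that by blast
    have refl: "reflection \<in> carrier pm"
      unfolding pm_carrier_iff using int_lattice_closed(1) by (intro bexI[of _ 0]) auto
    obtain v0 where v0: "v0 \<in> verts G" using verts_nonempty by blast
    have A0: "A *v t = 0" if "t \<in> int_lattice" for t
      using t[OF v0 tr[OF that]] t[OF v0 tr[OF int_lattice_closed(1)]]
      by (simp add: tr_def linear_part_def matrix_vector_right_distrib)
    have "A *v x = 0" for x
    proof -
      have "A *v axis 1 1 = 0" "A *v axis 2 1 = 0"
        by (rule A0; simp add: int_lattice_def axis_def)+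
      moreover have "x = x $ 1 *\<^sub>R axis 1 1 + x $ 2 *\<^sub>R axis 2 1"
        by (simp add: vec_eq_iff forall_2 axis_def)
      ultimately show ?thesis
        by (metis add_0 matrix_vector_mult_scaleR matrix_vector_right_distrib scaleR_zero_right)
    qed
    then have Wb: "linear_part \<gamma> (W v) = b" if "v \<in> verts G" "\<gamma> \<in> carrier pm" for v \<gamma>
      using t[OF that] by simp
    have "W v = b" if "v \<in> verts G" for v
      using Wb[OF that tr[OF int_lattice_closed(1)]] by (simp add: tr_def linear_part_def)
    moreover have "reflection b = b"
      using Wb[OF v0 refl] calculation[OF v0] by (simp add: linear_part_def reflection_zero)
    then have "b $ 2 = 0" by (metis reflection_nth(2) neg_equal_zero)
    ultimately have "w (v, 1) = b $ 1 \<and> w (v, 2) = 0" if "v \<in> verts G" for v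
      using that by (auto simp: W_def vec_eq_iff forall_2)
    then show "\<exists>b. \<forall>v\<in>verts G. w (v, 1) = b \<and> w (v, 2) = 0" by blast
  qed
next
  assume K: "\<forall>w. in_kernel D (arcs G) p w \<longrightarrow> (\<exists>b. \<forall>v\<in>verts G. w (v, 1) = b \<and> w (v, 2) = 0)"
  show "symmetrically_inf_rigid G m p"
    unfolding symmetrically_inf_rigid_def
  proof (intro allI impI)
    fix u assume u: "symmetric_motion G m p u"
    have lin: "u (v, \<gamma>) = linear_part \<gamma> (u (v, id))" if "v \<in> verts G" "\<gamma> \<in> carrier pm" for v \<gamma>
      using u that by (simp add: symmetric_motion_def pm_one)
    define w where "w = (\<lambda>(v, k). u (v, id) $ k)"
    have vec_w: "vector [w (v, 1), w (v, 2)] = u (v, id)" for v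
      by (simp add: w_def vec_eq_iff forall_2)
    have "in_kernel D (arcs G) p w"
      unfolding in_kernel_def
    proof
      fix e assume e: "e \<in> arcs G"
      have "(lift_conf p (tail G e, id) - lift_conf p (head G e, m e)) \<bullet> (u (tail G e, id) - u (head G e, m e)) = 0"
        using u derived_arcI[OF e] by (auto simp: symmetric_motion_def)
      then show "edge_pair (D e) p w = 0"
        using lin[OF head_in_verts[OF e] gain_in_pm[OF e]]
        by (simp add: edge_pair_to_edge[where m = m and e = e, OF gain_in_pm[OF e]] vec_w lift_conf_def)
    qed
    then obtain b where b: "\<And>v. v \<in> verts G \<Longrightarrow> u (v, id) $ 1 = b \<and> u (v, id) $ 2 = 0"
      using K by (fastforce simp: w_def)
    show "trivial_motion G m p u"
      unfolding trivial_motion_def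
    proof (intro exI conjI ballI)
      show "transpose (0 :: real^2^2) = - 0" by (simp add: transpose_def vec_eq_iff)
      fix x assume "x \<in> pverts (derived_graph G m)"
      then obtain v \<gamma> where x: "x = (v, \<gamma>)" "v \<in> verts G" "\<gamma> \<in> carrier pm"
        by (auto simp: derived_graph_def)
      show "u x = 0 *v lift_conf p x + vector [b, 0]"
        using lin[OF x(2,3)] b[OF x(2)]
        by (simp add: x(1) vec_eq_iff forall_2 linear_part_components[OF x(3)])
    qed
  qed
qed

end

section \<open>Walks and potentials\<close>

definition reverse_walk :: "('e \<times> bool) list \<Rightarrow> ('e \<times> bool) list" where
  "reverse_walk w = rev (map (\<lambda>(e, b). (e, \<not> b)) w)"

lemma gain_walk_append:
  "gain_walk G u w v \<Longrightarrow> gain_walk G v w' x \<Longrightarrow> gain_walk G u (w @ w') x"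
  by (induction w arbitrary: u) auto

lemma gain_walk_reverse:
  assumes "wf_digraph G" "gain_walk G u w v"
  shows "gain_walk G v (reverse_walk w) u"
  using assms(2)
proof (induction w arbitrary: u)
  case Nil
  then show ?case by (auto simp: reverse_walk_def)
next
  case (Cons a w)
  obtain e b where a: "a = (e, b)" by fastforce
  let ?x = "if b then head G e else tail G e"
  have e: "e \<in> arcs G" "u = (if b then tail G e else head G e)" and w: "gain_walk G ?x w v"
    using Cons.prems by (simp_all add: a)
  have "u \<in> verts G" using e assms(1) by (simp add: wf_digraph.tail_in_verts wf_digraph.head_in_verts)
  then have "gain_walk G ?x [(e, \<not> b)] u" using e by (cases b) auto
  from gain_walk_append[OF Cons.IH[OF w] this] show ?case by (simp add: a reverse_walk_def)
qed

lemma net_gain_append: "net_gain m (w @ w') = net_gain m w \<circ> net_gain m w'"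
proof (induction w)
  case (Cons a w)
  then show ?case by (cases a) (simp add: pm_mult comp_assoc)
qed (simp add: pm_one)

lemma net_gain_closed:
  assumes "\<And>e. e \<in> arcs G \<Longrightarrow> m e \<in> carrier pm" "gain_walk G u w v"
  shows "net_gain m w \<in> carrier pm"
  using assms(2)
proof (induction w arbitrary: u)
  case Nil
  then show ?case using monoid.one_closed[OF group.is_monoid[OF group_pm]] by simp
next
  case (Cons a w)
  obtain e b where a: "a = (e, b)" by fastforce
  have "m e \<in> carrier pm" "net_gain m w \<in> carrier pm" using Cons assms(1) by (auto simp: a)
  then show ?case
    using monoid.m_closed[OF group.is_monoid[OF group_pm]] pm_inv_closed by (simp add: a)
qed

lemma net_gain_reverse:
  assumes "\<And>e. e \<in> arcs G \<Longrightarrow> m e \<in> carrier pm" "gain_walk G u w v"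
  shows "net_gain m (reverse_walk w) \<circ> net_gain m w = id"
  using assms(2)
proof (induction w arbitrary: u)
  case Nil
  then show ?case by (simp add: reverse_walk_def pm_one)
next
  case (Cons a w)
  obtain e b where a: "a = (e, b)" by fastforce
  let ?x = "if b then head G e else tail G e"
  have e: "e \<in> arcs G" and w: "gain_walk G ?x w v" using Cons.prems by (simp_all add: a)
  have IH: "net_gain m (reverse_walk w) (net_gain m w x) = x" for x
    using fun_cong[OF Cons.IH[OF w], of x] by simp
  show ?case
    using IH pm_inv_apply[OF assms(1)[OF e]]
    by (simp add: a reverse_walk_def net_gain_append pm_mult pm_one fun_eq_iff)
qed

text \<open>\<open>h v\<close> is the net gain of a chosen walk to \<open>v\<close> from the root of
  its component. Walking to the tail of an edge, across it and back from its head is a closed walk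
  at the root, so the transported gain lies in the gain space there; \<open>k\<close> is the net
  gain of the way back.\<close>

lemma walk_lifts:
  assumes wf: "wf_digraph G" and gains: "\<And>e. e \<in> arcs G \<Longrightarrow> m e \<in> carrier pm"
  shows "\<exists>h. (\<forall>v\<in>verts G. h v \<in> carrier pm) \<and> (\<forall>e\<in>arcs G. \<exists>v\<in>verts G. \<exists>k\<in>carrier pm.
      k \<circ> h (head G e) = id \<and> h (tail G e) \<circ> m e \<circ> k \<in> gain_space G m v)"
proof -
  define R where "R u v = (\<exists>w. gain_walk G u w v)" for u v
  define root where "root v = (SOME u. R u v)" for v
  define wk where "wk v = (SOME w. gain_walk G (root v) w v)" for v
  define h where "h v = net_gain m (wk v)" for v
  have R_trans: "R u v \<Longrightarrow> R v x \<Longrightarrow> R u x" for u v x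
    unfolding R_def using gain_walk_append by fast
  have wk: "gain_walk G (root v) (wk v) v" if "v \<in> verts G" for v
  proof -
    have "R v v" unfolding R_def using that by (intro exI[of _ "[]"]) simp
    then have "R (root v) v" unfolding root_def by (rule someI)
    then have "\<exists>w. gain_walk G (root v) w v" by (simp add: R_def)
    then show ?thesis unfolding wk_def by (rule someI_ex)
  qed
  have hc: "h v \<in> carrier pm" if "v \<in> verts G" for v
    unfolding h_def by (rule net_gain_closed[OF gains wk[OF that]])
  show ?thesis
  proof (intro exI[of _ h] conjI ballI)
    fix e assume e: "e \<in> arcs G"
    let ?i = "tail G e" and ?j = "head G e"
    have ij: "?i \<in> verts G" "?j \<in> verts G"
      using e wf by (simp_all add: wf_digraph.tail_in_verts wf_digraph.head_in_verts)
    have "gain_walk G ?i [(e, True)] ?j" "gain_walk G ?j [(e, False)] ?i" using e ij by simp_all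
    then have "R ?i ?j" "R ?j ?i" unfolding R_def by blast+
    \<comment> \<open>Adjacent vertices define the same predicate, so the choice operator picks the
      same root.\<close>
    then have "R u ?i \<longleftrightarrow> R u ?j" for u using R_trans by blast
    then have root: "root ?i = root ?j" by (simp add: root_def)
    let ?k = "net_gain m (reverse_walk (wk ?j))"
    have rw: "gain_walk G ?j (reverse_walk (wk ?j)) (root ?j)"
      by (rule gain_walk_reverse[OF wf wk[OF ij(2)]])
    have k: "?k \<in> carrier pm" by (rule net_gain_closed[OF gains rw])
    have inv: "?k \<circ> h ?j = id" unfolding h_def by (rule net_gain_reverse[OF gains wk[OF ij(2)]])
    let ?w = "wk ?i @ [(e, True)] @ reverse_walk (wk ?j)"
    have "gain_walk G (root ?i) ?w (root ?i)"
    proof (rule gain_walk_append[OF wk[OF ij(1)]])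
      show "gain_walk G ?i ([(e, True)] @ reverse_walk (wk ?j)) (root ?i)" using rw e root by simp
    qed
    then have "net_gain m ?w \<in> gain_space G m (root ?i)"
      unfolding gain_space_def by (intro generate.incl) blast
    moreover have "net_gain m ?w = h ?i \<circ> m e \<circ> ?k"
      by (simp add: net_gain_append h_def pm_mult pm_one comp_assoc)
    moreover have "root ?i \<in> verts G"
    proof -
      have "gain_walk G ?i (reverse_walk (wk ?i)) (root ?i)"
        by (rule gain_walk_reverse[OF wf wk[OF ij(1)]])
      moreover have "gain_walk G u w v \<Longrightarrow> v \<in> verts G" for u w v
        by (induction w arbitrary: u) auto
      ultimately show ?thesis by blast
    qed
    ultimately show "\<exists>v\<in>verts G. \<exists>k\<in>carrier pm.
      k \<circ> h ?j = id \<and> h ?i \<circ> m e \<circ> k \<in> gain_space G m v"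
      using k inv by metis
  qed (rule hc)
qed

text \<open>The potential consists of the coordinates of \<open>h\<close>. A gain transported to a
  translation makes the signs compatible; one transported to the identity gives
  \<open>h (head G e) = h (tail G e) \<circ> m e\<close>, which also fixes the translation
  parts.\<close>

lemma gains_to_potential:
  assumes wf: "wf_digraph G" and gains: "\<And>e. e \<in> arcs G \<Longrightarrow> m e \<in> carrier pm"
  shows "purely_periodic G m \<Longrightarrow> \<exists>\<sigma> \<alpha> \<beta>. potential (to_edge G m) (arcs G) 2 \<sigma> \<alpha> \<beta>"
    "balanced G m \<Longrightarrow> \<exists>\<sigma> \<alpha> \<beta>. potential (to_edge G m) (arcs G) 3 \<sigma> \<alpha> \<beta>"
proof -
  have "\<exists>h. (\<forall>v\<in>verts G. h v \<in> carrier pm) \<and> (\<forall>e\<in>arcs G. \<exists>v\<in>verts G. \<exists>k\<in>carrier pm.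
      k \<circ> h (head G e) = id \<and> h (tail G e) \<circ> m e \<circ> k \<in> gain_space G m v)"
    by (rule walk_lifts[OF wf gains])
  then obtain h where H: "(\<forall>v\<in>verts G. h v \<in> carrier pm) \<and> (\<forall>e\<in>arcs G. \<exists>v\<in>verts G. \<exists>k\<in>carrier pm.
      k \<circ> h (head G e) = id \<and> h (tail G e) \<circ> m e \<circ> k \<in> gain_space G m v)"
    by (rule exE)
  have h: "h v \<in> carrier pm" if "v \<in> verts G" for v by (rule bspec[OF conjunct1[OF H] that])
  have closed: "\<exists>v\<in>verts G. \<exists>k\<in>carrier pm.
      k \<circ> h (head G e) = id \<and> h (tail G e) \<circ> m e \<circ> k \<in> gain_space G m v" if "e \<in> arcs G" for e
    by (rule bspec[OF conjunct2[OF H] that])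
  define \<sigma> where "\<sigma> v = (if v \<in> verts G then gain_flip (h v) else 1)" for v
  have sq: "\<sigma> v * \<sigma> v = 1" for v using pm_apply(3)[OF h] by (simp add: \<sigma>_def)
  have ij: "tail G e \<in> verts G" "head G e \<in> verts G" if "e \<in> arcs G" for e
    using that wf by (simp_all add: wf_digraph.tail_in_verts wf_digraph.head_in_verts)
  have signs: "\<sigma> (head G e) = \<sigma> (tail G e) * gain_flip (m e)"
    if e: "e \<in> arcs G" and k: "k \<in> carrier pm" "k \<circ> h (head G e) = id"
      and one: "gain_flip (h (tail G e) \<circ> m e \<circ> k) = 1" for e k
  proof -
    have c: "h (tail G e) \<circ> m e \<in> carrier pm"
      using monoid.m_closed[OF group.is_monoid[OF group_pm] h[OF ij(1)[OF e]] gains[OF e]] by (simp add: pm_mult)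
    have 1: "gain_flip (h (tail G e)) * gain_flip (m e) * gain_flip k = 1"
      using one gain_flip_comp[OF c k(1)] gain_flip_comp[OF h[OF ij(1)[OF e]] gains[OF e]] by simp
    have 2: "gain_flip k * gain_flip (h (head G e)) = 1"
      using gain_flip_comp[OF k(1) h[OF ij(2)[OF e]]] k(2) by simp
    have "a = b" if "b * x = 1" "x * a = 1" for a b x :: real
    proof -
      have "a = (b * x) * a" using that(1) by simp
      also have "\<dots> = b" using that(2) by (simp add: mult.assoc)
      finally show ?thesis .
    qed
    from this[OF 1 2] show ?thesis using ij[OF e] by (simp add: \<sigma>_def)
  qed
  show "\<exists>\<sigma> \<alpha> \<beta>. potential (to_edge G m) (arcs G) 2 \<sigma> \<alpha> \<beta>" if per: "purely_periodic G m"
  proof -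
    have "\<sigma> (head G e) = \<sigma> (tail G e) * gain_flip (m e)" if e: "e \<in> arcs G" for e
    proof -
      obtain v k where k: "v \<in> verts G" "k \<in> carrier pm" "k \<circ> h (head G e) = id"
        "h (tail G e) \<circ> m e \<circ> k \<in> gain_space G m v" using closed[OF e] by blast
      then have "h (tail G e) \<circ> m e \<circ> k \<in> pm_translations"
        using per by (auto simp: purely_periodic_def)
      then show ?thesis using signs[OF e k(2,3)] by (simp add: pm_translations_iff)
    qed
    \<comment> \<open>At level two the translation parts are unconstrained; \<sigma> merely fills
      their places.\<close>
    then have "potential (to_edge G m) (arcs G) 2 \<sigma> \<sigma> \<sigma>" by (simp add: potential_def sq)
    then show ?thesis by blast
  qed
  show "\<exists>\<sigma> \<alpha> \<beta>. potential (to_edge G m) (arcs G) 3 \<sigma> \<alpha> \<beta>" if bal: "balanced G m"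
  proof -
    have step: "h (head G e) = h (tail G e) \<circ> m e \<and> \<sigma> (head G e) = \<sigma> (tail G e) * gain_flip (m e)"
      if e: "e \<in> arcs G" for e
    proof -
      obtain v k where k: "v \<in> verts G" "k \<in> carrier pm" "k \<circ> h (head G e) = id"
        "h (tail G e) \<circ> m e \<circ> k \<in> gain_space G m v" using closed[OF e] by blast
      then have id: "h (tail G e) \<circ> m e \<circ> k = id"
        using bal by (auto simp: balanced_def pm_one)
      then have "h (tail G e) \<circ> m e = h (tail G e) \<circ> m e \<circ> (k \<circ> h (head G e))" using k(3) by simp
      also have "\<dots> = h (head G e)" using id by (metis comp_assoc id_comp)
      finally show ?thesis using signs[OF e k(2,3)] id by simp
    qed
    have "potential (to_edge G m) (arcs G) 3 \<sigma> (\<lambda>v. h v 0 $ 1) (\<lambda>v. h v 0 $ 2)"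
      unfolding potential_def
    proof (intro conjI allI impI ballI)
      fix e assume e: "e \<in> arcs G"
      note a = pm_apply(1,2)[OF h[OF ij(1)[OF e]], of "m e 0"]
      show "h (dst (to_edge G m e)) 0 $ 1 = h (src (to_edge G m e)) 0 $ 1 + shx (to_edge G m e)"
        using step[OF e] a by simp
      show "h (dst (to_edge G m e)) 0 $ 2 = h (src (to_edge G m e)) 0 $ 2
          + \<sigma> (src (to_edge G m e)) * shy (to_edge G m e)"
        using step[OF e] a ij[OF e] by (simp add: \<sigma>_def)
    qed (use sq step in simp_all)
    then show ?thesis by blast
  qed
qed

lemma gain_flip_ident [simp]: "gain_flip (\<lambda>x. x) = 1"
  using gain_flip_id by (simp add: id_def)

lemma gain_flip_one: "gain_flip \<one>\<^bsub>pm\<^esub> = 1" and pm_one_apply: "\<one>\<^bsub>pm\<^esub> x = x"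
  unfolding pm_one by simp_all

text \<open>The edge equations telescope. On a closed walk, cancelling \<open>\<sigma> u\<close>
  leaves a trivial sign, and at level three a trivial translation.\<close>

lemma potential_walk:
  assumes gains: "\<And>e. e \<in> arcs G \<Longrightarrow> m e \<in> carrier pm"
    and pot: "potential (to_edge G m) (arcs G) k \<sigma> \<alpha> \<beta>" and k: "2 \<le> k" and walk: "gain_walk G u w v"
  shows "\<sigma> v = \<sigma> u * gain_flip (net_gain m w) \<and>
    (3 \<le> k \<longrightarrow> \<alpha> v = \<alpha> u + net_gain m w 0 $ 1 \<and> \<beta> v = \<beta> u + \<sigma> u * net_gain m w 0 $ 2)"
  using walk
proof (induction w arbitrary: u)
  case Nil
  then show ?case by (simp add: gain_flip_one pm_one_apply)
next
  case (Cons a w)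
  obtain e b where a: "a = (e, b)" by fastforce
  let ?x = "if b then head G e else tail G e" and ?g = "if b then m e else inv\<^bsub>pm\<^esub> (m e)"
  have e: "e \<in> arcs G" and u: "u = (if b then tail G e else head G e)" and w: "gain_walk G ?x w v"
    using Cons.prems by (simp_all add: a)
  note g = gains[OF e]
  have gc: "?g \<in> carrier pm" using g pm_inv_closed by simp
  have nc: "net_gain m w \<in> carrier pm" by (rule net_gain_closed[OF gains w])
  have s: "\<sigma> (head G e) = \<sigma> (tail G e) * gain_flip (m e)"
    using pot k e by (simp add: potential_def)
  have sq: "gain_flip (m e) * gain_flip (m e) = 1" by (rule pm_apply(3)[OF g])
  have sx: "\<sigma> ?x = \<sigma> u * gain_flip ?g"
    using s sq by (simp add: u pm_inv_components[OF g])
  have x3: "\<alpha> ?x = \<alpha> u + ?g 0 $ 1 \<and> \<beta> ?x = \<beta> u + \<sigma> u * ?g 0 $ 2" if "3 \<le> k"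
  proof -
    have "\<alpha> (head G e) = \<alpha> (tail G e) + m e 0 $ 1" "\<beta> (head G e) = \<beta> (tail G e) + \<sigma> (tail G e) * m e 0 $ 2"
      using pot that e by (simp_all add: potential_def)
    then show ?thesis using s sq by (simp add: u pm_inv_components[OF g])
  qed
  have net: "net_gain m (a # w) = ?g \<circ> net_gain m w" by (simp add: a pm_mult)
  have "gain_flip (net_gain m (a # w)) = gain_flip ?g * gain_flip (net_gain m w)"
    unfolding net by (rule gain_flip_comp[OF gc nc])
  moreover have "net_gain m (a # w) 0 $ 1 = net_gain m w 0 $ 1 + ?g 0 $ 1"
    "net_gain m (a # w) 0 $ 2 = gain_flip ?g * net_gain m w 0 $ 2 + ?g 0 $ 2"
    unfolding net using pm_apply(1,2)[OF gc, of "net_gain m w 0"] by simp_all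
  ultimately show ?case
    using Cons.IH[OF w] sx x3 by (auto simp: algebra_simps)
qed

lemma potential_to_gains:
  assumes gains: "\<And>e. e \<in> arcs G \<Longrightarrow> m e \<in> carrier pm"
    and pot: "potential (to_edge G m) (arcs G) k \<sigma> \<alpha> \<beta>"
  shows "2 \<le> k \<Longrightarrow> purely_periodic G m" "3 \<le> k \<Longrightarrow> balanced G m"
proof -
  have nz: "\<sigma> v \<noteq> 0" for v by (rule potential_nonzero[OF pot])
  show "purely_periodic G m" if k: "2 \<le> k"
    unfolding purely_periodic_def
  proof (intro ballI subsetI)
    fix v \<gamma> assume "\<gamma> \<in> gain_space G m v"
    then show "\<gamma> \<in> pm_translations"
      unfolding gain_space_def pm_translations_iff
    proof (induction \<gamma> rule: generate.induct)
      case one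
      then show ?case using monoid.one_closed[OF group.is_monoid[OF group_pm]] by (simp add: gain_flip_one)
    next
      case (incl \<gamma>)
      then obtain w where w: "\<gamma> = net_gain m w" "gain_walk G v w v" by blast
      then show ?case using potential_walk[OF gains pot k w(2)] net_gain_closed[OF gains w(2)] nz by simp
    next
      case (inv \<gamma>)
      then obtain w where w: "\<gamma> = net_gain m w" "gain_walk G v w v" by blast
      have c: "\<gamma> \<in> carrier pm" unfolding w(1) by (rule net_gain_closed[OF gains w(2)])
      then show ?case
        using potential_walk[OF gains pot k w(2)] nz w(1) pm_inv_components(3)[OF c] pm_inv_closed[OF c] by simp
    next
      case (eng \<gamma> \<delta>)
      then have "\<gamma> \<in> carrier pm" "\<delta> \<in> carrier pm" by simp_all
      note f = gain_flip_comp[OF this] and c = monoid.m_closed[OF group.is_monoid[OF group_pm] this]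
      have "gain_flip \<gamma> * gain_flip \<delta> = 1" using eng.IH by simp
      then have "gain_flip (\<gamma> \<otimes>\<^bsub>pm\<^esub> \<delta>) = 1" using f by (simp only: pm_mult)
      then show ?case by (rule conjI[OF c])
    qed
  qed
  show "balanced G m" if k: "3 \<le> k"
    unfolding balanced_def
  proof (intro ballI equalityI subsetI)
    fix v \<gamma> assume "\<gamma> \<in> {\<one>\<^bsub>pm\<^esub>}"
    then show "\<gamma> \<in> gain_space G m v" by (simp add: gain_space_def generate.one)
  next
    fix v \<gamma> assume "\<gamma> \<in> gain_space G m v"
    moreover have id: "net_gain m w = \<one>\<^bsub>pm\<^esub>" if w: "gain_walk G v w v" for w
    proof (rule pm_eqI[OF net_gain_closed[OF gains w]])
      have k2: "2 \<le> k" using k by simp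
      note p = potential_walk[OF gains pot k2 w]
      show "gain_flip (net_gain m w) = gain_flip \<one>\<^bsub>pm\<^esub>" using p nz by (simp add: gain_flip_one)
      show "net_gain m w 0 = \<one>\<^bsub>pm\<^esub> 0" using p nz k by (simp add: pm_one_apply vec_eq_iff forall_2)
    qed (simp_all add: monoid.one_closed[OF group.is_monoid[OF group_pm]])
    ultimately show "\<gamma> \<in> {\<one>\<^bsub>pm\<^esub>}"
      unfolding gain_space_def
    proof (induction \<gamma> rule: generate.induct)
      case one
      then show ?case by simp
    next
      case (incl \<gamma>)
      then show ?case by blast
    next
      case (inv \<gamma>)
      then obtain w where "\<gamma> = net_gain m w" "gain_walk G v w v" by blast
      then have "\<gamma> = \<one>\<^bsub>pm\<^esub>" using id by simp
      then show ?case using monoid.inv_one[OF group.is_monoid[OF group_pm]] by simp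
    next
      case (eng \<gamma> \<delta>)
      then show ?case by (simp add: pm_one pm_mult)
    qed
  qed
qed

section \<open>Tightness as a count on edge sets\<close>

lemma sparseD:
  assumes "sparse k l G" "subgraph H G" "1 \<le> card (arcs H)"
  shows "card (arcs H) + l \<le> k * card (verts H)"
proof -
  have "int (card (arcs H)) \<le> int k * int (card (verts H)) - int l"
    using assms unfolding sparse_def by simp
  then have "int (card (arcs H) + l) \<le> int (k * card (verts H))" by simp
  then show ?thesis by (simp only: of_nat_le_iff)
qed

lemma sparseI:
  assumes "\<And>H. subgraph H G \<Longrightarrow> 1 \<le> card (arcs H) \<Longrightarrow> card (arcs H) + l \<le> k * card (verts H)"
  shows "sparse k l G"
  unfolding sparse_def
proof (intro allI impI)
  fix H assume "subgraph H G \<and> 1 \<le> card (arcs H)"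
  then have "int (card (arcs H) + l) \<le> int (k * card (verts H))"
    using assms by (simp only: of_nat_le_iff)
  then show "int (card (arcs H)) \<le> int k * int (card (verts H)) - int l" by simp
qed

context pm_gain_graph
begin

lemma subgraph_facts:
  assumes "subgraph H G"
  shows "arcs H \<subseteq> arcs G" "wf_digraph H" "to_edge H m = D" "ends D (arcs H) \<subseteq> verts H"
    "finite (verts H)" "\<And>e. e \<in> arcs H \<Longrightarrow> m e \<in> carrier pm"
proof -
  show sub: "arcs H \<subseteq> arcs G" and wf: "wf_digraph H" using assms by auto
  have comp: "tail H = tail G" "head H = head G" using assms by (auto simp: compatible_def)
  show "to_edge H m = D" by (simp add: to_edge_def fun_eq_iff comp)
  show "ends D (arcs H) \<subseteq> verts H"
    using wf_digraph.tail_in_verts[OF wf] wf_digraph.head_in_verts[OF wf] comp by (auto simp: ends_def)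
  have "verts H \<subseteq> verts G" using assms by (auto simp: subgraph_def)
  then show "finite (verts H)" using finite_verts by (rule finite_subset)
  show "\<And>e. e \<in> arcs H \<Longrightarrow> m e \<in> carrier pm" using sub gain_in_pm by blast
qed

text \<open>A potential restricts to every smaller edge set, and isolated vertices of
  \<open>K\<close> only enlarge the right side.\<close>

lemma count_sparse_subgraph:
  assumes "count_sparse D (arcs G)" "subgraph H G" "subgraph K H" "1 \<le> card (arcs K)"
    "potential D (arcs H) k \<sigma> \<alpha> \<beta>" "k \<le> 3"
  shows "card (arcs K) + k \<le> 2 * card (verts K)"
proof -
  have KG: "subgraph K G" using subgraph_trans[OF assms(3,2)] .
  have KH: "arcs K \<subseteq> arcs H" using assms(3) by auto
  have "arcs K \<noteq> {}" using assms(4) by auto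
  then have "card (arcs K) + defect D (arcs K) \<le> 2 * card (ends D (arcs K))"
    using count_sparseD[OF assms(1) subgraph_facts(1)[OF KG]] by blast
  moreover have "k \<le> defect D (arcs K)"
    by (rule defect_ge[OF potential_mono[OF assms(5) KH order_refl] assms(6)])
  moreover have "card (ends D (arcs K)) \<le> card (verts K)"
    by (rule card_mono[OF subgraph_facts(5,4)[OF KG]])
  ultimately show ?thesis by linarith
qed

lemma pm_tight_iff:
  "pm_tight G m \<longleftrightarrow> count_sparse D (arcs G) \<and> card (arcs G) + 1 = 2 * card (verts G)"
proof
  assume tight: "pm_tight G m"
  have "count_sparse D (arcs G)"
    unfolding count_sparse_def
  proof (intro allI impI)
    fix F assume F: "F \<subseteq> arcs G" "F \<noteq> {}"
    \<comment> \<open>The smallest subgraph carrying \<open>F\<close> gives the sharpest bound; the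
      defect of \<open>F\<close> decides which of the three sparsity conditions is applied to
      it.\<close>
    define H where "H = \<lparr>verts = ends D F, arcs = F, tail = tail G, head = head G\<rparr>"
    have wfH: "wf_digraph H" by unfold_locales (auto simp: H_def ends_def)
    have H: "subgraph H G"
      using F ends_subset_verts ends_mono[OF F(1), of D] wfH wf_digraph_axioms
      by (auto simp: subgraph_def H_def compatible_def)
    have HH: "subgraph H H" using wfH by (auto simp: subgraph_def compatible_def)
    have cF: "1 \<le> card (arcs H)" "arcs H = F" "verts H = ends D F"
      using F finite_subset[OF F(1) finite_arcs] by (auto simp: H_def Suc_le_eq card_gt_0_iff)
    obtain \<sigma> \<alpha> \<beta> where pot: "potential D F (defect D F) \<sigma> \<alpha> \<beta>" by (rule defect_potential)
    have potH: "potential (to_edge H m) (arcs H) (defect D F) \<sigma> \<alpha> \<beta>"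
      unfolding subgraph_facts(3)[OF H] cF(2) by (rule pot)
    note gains = potential_to_gains[where G = H and m = m, OF subgraph_facts(6)[OF H] potH]
    consider "defect D F = 1" | "defect D F = 2" | "defect D F = 3" using defect_cases[of D F] by blast
    then show "card F + defect D F \<le> 2 * card (ends D F)"
    proof cases
      case 1
      have "sparse 2 1 G" using tight by (simp add: pm_tight_def tight_def)
      from sparseD[OF this H cF(1)] show ?thesis by (simp add: cF 1)
    next
      case 2
      then have "sparse 2 2 H" using tight H gains(1) by (simp add: pm_tight_def)
      from sparseD[OF this HH cF(1)] show ?thesis by (simp add: cF 2)
    next
      case 3
      then have "sparse 2 3 H" using tight H gains(2) by (simp add: pm_tight_def)
      from sparseD[OF this HH cF(1)] show ?thesis by (simp add: cF 3)
    qed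
  qed
  moreover have "card (arcs G) + 1 = 2 * card (verts G)"
    using tight by (simp add: pm_tight_def tight_def)
  ultimately show "count_sparse D (arcs G) \<and> card (arcs G) + 1 = 2 * card (verts G)" by blast
next
  assume a: "count_sparse D (arcs G) \<and> card (arcs G) + 1 = 2 * card (verts G)"
  note sub = count_sparse_subgraph[OF conjunct1[OF a]]
  have GG: "subgraph G G" using wf_digraph_axioms by (auto simp: subgraph_def compatible_def)
  show "pm_tight G m"
    unfolding pm_tight_def tight_def
  proof (intro conjI allI impI)
    show "sparse 2 1 G"
    proof (rule sparseI)
      fix H assume "subgraph H G" "1 \<le> card (arcs H)"
      then show "card (arcs H) + 1 \<le> 2 * card (verts H)"
        by (rule sub[OF GG _ _ potential_trivial]) simp_all
    qed
    show "int (card (arcs G)) = int 2 * int (card (verts G)) - int 1" using a by linarith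
  next
    fix H assume H: "subgraph H G \<and> purely_periodic H m"
    have "\<exists>\<sigma> \<alpha> \<beta>. potential (to_edge H m) (arcs H) 2 \<sigma> \<alpha> \<beta>"
      by (rule gains_to_potential(1)[where G = H and m = m, OF subgraph_facts(2,6)[OF conjunct1[OF H]] conjunct2[OF H]])
    then obtain \<sigma> \<alpha> \<beta> where pot: "potential D (arcs H) 2 \<sigma> \<alpha> \<beta>"
      unfolding subgraph_facts(3)[OF conjunct1[OF H]] by blast
    show "sparse 2 2 H"
    proof (rule sparseI)
      fix K assume K: "subgraph K H" "1 \<le> card (arcs K)"
      show "card (arcs K) + 2 \<le> 2 * card (verts K)" by (rule sub[OF conjunct1[OF H] K pot]) simp
    qed
  next
    fix H assume H: "subgraph H G \<and> balanced H m"
    have "\<exists>\<sigma> \<alpha> \<beta>. potential (to_edge H m) (arcs H) 3 \<sigma> \<alpha> \<beta>"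
      by (rule gains_to_potential(2)[where G = H and m = m, OF subgraph_facts(2,6)[OF conjunct1[OF H]] conjunct2[OF H]])
    then obtain \<sigma> \<alpha> \<beta> where pot: "potential D (arcs H) 3 \<sigma> \<alpha> \<beta>"
      unfolding subgraph_facts(3)[OF conjunct1[OF H]] by blast
    show "sparse 2 3 H"
    proof (rule sparseI)
      fix K assume K: "subgraph K H" "1 \<le> card (arcs K)"
      show "card (arcs K) + 3 \<le> 2 * card (verts K)" by (rule sub[OF conjunct1[OF H] K pot]) simp
    qed
  qed
qed

text \<open>Rigidity says that the kernel is the line of horizontal translations. With independent
  rows this is the same as having one edge fewer than columns, so the two conditions separate into
  the count on subsets and the total number of edges.\<close>

lemma minimally_rigid_iff_pm_tight: "minimally_rigid G m \<longleftrightarrow> pm_tight G m"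
proof
  assume mr: "minimally_rigid G m"
  obtain p where p: "generic G m p" using generic_exists by blast
  have ind: "indep_at D (arcs G) p"
    using mr p by (simp add: minimally_rigid_def gain_independent_def orbit_rows_independent_iff)
  have sparse: "count_sparse D (arcs G)" by (rule indep_at_imp_count_sparse[OF finite_arcs ind])
  have rigid: "symmetrically_inf_rigid G m p" using mr p by (simp add: minimally_rigid_def rigid_def)
  have "2 * card (verts G) \<le> card (arcs G) + 1"
  proof (rule card_le_if_kernel_trivial[OF finite_arcs finite_verts ends_subset_verts])
    fix u assume "in_kernel D (arcs G) p u"
    then obtain b where "\<forall>v\<in>verts G. u (v, 1) = b \<and> u (v, 2) = 0"
      using rigid unfolding inf_rigid_iff by blast
    then have "trivial_on (verts G) 1 (\<lambda>_. 1) (\<lambda>_. 0) (\<lambda>_. 0) p u 0 b 0" by (simp add: trivial_on_def)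
    then show "\<exists>\<theta> b c. trivial_on (verts G) 1 (\<lambda>_. 1) (\<lambda>_. 0) (\<lambda>_. 0) p u \<theta> b c" by blast
  qed simp_all
  moreover have "card (arcs G) + 1 \<le> 2 * card (verts G)"
  \<comment> \<open>\<open>count_sparse\<close> says nothing about the empty edge set, for which the
    bound comes from the existence of a vertex.\<close>
  proof (cases "arcs G = {}")
    case True
    then show ?thesis using verts_nonempty finite_verts card_gt_0_iff[of "verts G"] by simp
  next
    case False
    then have "card (arcs G) + defect D (arcs G) \<le> 2 * card (ends D (arcs G))"
      by (rule count_sparseD[OF sparse order_refl])
    then show ?thesis
      using defect_cases[of D "arcs G"] card_mono[OF finite_verts ends_subset_verts] by linarith
  qed
  ultimately show "pm_tight G m" using sparse by (simp add: pm_tight_iff)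
next
  assume "pm_tight G m"
  then have sparse: "count_sparse D (arcs G)" and card: "card (arcs G) + 1 = 2 * card (verts G)"
    by (simp_all add: pm_tight_iff)
  obtain p where p: "indep_at D (arcs G) p"
    using count_sparse_imp_indep[OF finite_arcs gain_flip_square sparse] by blast
  have ind: "indep_at D (arcs G) q" if "generic G m q" for q by (rule generic_indep[OF p that])
  have "symmetrically_inf_rigid G m q" if q: "generic G m q" for q
    unfolding inf_rigid_iff
  proof (intro allI impI)
    fix w assume w: "in_kernel D (arcs G) q w"
    have "\<exists>\<theta> b c. trivial_on (verts G) 1 (\<lambda>_. 1) (\<lambda>_. 0) (\<lambda>_. 0) q w \<theta> b c"
      by (rule kernel_trivial[OF finite_arcs ind[OF q] finite_verts ends_subset_verts verts_nonempty
            potential_trivial _ w]) (use card in auto)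
    then show "\<exists>b. \<forall>v\<in>verts G. w (v, 1) = b \<and> w (v, 2) = 0" by (auto simp: trivial_on_def)
  qed
  then show "minimally_rigid G m"
    using ind by (simp add: minimally_rigid_def rigid_def gain_independent_def orbit_rows_independent_iff)
qed

end

theorem theorem3p2:
  fixes G :: "('v, 'e) pre_digraph" and m :: "'e \<Rightarrow> real^2 \<Rightarrow> real^2"
  assumes "pm_gain_graph G m"
  shows "minimally_rigid G m \<longleftrightarrow> pm_tight G m"
  using assms by (rule pm_gain_graph.minimally_rigid_iff_pm_tight)

end
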